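(* Let $k\ge1$ and let $\mathbf{n}=(n_1,\dots,n_k)$ and $\mathbf{a}=(a_1,\dots,a_k)$ be $k$-tuples of positive integers. Then $T(\mathbf{n};\mathbf{a};3)$ is true with exactly the following exceptions (up to simultaneous permutation of the entries of $\mathbf{n}$ and $\mathbf{a}$), in which it is false: \begin{itemize} \item $k=1$, $n_1\ge3$ and $\mathbf{a}=2$; \item $\mathbf{n}=(n_1,n_2)$ with $3\le n_1\le n_2$ and $\mathbf{a}=(1,1)$; \item $\mathbf{n}=(1,1)$ and $\mathbf{a}=(2,2)$; \item $\mathbf{n}=(1,1,n)$ with $n\ge3$ and $\mathbf{a}=(1,1,1)$; \item $\mathbf{n}=(1,1,1)$ and $\mathbf{a}=(1,1,2)$; \item $\mathbf{n}=(1,1,1,1)$ and $\mathbf{a}=(1,1,1,1)$. \end{itemize}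
   Context: We work over $\mathbb{C}$. For $k$-tuples $\mathbf{n},\mathbf{a}$ of positive integers, $\mathbb{P}^{\mathbf{n}}=\prod_{i=1}^k\mathbb{P}^{n_i}$ and $N=\prod_{i=1}^k\binom{n_i+a_i}{a_i}=\dim H^0(\mathbb{P}^{\mathbf{n}},\mathcal{O}(\mathbf{a}))$. For a zero-dimensional subscheme $Z\subset\mathbb{P}^{\mathbf{n}}$ put $h_{\mathbb{P}^{\mathbf{n}}}(Z,\mathbf{a})=\dim H^0(\mathcal{O}(\mathbf{a}))-\dim H^0(\mathcal{I}_Z(\mathbf{a}))$. A double point $p^2$ is the subscheme with ideal sheaf $\mathcal{I}_p^2$. The statement $T(\mathbf{n};\mathbf{a};s)$ is true if, for $Z$ a collection of $s$ general double points of $\mathbb{P}^{\mathbf{n}}$, $h_{\mathbb{P}^{\mathbf{n}}}(Z,\mathbf{a})=\min\{s(1+\sum_{i=1}^k n_i),\ N\}$; otherwise it is false. Equivalently (Terracini's lemma), $T(\mathbf{n};\mathbf{a};s)$ is true iff the $s$-th secant variety of the Segre-Veronese variety $X_{\mathbf{n},\mathbf{a}}\subset\mathbb{P}^{N-1}$ ($\mathbb{P}^{\mathbf{n}}$ embedded by $\mathcal{O}(\mathbf{a})$) has the expected dimension $\min\{N-1,s(1+\sum_i n_i)-1\}$. *)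

theory Defs
  imports Complex_Main "HOL-Library.FuncSet" "HOL-Library.Poly_Mapping"
    "HOL-Combinatorics.Permutations"
begin

text \<open>Multivariate polynomials over the complex numbers are finitely supported functions from
  monomials to coefficients, with the ring structure of \<open>HOL-Library.Poly_Mapping\<close>.\<close>

type_synonym 'v mpoly = "('v \<Rightarrow>\<^sub>0 nat) \<Rightarrow>\<^sub>0 complex"

definition mscale :: "complex \<Rightarrow> 'v mpoly \<Rightarrow> 'v mpoly" where
  "mscale c f = Poly_Mapping.single 0 c * f"

interpretation mpoly: vector_space "mscale :: complex \<Rightarrow> 'v mpoly \<Rightarrow> 'v mpoly"
proof
  fix a b :: complex and x y :: "'v mpoly"
  show "mscale a (x + y) = mscale a x + mscale a y"
    by (simp add: mscale_def algebra_simps)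
  show "mscale (a + b) x = mscale a x + mscale b x"
    by (simp add: mscale_def single_add algebra_simps)
  show "mscale a (mscale b x) = mscale (a * b) x"
    by (simp add: mscale_def mult_single flip: mult.assoc)
  show "mscale 1 x = x"
    by (simp add: mscale_def)
qed

definition meval :: "('v \<Rightarrow> complex) \<Rightarrow> 'v mpoly \<Rightarrow> complex" where
  "meval z f = (\<Sum>t\<in>Poly_Mapping.keys f.
     Poly_Mapping.lookup f t * (\<Prod>x\<in>Poly_Mapping.keys t. z x ^ Poly_Mapping.lookup t x))"

text \<open>The projective space of dimension \<open>m\<close>: nonzero vectors with coordinates \<open>0,\<dots>,m\<close>,
  modulo rescaling. Coordinates beyond \<open>m\<close> are set to 0.\<close>

definition nonzero_vectors :: "nat \<Rightarrow> (nat \<Rightarrow> complex) set" where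
  "nonzero_vectors m = {v. (\<exists>l\<le>m. v l \<noteq> 0) \<and> (\<forall>l>m. v l = 0)}"

definition proj_space :: "nat \<Rightarrow> (nat \<Rightarrow> complex) set set" where
  "proj_space m = nonzero_vectors m //
     {(v, w). v \<in> nonzero_vectors m \<and> w \<in> nonzero_vectors m \<and>
              (\<exists>c. c \<noteq> 0 \<and> w = (\<lambda>l. c * v l))}"

text \<open>The product of the projective spaces of dimension \<open>n i\<close>, over a finite index set \<open>I\<close>, which
  is kept abstract so that the same definitions also apply to powers of such a product. The
  homogeneous coordinates on factor \<open>i\<close> are the variables \<open>(i, 0), \<dots>, (i, n i)\<close>, and
  \<open>forms I n d\<close> is the space of forms of multidegree \<open>d\<close> in these, that is, the global sections
  of \<open>\<O>(d)\<close>.\<close>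

definition multiproj :: "'i set \<Rightarrow> ('i \<Rightarrow> nat) \<Rightarrow> ('i \<Rightarrow> (nat \<Rightarrow> complex) set) set" where
  "multiproj I n = (\<Pi>\<^sub>E i\<in>I. proj_space (n i))"

definition forms :: "'i set \<Rightarrow> ('i \<Rightarrow> nat) \<Rightarrow> ('i \<Rightarrow> nat) \<Rightarrow> ('i \<times> nat) mpoly set" where
  "forms I n d = {f. \<forall>t\<in>Poly_Mapping.keys f.
     Poly_Mapping.keys t \<subseteq> (SIGMA i:I. {..n i}) \<and>
     (\<forall>i\<in>I. (\<Sum>l\<le>n i. Poly_Mapping.lookup t (i, l)) = d i)}"

text \<open>For a form this does not depend on the representatives \<open>v\<close> of the point.\<close>

definition vanishes_at ::
  "'i set \<Rightarrow> ('i \<times> nat) mpoly \<Rightarrow> ('i \<Rightarrow> (nat \<Rightarrow> complex) set) \<Rightarrow> bool" where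
  "vanishes_at I f P \<longleftrightarrow> (\<forall>v. (\<forall>i\<in>I. v i \<in> P i) \<longrightarrow> meval (\<lambda>(i, l). v i l) f = 0)"

definition zariski_open ::
  "'i set \<Rightarrow> ('i \<Rightarrow> nat) \<Rightarrow> ('i \<Rightarrow> (nat \<Rightarrow> complex) set) set \<Rightarrow> bool" where
  "zariski_open I n U \<longleftrightarrow> (\<exists>E. E \<subseteq> (\<Union>d. forms I n d) \<and>
     U = {P \<in> multiproj I n. \<exists>f\<in>E. \<not> vanishes_at I f P})"

text \<open>A property holds for a general \<open>s\<close>-tuple of points if it holds on a nonempty Zariski open
  subset of the \<open>s\<close>-th power of the product space, which is itself a product of projective spaces,
  with factors indexed by pairs \<open>(j, i)\<close>; point \<open>j\<close> of the tuple \<open>P\<close> is \<open>\<lambda>i. P (j, i)\<close>.\<close>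

definition for_general_points ::
  "nat \<Rightarrow> 'i set \<Rightarrow> ('i \<Rightarrow> nat) \<Rightarrow> ((nat \<Rightarrow> 'i \<Rightarrow> (nat \<Rightarrow> complex) set) \<Rightarrow> bool) \<Rightarrow> bool" where
  "for_general_points s I n Q \<longleftrightarrow>
     (\<exists>U. zariski_open ({..<s} \<times> I) (\<lambda>(j, i). n i) U \<and> U \<noteq> {} \<and>
          (\<forall>P\<in>U. Q (\<lambda>j i. P (j, i))))"

text \<open>The multihomogeneous ideal of a point in the coordinate ring, as the linear span of the forms
  it contains, and the product of two ideals.\<close>

definition point_ideal ::
  "'i set \<Rightarrow> ('i \<Rightarrow> nat) \<Rightarrow> ('i \<Rightarrow> (nat \<Rightarrow> complex) set) \<Rightarrow> ('i \<times> nat) mpoly set" where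
  "point_ideal I n P = mpoly.span {f. (\<exists>d. f \<in> forms I n d) \<and> vanishes_at I f P}"

definition ideal_prod :: "'v mpoly set \<Rightarrow> 'v mpoly set \<Rightarrow> 'v mpoly set" where
  "ideal_prod A B = mpoly.span {f * g | f g. f \<in> A \<and> g \<in> B}"

text \<open>The form \<open>F\<close> is a section of the twisted ideal sheaf of the double point supported at \<open>P\<close>:
  its germ at \<open>P\<close> lies in the stalk there, the localization of the squared ideal. (At other points
  the stalk of the ideal sheaf is everything.)\<close>

definition in_double_point ::
  "'i set \<Rightarrow> ('i \<Rightarrow> nat) \<Rightarrow> ('i \<Rightarrow> (nat \<Rightarrow> complex) set) \<Rightarrow> ('i \<times> nat) mpoly \<Rightarrow> bool" where
  "in_double_point I n P F \<longleftrightarrow>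
     (\<exists>d. \<exists>G\<in>forms I n d. \<not> vanishes_at I G P \<and>
        G * F \<in> ideal_prod (point_ideal I n P) (point_ideal I n P))"

text \<open>Sections of \<open>\<I>\<^sub>Z(a)\<close> for \<open>Z\<close> the union of the double points supported at \<open>P 0, \<dots>, P (s - 1)\<close>.\<close>

definition double_points_sections ::
  "'i set \<Rightarrow> ('i \<Rightarrow> nat) \<Rightarrow> ('i \<Rightarrow> nat) \<Rightarrow> nat \<Rightarrow> (nat \<Rightarrow> 'i \<Rightarrow> (nat \<Rightarrow> complex) set) \<Rightarrow>
    ('i \<times> nat) mpoly set" where
  "double_points_sections I n a s P = {F \<in> forms I n a. \<forall>j<s. in_double_point I n (P j) F}"

definition hilbert_double_points ::
  "'i set \<Rightarrow> ('i \<Rightarrow> nat) \<Rightarrow> ('i \<Rightarrow> nat) \<Rightarrow> nat \<Rightarrow> (nat \<Rightarrow> 'i \<Rightarrow> (nat \<Rightarrow> complex) set) \<Rightarrow> int" where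
  "hilbert_double_points I n a s P =
     int (mpoly.dim (forms I n a)) - int (mpoly.dim (double_points_sections I n a s P))"

definition T_stmt :: "nat list \<Rightarrow> nat list \<Rightarrow> nat \<Rightarrow> bool" where
  "T_stmt n a s \<longleftrightarrow>
     for_general_points s {..<length n} (nth n) (\<lambda>P.
       hilbert_double_points {..<length n} (nth n) (nth a) s P =
       int (min (s * (1 + (\<Sum>i<length n. n ! i)))
                (\<Prod>i<length n. (n ! i + a ! i) choose (a ! i))))"

definition exceptional :: "nat list \<Rightarrow> nat list \<Rightarrow> bool" where
  "exceptional n a \<longleftrightarrow>
     (\<exists>n1\<ge>3. n = [n1] \<and> a = [2]) \<or>
     (\<exists>n1 n2. 3 \<le> n1 \<and> n1 \<le> n2 \<and> n = [n1, n2] \<and> a = [1, 1]) \<or>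
     (n = [1, 1] \<and> a = [2, 2]) \<or>
     (\<exists>m\<ge>3. n = [1, 1, m] \<and> a = [1, 1, 1]) \<or>
     (n = [1, 1, 1] \<and> a = [1, 1, 2]) \<or>
     (n = [1, 1, 1, 1] \<and> a = [1, 1, 1, 1])"

end

theory Submission
  imports Defs "Jordan_Normal_Form.Determinant"
begin

text \<open>A form lies in the double point at \<open>p\<close> iff it vanishes at \<open>p\<close> together with its first
  derivatives, so the Hilbert function is the rank of \<open>3 (1 + \<Sum>n\<^sub>i)\<close> functionals on forms. This
  rank is lower semicontinuous, so truth of \<open>T\<close> can be tested at one triple of points. Take
  \<open>e\<^sub>0\<close>, \<open>e\<^sub>1\<close> in every factor and, as third coordinate, \<open>e\<^sub>2\<close> in factors of dimension at least 2 and
  \<open>e\<^sub>0 + e\<^sub>1\<close> in the projective lines. There the functionals are coordinate functions up to the third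
  point, and with \<open>d\<^sub>A\<close>, \<open>d\<^sub>B\<close> the total degrees over the factors of dimension at least 2 and over the
  lines, they are independent as soon as \<open>2 d\<^sub>A + d\<^sub>B \<ge> 5\<close>. Among the few remaining cases the
  functionals have no common zero except in the listed exceptions, where unexpected forms exist:
  products of linear forms through the points, or products of \<open>(1, 1)\<close>-forms on pairs of lines
  through the points.\<close>

text \<open>The bound 5 comes from separating the third point from the other two. A functional at a
  point sees only the monomials that vanish there to order at most 1, so the functionals at the
  third point are isolated by monomials of order at least 2 at both \<open>e0\<close> and
  \<open>e1\<close>. A factor of dimension at least 2 adds its whole degree to both orders through
  the variable of index 2, whereas the degree of a line has only the indices 0 and 1 to go to and is
  split between the two orders. Derivatives along a line are read off from two neighbouring splits
  \<open>s\<close> and \<open>s + 1\<close>, so \<open>degA + s \<ge> 2\<close> and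
  \<open>degA + (degB - s - 1) \<ge> 2\<close> are both required, and the sum of the two is the
  bound. For falsity only a nonempty open set of triples is given. The line joining one of its
  triples to (1:0), (0:1), (1:1) in each factor meets it in a triple whose first two coordinates are
  pairwise independent in every factor. This is all the genericity that the unexpected forms use,
  and a single triple with too small a Hilbert function refutes the claim.\<close>

abbreviation lkp :: "('a \<Rightarrow>\<^sub>0 'b::zero) \<Rightarrow> 'a \<Rightarrow> 'b" where "lkp \<equiv> Poly_Mapping.lookup"
abbreviation pkeys :: "('a \<Rightarrow>\<^sub>0 'b::zero) \<Rightarrow> 'a set" where "pkeys \<equiv> Poly_Mapping.keys"
abbreviation psingle :: "'a \<Rightarrow> 'b::zero \<Rightarrow> 'a \<Rightarrow>\<^sub>0 'b" where "psingle \<equiv> Poly_Mapping.single"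

subsection \<open>Linear functionals and evaluation\<close>

lemma mpoly_monomials: "f = (\<Sum>t\<in>pkeys f. psingle t (lkp f t))"
  by (rule poly_mapping_eqI) (simp add: lookup_sum lookup_single when_def in_keys_iff)

lemma mscale_monomials: "mscale c f = (\<Sum>t\<in>pkeys f. psingle t (c * lkp f t))"
  by (subst mpoly_monomials) (simp add: mscale_def sum_distrib_left mult_single)

text \<open>\<open>g\<close> gives the values on monomials and \<open>h\<close> transports
  coefficients. With \<open>h\<close> the identity this is an arbitrary linear functional; with
  constants in \<open>complex poly\<close> it becomes substitution of one-variable
  polynomials.\<close>

definition lf :: "(('v \<Rightarrow>\<^sub>0 nat) \<Rightarrow> 'r::comm_semiring_0) \<Rightarrow> (complex \<Rightarrow> 'r) \<Rightarrow> 'v mpoly \<Rightarrow> 'r" where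
  "lf g h f = (\<Sum>t\<in>pkeys f. h (lkp f t) * g t)"

locale coeff_hom =
  fixes h :: "complex \<Rightarrow> 'r::comm_ring_1"
  assumes h_add: "h (x + y) = h x + h y" and h_mult: "h (x * y) = h x * h y"
    and h_one: "h 1 = 1"
begin

lemma h_zero: "h 0 = 0"
  using h_add[of 0 0] by simp

lemma lf_superset:
  assumes "finite T" "pkeys f \<subseteq> T"
  shows "lf g h f = (\<Sum>t\<in>T. h (lkp f t) * g t)"
  unfolding lf_def using assms
  by (intro sum.mono_neutral_left) (auto simp: in_keys_iff h_zero)

lemma lf_add: "lf g h (f1 + f2) = lf g h f1 + lf g h f2"
proof -
  let ?T = "pkeys f1 \<union> pkeys f2"
  have "pkeys (f1 + f2) \<subseteq> ?T" by (rule Poly_Mapping.keys_add)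
  then show ?thesis
    using lf_superset[of ?T f1] lf_superset[of ?T f2] lf_superset[of ?T "f1 + f2"]
    by (simp add: lookup_add h_add distrib_right sum.distrib)
qed

lemma lf_zero [simp]: "lf g h 0 = 0"
  by (simp add: lf_def)

lemma lf_sum: "lf g h (sum f A) = (\<Sum>x\<in>A. lf g h (f x))"
  by (induction A rule: infinite_finite_induct) (simp_all add: lf_add)

lemma lf_single [simp]: "lf g h (psingle t c) = h c * g t"
  by (simp add: lf_def h_zero)

lemma lf_mscale: "lf g h (mscale c f) = h c * lf g h f"
proof -
  have "lf g h (mscale c f) = (\<Sum>t\<in>pkeys f. h (c * lkp f t) * g t)"
    by (simp add: mscale_monomials lf_sum)
  then show ?thesis by (simp add: lf_def sum_distrib_left h_mult mult.assoc)
qed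

end

lemma mscale_single [simp]: "mscale c (psingle t d) = psingle t (c * d)"
  by (simp add: mscale_def mult_single)

lemma lookup_mscale [simp]: "lkp (mscale c f) t = c * lkp f t"
  unfolding mscale_monomials by (simp add: lookup_sum lookup_single when_def in_keys_iff)

lemma mscale_mult_left: "mscale c f * g = mscale c (f * g)"
  by (simp add: mscale_def mult.assoc)

lemma mscale_mult_right: "f * mscale c g = mscale c (f * g)"
  by (simp add: mscale_def mult.left_commute)

definition mev :: "('v \<Rightarrow> 'r::comm_ring_1) \<Rightarrow> ('v \<Rightarrow>\<^sub>0 nat) \<Rightarrow> 'r" where
  "mev z t = (\<Prod>x\<in>pkeys t. z x ^ lkp t x)"

lemma mev_superset: "finite T \<Longrightarrow> pkeys t \<subseteq> T \<Longrightarrow> mev z t = (\<Prod>x\<in>T. z x ^ lkp t x)"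
  unfolding mev_def by (intro prod.mono_neutral_left) (auto simp: in_keys_iff)

lemma mev_add: "mev z (s + t) = mev z s * mev z t"
proof -
  let ?T = "pkeys s \<union> pkeys t"
  have "pkeys (s + t) \<subseteq> ?T" by (rule Poly_Mapping.keys_add)
  then show ?thesis
    using mev_superset[of ?T s z] mev_superset[of ?T t z] mev_superset[of ?T "s + t" z]
    by (simp add: lookup_add power_add prod.distrib)
qed

lemma mev_zero [simp]: "mev z 0 = 1"
  by (simp add: mev_def)

lemma mev_single [simp]: "mev z (psingle x m) = z x ^ m"
  by (simp add: mev_def)

lemma mev_cong: "(\<And>x. x \<in> pkeys t \<Longrightarrow> z x = z' x) \<Longrightarrow> mev z t = mev z' t"
  by (simp add: mev_def)

context coeff_hom
begin

lemma lf_mult: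
  assumes g: "\<And>s t. g (s + t) = g s * g t"
  shows "lf g h (f1 * f2) = lf g h f1 * lf g h f2"
proof -
  have "f1 * f2 = (\<Sum>s\<in>pkeys f1. \<Sum>t\<in>pkeys f2. psingle (s + t) (lkp f1 s * lkp f2 t))"
    by (subst mpoly_monomials[of f1], subst mpoly_monomials[of f2])
      (simp add: sum_product mult_single)
  then have "lf g h (f1 * f2) = (\<Sum>s\<in>pkeys f1. \<Sum>t\<in>pkeys f2. h (lkp f1 s * lkp f2 t) * g (s + t))"
    by (simp add: lf_sum)
  also have "\<dots> = lf g h f1 * lf g h f2"
    by (simp add: lf_def sum_product h_mult g mult.assoc mult.left_commute)
  finally show ?thesis .
qed

lemma lf_one: "g 0 = 1 \<Longrightarrow> lf g h 1 = 1"
  by (simp add: h_one flip: single_one)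

end

interpretation cx: coeff_hom "\<lambda>c::complex. c"
  by unfold_locales auto

interpretation px: coeff_hom "\<lambda>c::complex. [:c:]"
  by unfold_locales auto

abbreviation clf :: "(('v \<Rightarrow>\<^sub>0 nat) \<Rightarrow> complex) \<Rightarrow> 'v mpoly \<Rightarrow> complex" where
  "clf g \<equiv> lf g (\<lambda>c. c)"

text \<open>Restriction of a polynomial to a parametrized curve. It serves twice: for first-order
  germs at a point, and for the line joining two triples of points.\<close>

definition pev :: "('v \<Rightarrow> complex poly) \<Rightarrow> 'v mpoly \<Rightarrow> complex poly" where
  "pev z = lf (mev z) (\<lambda>c. [:c:])"

lemma meval_eq: "meval z f = clf (mev z) f"
  by (simp add: meval_def lf_def mev_def)

lemma meval_add: "meval z (f + g) = meval z f + meval z g"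
  by (simp add: meval_eq cx.lf_add)
lemma meval_mult: "meval z (f * g) = meval z f * meval z g"
  by (simp add: meval_eq cx.lf_mult mev_add)
lemma meval_mscale: "meval z (mscale c f) = c * meval z f"
  by (simp add: meval_eq cx.lf_mscale)
lemma meval_zero [simp]: "meval z 0 = 0"
  by (simp add: meval_eq)
lemma meval_one [simp]: "meval z 1 = 1"
  by (simp add: meval_eq cx.lf_one)
lemma meval_sum: "meval z (sum f A) = (\<Sum>x\<in>A. meval z (f x))"
  by (simp add: meval_eq cx.lf_sum)
lemma meval_prod: "meval z (prod f A) = (\<Prod>x\<in>A. meval z (f x))"
  by (induction A rule: infinite_finite_induct) (simp_all add: meval_mult)
lemma meval_single [simp]: "meval z (psingle t c) = c * mev z t"
  by (simp add: meval_eq)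
lemma meval_diff: "meval z (f - g) = meval z f - meval z g"
  using meval_add[of z "f - g" g] by simp

interpretation meval_hom: comm_ring_hom "meval z" for z :: "'v \<Rightarrow> complex"
  by unfold_locales (simp_all add: meval_add meval_mult)

lemma pev_mult: "pev z (f * g) = pev z f * pev z g"
  by (simp add: pev_def px.lf_mult mev_add)
lemma pev_add: "pev z (f + g) = pev z f + pev z g"
  by (simp add: pev_def px.lf_add)
lemma pev_mscale: "pev z (mscale c f) = smult c (pev z f)"
  by (simp add: pev_def px.lf_mscale)

lemma poly_pev: "poly (pev z f) \<tau> = meval (\<lambda>x. poly (z x) \<tau>) f"
  by (simp add: pev_def meval_def lf_def poly_sum mev_def poly_prod poly_power)

lemma lf_cong: "(\<And>t. t \<in> pkeys f \<Longrightarrow> g t = g' t) \<Longrightarrow> lf g h f = lf g' h f"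
  by (simp add: lf_def)

lemma meval_cong:
  assumes "\<And>t x. t \<in> pkeys f \<Longrightarrow> x \<in> pkeys t \<Longrightarrow> z x = z' x"
  shows "meval z f = meval z' f"
  unfolding meval_eq by (rule lf_cong, rule mev_cong) (use assms in blast)

subsection \<open>First-order conditions at a point\<close>

text \<open>The derivative at \<open>z\<close> in direction \<open>w\<close> is the linear coefficient of the value at the
  polynomial vector \<open>[:z, w:]\<close>; the product rule is then multiplication of polynomials.\<close>

fun dmon :: "('v \<Rightarrow> complex) \<Rightarrow> 'v option \<Rightarrow> ('v \<Rightarrow>\<^sub>0 nat) \<Rightarrow> complex" where
  "dmon z None t = mev z t"
| "dmon z (Some x) t = of_nat (lkp t x) * mev z (t - psingle x 1)"

lemma coeff_pev_0: "coeff (pev (\<lambda>y. [:z y, w y:]) f) 0 = meval z f"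
  using poly_pev[of "\<lambda>y. [:z y, w y:]" f 0] by (simp add: poly_0_coeff_0)

lemma coeff_power_1: "coeff ([:a, 1:] ^ m) 1 = of_nat m * (a::complex) ^ (m - 1)"
proof (induction m)
  case (Suc m)
  have *: "coeff ([:a, 1:] ^ m) 0 = a ^ m"
    by (simp flip: poly_0_coeff_0 add: poly_power)
  have "coeff ([:a, 1:] ^ Suc m) 1 = a * coeff ([:a, 1:] ^ m) 1 + coeff ([:a, 1:] ^ m) 0"
    by (simp add: coeff_mult)
  also have "\<dots> = of_nat (Suc m) * a ^ (Suc m - 1)"
    using * Suc by (cases m) (auto simp: algebra_simps)
  finally show ?case .
qed simp

lemma mev_const_poly: "mev (\<lambda>y. [:z y:]) t = [:mev z t:]"
proof -
  have "mev (\<lambda>y. [:z y:]) t = (\<Prod>x\<in>pkeys t. [:z x ^ lkp t x:])"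
    unfolding mev_def by (simp add: poly_const_pow)
  also have "(\<Prod>x\<in>A. [:z x ^ lkp t x:]) = [:\<Prod>x\<in>A. z x ^ lkp t x:]" for A
    by (induction A rule: infinite_finite_induct) simp_all
  finally show ?thesis by (simp add: mev_def)
qed

text \<open>After the full power of \<open>x\<close> is split off, the remaining variables are
  constants and the linear coefficient comes from \<open>[:z x, 1:] ^ m\<close> alone. For
  \<open>m = 0\<close> both sides vanish, in \<open>dmon\<close> through the factor
  \<open>lkp t x\<close>.\<close>

lemma coeff_mev_1:
  "coeff (mev (\<lambda>y. [:z y, if y = x then 1 else 0:]) t) 1 = dmon z (Some x) t"
proof -
  define m s where "m = lkp t x" and "s = t - psingle x m"
  have t: "t = s + psingle x m"
    by (rule poly_mapping_eqI) (auto simp: s_def m_def lookup_add lookup_minus lookup_single when_def)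
  have sx: "lkp s x = 0" by (simp add: s_def m_def lookup_minus)
  have "mev (\<lambda>y. [:z y, if y = x then 1 else 0:]) s = mev (\<lambda>y. [:z y:]) s"
    by (rule mev_cong) (use sx in \<open>auto simp: in_keys_iff\<close>)
  then have "mev (\<lambda>y. [:z y, if y = x then 1 else 0:]) t = smult (mev z s) ([:z x, 1:] ^ m)"
    by (simp add: t mev_add mev_const_poly)
  then have "coeff (mev (\<lambda>y. [:z y, if y = x then 1 else 0:]) t) 1 = mev z s * (of_nat m * z x ^ (m - 1))"
    by (simp add: coeff_power_1 del: One_nat_def)
  also have "\<dots> = dmon z (Some x) t"
  proof (cases "m = 0")
    case False
    then have "t - psingle x 1 = s + psingle x (m - 1)"
      by (intro poly_mapping_eqI) (auto simp: t lookup_add lookup_minus lookup_single when_def)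
    then show ?thesis by (simp add: mev_add flip: m_def)
  qed (simp flip: m_def)
  finally show ?thesis .
qed

lemma coeff_pev_1:
  "coeff (pev (\<lambda>y. [:z y, if y = x then 1 else 0:]) f) 1 = clf (dmon z (Some x)) f"
  using coeff_mev_1[of z x] by (simp add: pev_def lf_def coeff_sum del: One_nat_def)

subsection \<open>Dimension bounds\<close>

context vector_space
begin

text \<open>In an infinite-dimensional space \<open>dim\<close> is not monotone, as an infinite
  basis has \<open>card\<close> 0. The finite set \<open>W\<close> guarantees a finite basis of
  \<open>K\<close>; monotonicity is the special case of empty \<open>T\<close>.\<close>

lemma dim_le_of_span_Un:
  assumes "V \<subseteq> span (K \<union> T)" "finite T" "K \<subseteq> span W" "finite W"
  shows "dim V \<le> dim K + card T"
proof -
  obtain B where B: "B \<subseteq> K" "independent B" "K \<subseteq> span B" "card B = dim K"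
    using basis_exists by blast
  have "finite B"
    using independent_span_bound[OF \<open>finite W\<close> B(2)] B(1) assms(3) by blast
  have "K \<union> T \<subseteq> span (B \<union> T)"
    using B(3) span_mono[of B "B \<union> T"] span_superset[of "B \<union> T"] by blast
  then have "V \<subseteq> span (B \<union> T)"
    using assms(1) span_minimal[OF _ subspace_span] by blast
  then have "dim V \<le> card (B \<union> T)"
    using \<open>finite B\<close> assms(2) by (intro dim_le_card) auto
  also have "\<dots> \<le> card B + card T" by (rule card_Un_le)
  finally show ?thesis by (simp add: B(4))
qed

lemma dim_mono_fin: "V \<subseteq> K \<Longrightarrow> K \<subseteq> span W \<Longrightarrow> finite W \<Longrightarrow> dim V \<le> dim K"
  using dim_le_of_span_Un[of V K "{}" W] span_superset[of K] by auto

lemma span_image_coeffs: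
  assumes "finite A" "x \<in> span (f ` A)"
  shows "\<exists>c. x = (\<Sum>a\<in>A. scale (c a) (f a))"
  using assms(2)
proof (induction rule: span_induct_alt)
  case base
  show ?case by (rule exI[of _ "\<lambda>_. 0"]) simp
next
  case (step a u v)
  then obtain p c where p: "p \<in> A" "u = f p" and c: "v = (\<Sum>q\<in>A. scale (c q) (f q))"
    by blast
  have "scale a u + v = (\<Sum>q\<in>A. scale ((if q = p then a else 0) + c q) (f q))"
    using p assms(1)
    by (simp add: c scale_left_distrib sum.distrib if_distrib[of "\<lambda>r. scale r _"] cong: if_cong)
  then show ?case by (intro exI[of _ "\<lambda>q. (if q = p then a else 0) + c q"]) simp
qed

text \<open>By \<open>ind\<close> the family is independent modulo the span of \<open>K\<close>,
  hence also injective, so its members can be added one by one to a basis of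
  \<open>K\<close>.\<close>

lemma family_dim_le:
  assumes f: "\<And>q. q \<in> Q \<Longrightarrow> f q \<in> V" and "finite Q" and V: "subspace V"
    and K: "K \<subseteq> V" and W: "V \<subseteq> span W" "finite W"
    and ind: "\<And>c. (\<Sum>q\<in>Q. scale (c q) (f q)) \<in> span K \<Longrightarrow> \<forall>q\<in>Q. c q = 0"
  shows "card Q + dim K \<le> dim V"
proof -
  obtain B where B: "B \<subseteq> K" "independent B" "K \<subseteq> span B" "card B = dim K"
    using basis_exists by blast
  have finB: "finite B"
    using independent_span_bound[OF \<open>finite W\<close> B(2)] B(1) assms(4,5) by blast
  have *: "independent (B \<union> f ` Q') \<and> card (B \<union> f ` Q') = card B + card Q'"
    if "finite Q'" "Q' \<subseteq> Q" for Q'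
    using that
  proof (induction Q' rule: finite_induct)
    case (insert q Q')
    have "f q \<notin> span (B \<union> f ` Q')"
    proof
      assume "f q \<in> span (B \<union> f ` Q')"
      then obtain x y where xy: "f q = x + y" "x \<in> span B" "y \<in> span (f ` Q')"
        unfolding span_Un by blast
      obtain c where c: "y = (\<Sum>q\<in>Q'. scale (c q) (f q))"
        using span_image_coeffs[OF insert.hyps(1) xy(3)] by blast
      \<comment> \<open>The dependence of \<open>f q\<close> on earlier members, extended by zero to
        all of \<open>Q\<close>. Its coefficient at \<open>q\<close> is 1, which contradicts
        \<open>ind\<close>.\<close>
      define c' where "c' p = (if p = q then 1 else if p \<in> Q' then - c p else 0)" for p
      have "(\<Sum>p\<in>Q. scale (c' p) (f p)) = (\<Sum>p\<in>insert q Q'. scale (c' p) (f p))"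
        using insert.prems \<open>finite Q\<close> by (intro sum.mono_neutral_right) (auto simp: c'_def)
      also have "\<dots> = f q + (\<Sum>p\<in>Q'. scale (c' p) (f p))"
        using insert.hyps by (simp add: c'_def)
      also have "(\<Sum>p\<in>Q'. scale (c' p) (f p)) = (\<Sum>p\<in>Q'. scale (- c p) (f p))"
        using insert.hyps by (intro sum.cong) (auto simp: c'_def)
      also have "f q + \<dots> = x"
        using xy(1) c by (simp add: sum_negf)
      finally have "(\<Sum>p\<in>Q. scale (c' p) (f p)) \<in> span K"
        using xy(2) span_mono[OF B(1)] by auto
      from ind[OF this] show False using insert.prems by (auto simp: c'_def)
    qed
    moreover from this have "f q \<notin> B \<union> f ` Q'"
      by (meson span_base)
    ultimately show ?case
      using insert finB by (simp add: independent_insert)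
  qed (use B in auto)
  from *[OF \<open>finite Q\<close>] have ind': "independent (B \<union> f ` Q)" "card (B \<union> f ` Q) = card B + card Q"
    by auto
  have sub: "B \<union> f ` Q \<subseteq> V" using B(1) K f by auto
  obtain C where C: "B \<union> f ` Q \<subseteq> C" "C \<subseteq> V" "independent C" "V \<subseteq> span C"
    using maximal_independent_subset_extend[OF sub ind'(1)] by blast
  have "finite C" using independent_span_bound[OF W(2) C(3)] C(2) W(1) by auto
  then have "card (B \<union> f ` Q) \<le> card C" using C(1) card_mono by blast
  also have "card C = dim V" using basis_card_eq_dim[OF C(2) C(4) C(3)] by simp
  finally show ?thesis using ind'(2) B(4) by simp
qed

text \<open>Each further functional costs at most one vector: if \<open>\<phi> p\<close> is nonzero
  at some \<open>u\<close> in the kernel so far, subtracting \<open>\<phi> p x / \<phi> p u\<close>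
  times \<open>u\<close> moves any \<open>x\<close> of that kernel into the smaller one.\<close>

lemma span_kernel_Un:
  assumes "subspace V" and "finite Q"
    and add: "\<And>q x y. q \<in> Q \<Longrightarrow> \<phi> q (x + y) = \<phi> q x + \<phi> q y"
    and scale: "\<And>q c x. q \<in> Q \<Longrightarrow> \<phi> q (scale c x) = c * \<phi> q x"
  shows "\<exists>T\<subseteq>V. finite T \<and> card T \<le> card Q \<and> V \<subseteq> span ({x \<in> V. \<forall>q\<in>Q. \<phi> q x = 0} \<union> T)"
  using \<open>finite Q\<close> add scale
proof (induction Q rule: finite_induct)
  case empty
  show ?case by (intro exI[of _ "{}"]) (auto simp: span_superset)
next
  case (insert p Q)
  then obtain T where T: "T \<subseteq> V" "finite T" "card T \<le> card Q"
    "V \<subseteq> span ({x \<in> V. \<forall>q\<in>Q. \<phi> q x = 0} \<union> T)" by auto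
  let ?K = "{x \<in> V. \<forall>q\<in>Q. \<phi> q x = 0}"
  let ?K' = "{x \<in> V. \<forall>q\<in>insert p Q. \<phi> q x = 0}"
  show ?case
  proof (cases "\<exists>u\<in>?K. \<phi> p u \<noteq> 0")
    case False
    then have "?K' = ?K" by auto
    then show ?thesis using T insert.hyps by (intro exI[of _ T]) auto
  next
    case True
    then obtain u where u: "u \<in> ?K" "\<phi> p u \<noteq> 0" by auto
    have "?K \<subseteq> span (?K' \<union> insert u T)"
    proof
      fix x assume x: "x \<in> ?K"
      define c where "c = \<phi> p x / \<phi> p u"
      have "x + scale (- c) u \<in> V"
        using x u by (intro subspace_add[OF \<open>subspace V\<close>] subspace_scale[OF \<open>subspace V\<close>]) auto
      moreover have "\<phi> q (x + scale (- c) u) = 0" if "q \<in> insert p Q" for q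
      proof -
        have "\<phi> q (x + scale (- c) u) = \<phi> q x + - c * \<phi> q u"
          by (simp only: insert.prems(1)[OF that] insert.prems(2)[OF that])
        then show ?thesis using that u x by (auto simp: c_def)
      qed
      ultimately have "x + scale (- c) u \<in> span (?K' \<union> insert u T)"
        by (intro span_base) auto
      moreover have "scale c u \<in> span (?K' \<union> insert u T)"
        by (intro span_scale span_base) auto
      ultimately have "(x + scale (- c) u) + scale c u \<in> span (?K' \<union> insert u T)"
        by (rule span_add)
      then show "x \<in> span (?K' \<union> insert u T)" by simp
    qed
    then have "?K \<union> T \<subseteq> span (?K' \<union> insert u T)"
      using span_superset[of "?K' \<union> insert u T"] by blast
    then have "span (?K \<union> T) \<subseteq> span (?K' \<union> insert u T)"
      by (rule span_minimal[OF _ subspace_span])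
    with T(4) have "V \<subseteq> span (?K' \<union> insert u T)" by blast
    moreover have "card (insert u T) \<le> card (insert p Q)"
      using T insert.hyps card_insert_le_m1 by (simp add: card_insert_if)
    ultimately show ?thesis using T u by (intro exI[of _ "insert u T"]) auto
  qed
qed

lemma dim_le_kernel:
  assumes "subspace V" and "finite Q" and "V \<subseteq> span W" "finite W"
    and add: "\<And>q x y. q \<in> Q \<Longrightarrow> \<phi> q (x + y) = \<phi> q x + \<phi> q y"
    and scale: "\<And>q c x. q \<in> Q \<Longrightarrow> \<phi> q (scale c x) = c * \<phi> q x"
    and ker: "{x \<in> V. \<forall>q\<in>Q. \<phi> q x = 0} \<subseteq> K" and "K \<subseteq> V"
  shows "dim V \<le> dim K + card Q"
proof -
  obtain T where T: "T \<subseteq> V" "finite T" "card T \<le> card Q"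
    "V \<subseteq> span ({x \<in> V. \<forall>q\<in>Q. \<phi> q x = 0} \<union> T)"
    using span_kernel_Un[OF assms(1,2), of \<phi>] add scale by auto
  have "span ({x \<in> V. \<forall>q\<in>Q. \<phi> q x = 0} \<union> T) \<subseteq> span (K \<union> T)"
    using ker by (intro span_mono) auto
  then have "dim V \<le> dim K + card T"
    using T assms by (intro dim_le_of_span_Un[of V K T W]) auto
  then show ?thesis using T(3) by simp
qed

end

subsection \<open>Monomials and forms\<close>

definition mons :: "'i set \<Rightarrow> ('i \<Rightarrow> nat) \<Rightarrow> ('i \<Rightarrow> nat) \<Rightarrow> ('i \<times> nat \<Rightarrow>\<^sub>0 nat) set" where
  "mons I n d = {t. pkeys t \<subseteq> (SIGMA i:I. {..n i}) \<and> (\<forall>i\<in>I. (\<Sum>l\<le>n i. lkp t (i, l)) = d i)}"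

lemma forms_eq: "forms I n d = {f. pkeys f \<subseteq> mons I n d}"
  by (auto simp: forms_def mons_def)

lemma mons_cong: "(\<And>i. i \<in> I \<Longrightarrow> d i = d' i) \<Longrightarrow> mons I n d = mons I n d'"
  by (auto simp: mons_def)

lemma forms_cong: "(\<And>i. i \<in> I \<Longrightarrow> d i = d' i) \<Longrightarrow> forms I n d = forms I n d'"
  using mons_cong[of I d d' n] by (simp add: forms_eq)

lemma mons_zero: "0 \<in> mons I n (\<lambda>_. 0)"
  by (simp add: mons_def)

lemma mons_add: "s \<in> mons I n d \<Longrightarrow> t \<in> mons I n d' \<Longrightarrow> s + t \<in> mons I n (\<lambda>i. d i + d' i)"
  using Poly_Mapping.keys_add[of s t] by (fastforce simp: mons_def lookup_add sum.distrib)

text \<open>The multidegree of a linear form in the coordinates of factor \<open>i\<close>.\<close>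

definition edeg :: "'i \<Rightarrow> 'i \<Rightarrow> nat" where
  "edeg i = (\<lambda>i'. if i' = i then 1 else 0)"

lemma mons_single: "i \<in> I \<Longrightarrow> l \<le> n i \<Longrightarrow> psingle (i, l) 1 \<in> mons I n (edeg i)"
  by (auto simp: mons_def edeg_def lookup_single when_def)

lemma mons_diff_single:
  assumes t: "t \<in> mons I n d" and x: "lkp t (i, l) \<noteq> 0"
  shows "t - psingle (i, l) 1 \<in> mons I n (\<lambda>i'. d i' - edeg i i')" "0 < d i" "i \<in> I" "l \<le> n i"
    "t = (t - psingle (i, l) 1) + psingle (i, l) 1"
proof -
  have k: "(i, l) \<in> pkeys t" using x by (simp add: in_keys_iff)
  then show i: "i \<in> I" and l: "l \<le> n i" using t by (auto simp: mons_def)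
  have di: "(\<Sum>l\<le>n i. lkp t (i, l)) = d i" using t i by (simp add: mons_def)
  have r: "(\<Sum>l\<le>n i. lkp t (i, l)) = lkp t (i, l) + (\<Sum>l'\<in>{..n i} - {l}. lkp t (i, l'))"
    using l by (subst sum.remove[of _ l]) auto
  show "0 < d i" using x di r by auto
  show "t = (t - psingle (i, l) 1) + psingle (i, l) 1"
    using x by (intro poly_mapping_eqI) (auto simp: lookup_add lookup_minus lookup_single when_def)
  have "(\<Sum>l'\<le>n i. lkp (t - psingle (i, l) 1) (i, l')) = d i - 1"
  proof -
    have "(\<Sum>l'\<le>n i. lkp (t - psingle (i, l) 1) (i, l')) = lkp (t - psingle (i, l) 1) (i, l)
      + (\<Sum>l'\<in>{..n i} - {l}. lkp (t - psingle (i, l) 1) (i, l'))"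
      using l by (subst sum.remove[of _ l]) auto
    also have "(\<Sum>l'\<in>{..n i} - {l}. lkp (t - psingle (i, l) 1) (i, l')) = (\<Sum>l'\<in>{..n i} - {l}. lkp t (i, l'))"
      by (intro sum.cong) (auto simp: lookup_minus lookup_single when_def)
    finally show ?thesis using r di x by (simp add: lookup_minus)
  qed
  moreover have "(\<Sum>l'\<le>n i'. lkp (t - psingle (i, l) 1) (i', l')) = d i'" if "i' \<in> I" "i' \<noteq> i" for i'
    using t that by (auto simp: mons_def lookup_minus lookup_single when_def)
  moreover have "pkeys (t - psingle (i, l) 1) \<subseteq> pkeys t"
    by (auto simp: in_keys_iff lookup_minus)
  ultimately show "t - psingle (i, l) 1 \<in> mons I n (\<lambda>i'. d i' - edeg i i')"
    using t by (auto simp: mons_def edeg_def)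
qed

definition monomial :: "('v \<Rightarrow> nat) \<Rightarrow> 'v set \<Rightarrow> 'v \<Rightarrow>\<^sub>0 nat" where
  "monomial g X = (\<Sum>x\<in>X. psingle x (g x))"

lemma lookup_monomial: "finite X \<Longrightarrow> lkp (monomial g X) x = (if x \<in> X then g x else 0)"
  by (simp add: monomial_def lookup_sum lookup_single when_def)

text \<open>Prepares the count of monomials: in each factor the exponents form a list of length
  \<open>n i + 1\<close> with sum \<open>d i\<close>, and such lists are counted by stars and
  bars.\<close>

lemma mons_bij:
  fixes I :: "'i set"
  assumes "finite I"
  shows "bij_betw (\<lambda>t. \<lambda>i\<in>I. map (\<lambda>l. lkp t (i, l)) [0..<Suc (n i)]) (mons I n d)
    (\<Pi>\<^sub>E i\<in>I. {xs. length xs = Suc (n i) \<and> sum_list xs = d i})"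
proof (rule bij_betw_byWitness[where f' = "\<lambda>F. monomial (\<lambda>(i, l). F i ! l) (SIGMA i:I. {..n i})"])
  have fin: "finite (SIGMA i:I. {..n i})" using assms by auto
  have sl: "sum_list xs = (\<Sum>l\<le>m. xs ! l)" if "length xs = Suc m" for xs :: "nat list" and m
    using that by (simp add: sum_list_sum_nth atLeast0LessThan lessThan_Suc_atMost)
  show "\<forall>t\<in>mons I n d. monomial (\<lambda>(i, l). (\<lambda>i\<in>I. map (\<lambda>l. lkp t (i, l)) [0..<Suc (n i)]) i ! l)
      (SIGMA i:I. {..n i}) = t"
  proof (intro ballI poly_mapping_eqI)
    fix t and x :: "'i \<times> nat" assume t: "t \<in> mons I n d"
    obtain i l where x: "x = (i, l)" by (cases x)
    have "(i, l) \<notin> (SIGMA i:I. {..n i}) \<Longrightarrow> lkp t (i, l) = 0"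
      using t by (auto simp: mons_def subset_iff in_keys_iff)
    then show "lkp (monomial (\<lambda>(i, l). (\<lambda>i\<in>I. map (\<lambda>l. lkp t (i, l)) [0..<Suc (n i)]) i ! l)
      (SIGMA i:I. {..n i})) x = lkp t x"
      by (auto simp: x lookup_monomial[OF fin] less_Suc_eq_le simp del: upt_Suc)
  qed
  show "\<forall>F\<in>\<Pi>\<^sub>E i\<in>I. {xs. length xs = Suc (n i) \<and> sum_list xs = d i}.
     (\<lambda>i\<in>I. map (\<lambda>l. lkp (monomial (\<lambda>(i, l). F i ! l) (SIGMA i:I. {..n i})) (i, l)) [0..<Suc (n i)]) = F"
  proof
    fix F assume F: "F \<in> (\<Pi>\<^sub>E i\<in>I. {xs. length xs = Suc (n i) \<and> sum_list xs = d i})"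
    show "(\<lambda>i\<in>I. map (\<lambda>l. lkp (monomial (\<lambda>(i, l). F i ! l) (SIGMA i:I. {..n i})) (i, l)) [0..<Suc (n i)]) = F"
    proof
      fix i
      show "(\<lambda>i\<in>I. map (\<lambda>l. lkp (monomial (\<lambda>(i, l). F i ! l) (SIGMA i:I. {..n i})) (i, l)) [0..<Suc (n i)]) i = F i"
      proof (cases "i \<in> I")
        case True
        with F have "length (F i) = Suc (n i)" by auto
        then show ?thesis using True
          by (auto intro!: nth_equalityI simp: lookup_monomial[OF fin] less_Suc_eq_le simp del: upt_Suc)
      qed (use F in auto)
    qed
  qed
  show "(\<lambda>t. \<lambda>i\<in>I. map (\<lambda>l. lkp t (i, l)) [0..<Suc (n i)]) ` mons I n d
     \<subseteq> (\<Pi>\<^sub>E i\<in>I. {xs. length xs = Suc (n i) \<and> sum_list xs = d i})"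
    by (auto simp: sl mons_def less_Suc_eq_le simp del: upt_Suc)
  show "(\<lambda>F. monomial (\<lambda>(i, l). F i ! l) (SIGMA i:I. {..n i})) `
     (\<Pi>\<^sub>E i\<in>I. {xs. length xs = Suc (n i) \<and> sum_list xs = d i}) \<subseteq> mons I n d"
  proof safe
    fix F assume F: "F \<in> (\<Pi>\<^sub>E i\<in>I. {xs. length xs = Suc (n i) \<and> sum_list xs = d i})"
    then show "monomial (\<lambda>(i, l). F i ! l) (SIGMA i:I. {..n i}) \<in> mons I n d"
      using sl by (auto simp: mons_def in_keys_iff lookup_monomial[OF fin] PiE_iff split: if_splits)
  qed
qed

lemma finite_len_sum: "finite {xs::nat list. length xs = m \<and> sum_list xs = s}"
proof (rule finite_subset)
  show "{xs::nat list. length xs = m \<and> sum_list xs = s} \<subseteq> {xs. set xs \<subseteq> {..s} \<and> length xs = m}"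
    using member_le_sum_list by auto
qed (rule finite_lists_length_eq, simp)

lemma finite_mons: "finite I \<Longrightarrow> finite (mons I n d)"
  by (subst bij_betw_finite[OF mons_bij]) (auto intro: finite_PiE finite_len_sum)

lemma card_mons:
  assumes "finite I"
  shows "card (mons I n d) = (\<Prod>i\<in>I. (n i + d i) choose d i)"
proof -
  have "card (mons I n d) = card (\<Pi>\<^sub>E i\<in>I. {xs::nat list. length xs = Suc (n i) \<and> sum_list xs = d i})"
    by (rule bij_betw_same_card[OF mons_bij[OF assms]])
  also have "\<dots> = (\<Prod>i\<in>I. card {xs::nat list. length xs = Suc (n i) \<and> sum_list xs = d i})"
    by (rule card_PiE[OF assms])
  finally show ?thesis by (simp add: card_length_sum_list add.commute)
qed

lemma forms_zero [simp]: "0 \<in> forms I n d"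
  by (simp add: forms_eq)

lemma forms_one: "1 \<in> forms I n (\<lambda>_. 0)"
  using mons_zero by (simp add: forms_eq)

lemma forms_add: "f \<in> forms I n d \<Longrightarrow> g \<in> forms I n d \<Longrightarrow> f + g \<in> forms I n d"
  using Poly_Mapping.keys_add[of f g] by (auto simp: forms_eq)

lemma forms_mscale: "f \<in> forms I n d \<Longrightarrow> mscale c f \<in> forms I n d"
  by (auto simp: forms_eq in_keys_iff subset_iff)

lemma forms_mult:
  "f \<in> forms I n d \<Longrightarrow> g \<in> forms I n d' \<Longrightarrow> f * g \<in> forms I n (\<lambda>i. d i + d' i)"
  using keys_mult[of f g] by (force simp: forms_eq intro: mons_add)

lemma forms_single: "t \<in> mons I n d \<Longrightarrow> psingle t c \<in> forms I n d"
  by (auto simp: forms_eq)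

lemma forms_subspace: "mpoly.subspace (forms I n d)"
  by (rule mpoly.subspaceI) (auto simp: forms_add forms_mscale)

lemma forms_sum: "(\<And>x. x \<in> A \<Longrightarrow> f x \<in> forms I n d) \<Longrightarrow> sum f A \<in> forms I n d"
  by (rule mpoly.subspace_sum[OF forms_subspace])

lemma forms_neg: "f \<in> forms I n d \<Longrightarrow> - f \<in> forms I n d"
  by (rule mpoly.subspace_neg[OF forms_subspace])

lemma forms_diff: "f \<in> forms I n d \<Longrightarrow> g \<in> forms I n d \<Longrightarrow> f - g \<in> forms I n d"
  by (rule mpoly.subspace_diff[OF forms_subspace])

lemma forms_prod:
  "(\<And>x. x \<in> A \<Longrightarrow> f x \<in> forms I n (d x)) \<Longrightarrow> prod f A \<in> forms I n (\<lambda>i. \<Sum>x\<in>A. d x i)"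
  by (induction A rule: infinite_finite_induct) (auto simp: forms_one forms_mult)

lemma forms_power: "f \<in> forms I n d \<Longrightarrow> f ^ m \<in> forms I n (\<lambda>i. m * d i)"
  by (induction m) (auto simp: forms_one forms_mult)

abbreviation var :: "'v \<Rightarrow> 'v mpoly" where
  "var x \<equiv> psingle (psingle x 1) 1"

lemma forms_var: "i \<in> I \<Longrightarrow> l \<le> n i \<Longrightarrow> var (i, l) \<in> forms I n (edeg i)"
  by (rule forms_single, rule mons_single)

lemma forms_span: "forms I n d = mpoly.span ((\<lambda>t. psingle t 1) ` mons I n d)"
proof
  show "forms I n d \<subseteq> mpoly.span ((\<lambda>t. psingle t 1) ` mons I n d)"
  proof
    fix f assume f: "f \<in> forms I n d"
    have "f = (\<Sum>t\<in>pkeys f. mscale (lkp f t) (psingle t 1))"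
      by (subst mpoly_monomials) simp
    also have "\<dots> \<in> mpoly.span ((\<lambda>t. psingle t 1) ` mons I n d)"
      using f by (intro mpoly.span_sum mpoly.span_scale mpoly.span_base) (auto simp: forms_eq)
    finally show "f \<in> mpoly.span ((\<lambda>t. psingle t 1) ` mons I n d)" .
  qed
  show "mpoly.span ((\<lambda>t. psingle t 1) ` mons I n d) \<subseteq> forms I n d"
    by (rule mpoly.span_minimal[OF _ forms_subspace]) (auto intro: forms_single)
qed

lemma dim_forms:
  assumes "finite I"
  shows "mpoly.dim (forms I n d) = card (mons I n d)"
proof -
  have inj: "inj_on (\<lambda>t. psingle t (1::complex)) (mons I n d)"
    by (rule inj_onI) (metis keys_single one_neq_zero singleton_inject)
  have "mpoly.independent ((\<lambda>t. psingle t 1) ` mons I n d)"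
  proof (rule mpoly.independent_if_scalars_zero)
    show "finite ((\<lambda>t. psingle t (1::complex)) ` mons I n d)"
      using finite_mons[OF assms] by simp
    fix c :: "('a \<times> nat) mpoly \<Rightarrow> complex" and x :: "('a \<times> nat) mpoly"
    assume s: "(\<Sum>x\<in>(\<lambda>t. psingle t 1) ` mons I n d. mscale (c x) x) = 0"
      and "x \<in> (\<lambda>t. psingle t 1) ` mons I n d"
    then obtain t where t: "t \<in> mons I n d" "x = psingle t 1" by auto
    have "0 = lkp (\<Sum>x\<in>(\<lambda>t. psingle t 1) ` mons I n d. mscale (c x) x) t" using s by simp
    also have "\<dots> = (\<Sum>s\<in>mons I n d. c (psingle s 1) * (1 when s = t))"
      by (simp add: sum.reindex[OF inj] lookup_sum lookup_single when_def if_distrib cong: if_cong)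
    also have "\<dots> = c x"
      using t finite_mons[OF assms] by (simp add: when_def if_distrib cong: if_cong)
    finally show "c x = 0" by simp
  qed
  then show ?thesis
    by (simp add: forms_span mpoly.dim_span_eq_card_independent mpoly.dim_eq_card_independent card_image[OF inj])
qed

lemma forms_fin_span: 
  assumes "finite I"
  obtains W where "finite W" "forms I n d \<subseteq> mpoly.span W"
  using forms_span[of I n d] finite_mons[OF assms, of n d] by blast

lemma clf_form:
  assumes "finite I" "F \<in> forms I n d"
  shows "clf g F = (\<Sum>t\<in>mons I n d. lkp F t * g t)"
  using assms by (intro cx.lf_superset finite_mons) (auto simp: forms_eq)

declare One_nat_def [simp del]

subsection \<open>Points and double points\<close>

lemma pev_zero: "pev z 0 = 0"
  by (simp add: pev_def)

definition ray :: "(nat \<Rightarrow> complex) \<Rightarrow> (nat \<Rightarrow> complex) set" where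
  "ray v = {w. \<exists>c. c \<noteq> 0 \<and> w = (\<lambda>l. c * v l)}"

lemma coeff_mult_0: "coeff (p * q) 0 = coeff p 0 * coeff q (0::nat)"
  by (simp add: coeff_mult)

lemma coeff_mult_1: "coeff (p * q) 1 = coeff p 0 * coeff q 1 + coeff p 1 * coeff q (0::nat)"
  by (simp add: coeff_mult One_nat_def)

lemma ray_self: "v \<in> ray v"
  by (auto simp: ray_def intro: exI[of _ 1])

lemma nonzero_vectors_scale: "v \<in> nonzero_vectors m \<Longrightarrow> c \<noteq> 0 \<Longrightarrow> (\<lambda>l. c * v l) \<in> nonzero_vectors m"
  by (auto simp: nonzero_vectors_def)

lemma proj_space_eq: "proj_space m = ray ` nonzero_vectors m"
proof -
  let ?r = "{(v, w). v \<in> nonzero_vectors m \<and> w \<in> nonzero_vectors m \<and> (\<exists>c. c \<noteq> 0 \<and> w = (\<lambda>l. c * v l))}"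
  have "?r `` {v} = ray v" if "v \<in> nonzero_vectors m" for v
    using that nonzero_vectors_scale[OF that] unfolding ray_def by blast
  then show ?thesis
    unfolding proj_space_def quotient_def by (auto intro: rev_image_eqI)
qed

definition reps :: "'i set \<Rightarrow> ('i \<Rightarrow> nat) \<Rightarrow> ('i \<Rightarrow> (nat \<Rightarrow> complex) set) \<Rightarrow> ('i \<Rightarrow> nat \<Rightarrow> complex) \<Rightarrow> bool" where
  "reps I n P v \<longleftrightarrow> (\<forall>i\<in>I. v i \<in> nonzero_vectors (n i) \<and> P i = ray (v i))"

lemma multiproj_reps: "P \<in> multiproj I n \<Longrightarrow> \<exists>v. reps I n P v"
proof -
  assume "P \<in> multiproj I n"
  then have "\<forall>i\<in>I. \<exists>w. w \<in> nonzero_vectors (n i) \<and> P i = ray w"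
    by (auto simp: multiproj_def proj_space_eq PiE_iff image_iff Bex_def)
  then show ?thesis unfolding reps_def by (rule bchoice)
qed

lemma reps_multiproj:
  assumes "\<And>i. i \<in> I \<Longrightarrow> v i \<in> nonzero_vectors (n i)"
  shows "(\<lambda>i\<in>I. ray (v i)) \<in> multiproj I n" "reps I n (\<lambda>i\<in>I. ray (v i)) v"
  using assms by (auto simp: multiproj_def proj_space_eq reps_def)

lemma mev_scale:
  assumes "finite I" "t \<in> mons I n d"
  shows "mev (\<lambda>(i, l). c i * w i l) t = (\<Prod>i\<in>I. c i ^ d i) * mev (\<lambda>(i, l). w i l) t"
proof -
  let ?X = "SIGMA i:I. {..n i}"
  have X: "finite ?X" "pkeys t \<subseteq> ?X" using assms by (auto simp: mons_def)
  have "mev (\<lambda>(i, l). c i * w i l) t = (\<Prod>(i, l)\<in>?X. c i ^ lkp t (i, l)) * mev (\<lambda>(i, l). w i l) t"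
    by (simp add: mev_superset[OF X] case_prod_unfold power_mult_distrib prod.distrib)
  also have "(\<Prod>(i, l)\<in>?X. c i ^ lkp t (i, l)) = (\<Prod>i\<in>I. \<Prod>l\<le>n i. c i ^ lkp t (i, l))"
    using assms(1) by (subst prod.Sigma) auto
  also have "\<dots> = (\<Prod>i\<in>I. c i ^ d i)"
    using assms(2) by (intro prod.cong) (auto simp: mons_def simp flip: power_sum)
  finally show ?thesis .
qed

text \<open>Rescaling the coordinates of factor \<open>i\<close> by \<open>c i\<close> multiplies a
  form of multidegree \<open>d\<close> by the product of the \<open>c i ^ d i\<close>, so one choice
  of coordinates decides.\<close>

lemma vanishes_at_iff:
  assumes "finite I" "reps I n P v" "f \<in> forms I n d"
  shows "vanishes_at I f P \<longleftrightarrow> meval (\<lambda>(i, l). v i l) f = 0"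
proof
  assume "vanishes_at I f P"
  then show "meval (\<lambda>(i, l). v i l) f = 0"
    using assms(2) ray_self unfolding vanishes_at_def reps_def by blast
next
  assume 0: "meval (\<lambda>(i, l). v i l) f = 0"
  show "vanishes_at I f P"
    unfolding vanishes_at_def
  proof (intro allI impI)
    fix v' assume "\<forall>i\<in>I. v' i \<in> P i"
    then have "\<forall>i\<in>I. \<exists>c. v' i = (\<lambda>l. c * v i l)"
      using assms(2) by (auto simp: reps_def ray_def)
    then obtain c where c: "\<And>i. i \<in> I \<Longrightarrow> v' i = (\<lambda>l. c i * v i l)"
      by metis
    have "meval (\<lambda>(i, l). v' i l) f = meval (\<lambda>(i, l). c i * v i l) f"
      using assms(3) c by (intro meval_cong) (auto simp: forms_def subset_iff)
    also have "\<dots> = (\<Prod>i\<in>I. c i ^ d i) * meval (\<lambda>(i, l). v i l) f"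
      unfolding meval_eq lf_def sum_distrib_left
      using assms(1,3) by (intro sum.cong) (auto simp: forms_eq mev_scale)
    finally show "meval (\<lambda>(i, l). v' i l) f = 0" using 0 by simp
  qed
qed

lemma point_ideal_meval:
  assumes "finite I" "reps I n P v" "f \<in> point_ideal I n P"
  shows "meval (\<lambda>(i, l). v i l) f = 0"
proof -
  have "mpoly.subspace {f. meval (\<lambda>(i, l). v i l) f = 0}"
    by (rule mpoly.subspaceI) (auto simp: meval_add meval_mscale)
  then have "point_ideal I n P \<subseteq> {f. meval (\<lambda>(i, l). v i l) f = 0}"
    unfolding point_ideal_def
    using vanishes_at_iff[OF assms(1,2)] by (intro mpoly.span_minimal) auto
  then show ?thesis using assms(3) by auto
qed

text \<open>Along \<open>[:v, w:]\<close> each element of the point ideal has constant coefficient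
  0, so products of two of them start in order 2. In \<open>G * F\<close> the constant coefficient
  of \<open>G\<close> is invertible, and both low coefficients of \<open>F\<close> must vanish.
  Taking \<open>w\<close> to be a coordinate direction gives the partial derivative.\<close>

lemma in_double_point_dmon:
  assumes "finite I" "reps I n P v" "in_double_point I n P F"
  shows "clf (dmon (\<lambda>(i, l). v i l) q) F = 0"
proof -
  let ?v = "\<lambda>(i, l). v i l"
  obtain d G where G: "G \<in> forms I n d" "\<not> vanishes_at I G P"
    "G * F \<in> ideal_prod (point_ideal I n P) (point_ideal I n P)"
    using assms(3) by (auto simp: in_double_point_def)
  have G0: "meval ?v G \<noteq> 0" using G(2) vanishes_at_iff[OF assms(1,2) G(1)] by simp
  have *: "coeff (pev (\<lambda>y. [:?v y, w y:]) F) 0 = 0 \<and> coeff (pev (\<lambda>y. [:?v y, w y:]) F) 1 = 0" for w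
  proof -
    let ?e = "pev (\<lambda>y. [:?v y, w y:])"
    have "mpoly.subspace {H. coeff (?e H) 0 = 0 \<and> coeff (?e H) 1 = 0}"
      by (rule mpoly.subspaceI) (simp_all add: pev_add pev_mscale pev_zero)
    moreover have "coeff (?e (f * g)) 0 = 0 \<and> coeff (?e (f * g)) 1 = 0"
      if "f \<in> point_ideal I n P" "g \<in> point_ideal I n P" for f g
      using point_ideal_meval[OF assms(1,2)] that coeff_pev_0[of ?v w]
      by (simp add: pev_mult coeff_mult_1 coeff_mult_0)
    ultimately have "ideal_prod (point_ideal I n P) (point_ideal I n P)
      \<subseteq> {H. coeff (?e H) 0 = 0 \<and> coeff (?e H) 1 = 0}"
      unfolding ideal_prod_def by (intro mpoly.span_minimal) auto
    then have "coeff (?e G * ?e F) 0 = 0" "coeff (?e G * ?e F) 1 = 0"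
      using G(3) by (auto simp: pev_mult)
    then show ?thesis
      using G0 coeff_pev_0[of ?v w G] by (simp add: coeff_mult_1 coeff_mult_0)
  qed
  show ?thesis
  proof (cases q)
    case None
    then show ?thesis
      using *[of "\<lambda>_. 0"] coeff_pev_0[of ?v "\<lambda>_. 0" F]
      by (simp add: meval_eq lf_def)
  next
    case (Some x)
    then show ?thesis
      using *[of "\<lambda>y. if y = x then 1 else 0"] coeff_pev_1[of ?v x F] by simp
  qed
qed

lemma vanishing_in_point_ideal:
  "f \<in> forms I n d \<Longrightarrow> vanishes_at I f P \<Longrightarrow> f \<in> point_ideal I n P"
  unfolding point_ideal_def by (rule mpoly.span_base) auto

text \<open>The product lies in the squared ideal itself, so the constant 1 serves as the local
  denominator.\<close>

lemma in_double_point_mult: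
  assumes "finite I" "reps I n P v"
    and "f \<in> forms I n d" "meval (\<lambda>(i, l). v i l) f = 0"
    and "g \<in> forms I n d'" "meval (\<lambda>(i, l). v i l) g = 0"
  shows "in_double_point I n P (f * g)"
proof -
  have "f \<in> point_ideal I n P" "g \<in> point_ideal I n P"
    using assms vanishes_at_iff[OF assms(1,2)] by (auto intro: vanishing_in_point_ideal)
  then have "1 * (f * g) \<in> ideal_prod (point_ideal I n P) (point_ideal I n P)"
    unfolding ideal_prod_def by (intro mpoly.span_base) auto
  moreover have "\<not> vanishes_at I 1 P"
    using vanishes_at_iff[OF assms(1,2) forms_one] by simp
  ultimately show ?thesis
    unfolding in_double_point_def using forms_one by blast
qed

text \<open>The ideals are encoded as linear spans of forms or products, so closure under
  multiplication is checked on generators; the new form is absorbed into one of the two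
  factors.\<close>

lemma ideal_prod_mult_form:
  assumes fin: "finite I" and P: "reps I n P v" and h: "h \<in> forms I n d"
    and "r \<in> ideal_prod (point_ideal I n P) (point_ideal I n P)"
  shows "r * h \<in> ideal_prod (point_ideal I n P) (point_ideal I n P)"
proof -
  have sub: "mpoly.subspace {f. f * h \<in> mpoly.span S}" for S
    by (rule mpoly.subspaceI)
      (auto simp: mpoly.span_zero distrib_right mpoly.span_add mscale_mult_left mpoly.span_scale)
  have "point_ideal I n P \<subseteq> {f. f * h \<in> point_ideal I n P}"
    unfolding point_ideal_def
  proof (rule mpoly.span_minimal[OF _ sub], safe)
    fix f d' assume f: "f \<in> forms I n d'" "vanishes_at I f P"
    have fh: "f * h \<in> forms I n (\<lambda>i. d' i + d i)" by (rule forms_mult[OF f(1) h])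
    moreover have "vanishes_at I (f * h) P"
      using vanishes_at_iff[OF fin P] f fh by (simp add: meval_mult)
    ultimately show "f * h \<in> mpoly.span {f. (\<exists>d. f \<in> forms I n d) \<and> vanishes_at I f P}"
      by (intro mpoly.span_base) auto
  qed
  then have PI: "f * h \<in> point_ideal I n P" if "f \<in> point_ideal I n P" for f
    using that by auto
  have "ideal_prod (point_ideal I n P) (point_ideal I n P) \<subseteq>
    {r. r * h \<in> ideal_prod (point_ideal I n P) (point_ideal I n P)}"
    unfolding ideal_prod_def
  proof (rule mpoly.span_minimal[OF _ sub], safe)
    fix f g assume "f \<in> point_ideal I n P" "g \<in> point_ideal I n P"
    then show "f * g * h \<in> mpoly.span {f * g |f g. f \<in> point_ideal I n P \<and> g \<in> point_ideal I n P}"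
      using PI[of g] by (intro mpoly.span_base) (auto simp: mult.assoc)
  qed
  then show ?thesis using assms(4) by auto
qed

text \<open>Every variable of a factor is a multiple of a pivot variable \<open>X i\<close>, which does not vanish at
  the point, plus a linear form \<open>y\<close> that does. Modulo products of two such forms a monomial is a
  combination of \<open>1 + \<Sum>n\<^sub>i\<close> terms. Multiplying it by \<open>\<Prod>X i\<close> first keeps the truncated
  exponents \<open>d i + 1 - edeg i\<close> exact.\<close>

lemma in_double_point_codim:
  fixes I :: "'i set"
  assumes fin: "finite I" and P: "reps I n P v"
  shows "\<exists>D::('i \<times> nat) option set. \<exists>\<gamma>. finite D \<and> card D = 1 + (\<Sum>i\<in>I. n i) \<and>
    (\<forall>F\<in>forms I n a. (\<forall>q\<in>D. clf (\<gamma> q) F = 0) \<longrightarrow> in_double_point I n P F)"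
proof -
  let ?v = "\<lambda>(i, l). v i l"
  have "\<forall>i\<in>I. \<exists>l. l \<le> n i \<and> v i l \<noteq> 0"
    using P by (auto simp: reps_def nonzero_vectors_def)
  then obtain p where p: "\<And>i. i \<in> I \<Longrightarrow> p i \<le> n i" "\<And>i. i \<in> I \<Longrightarrow> v i (p i) \<noteq> 0"
    by metis
  \<comment> \<open>With this normalization \<open>y x\<close> vanishes at the point. For a pivot
    variable \<open>c\<close> is 1 and \<open>y\<close> is 0, so \<open>D\<close> omits the
    pivots.\<close>
  define c where "c = (\<lambda>(i, l). v i l / v i (p i))"
  define X where "X i = var (i, p i)" for i
  define y where "y x = var x - mscale (c x) (X (fst x))" for x
  define Xd where "Xd e = (\<Prod>i\<in>I. X i ^ e i)" for e :: "'i \<Rightarrow> nat"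
  define D where "D = insert None (Some ` (SIGMA i:I. {..n i} - {p i}))"
  define g where "g d q = (case q of None \<Rightarrow> Xd (\<lambda>i. d i + 1)
    | Some x \<Rightarrow> y x * Xd (\<lambda>i. d i + 1 - edeg (fst x) i))" for d q
  let ?PI = "point_ideal I n P"
  let ?I2 = "ideal_prod ?PI ?PI"
  have X_form: "X i \<in> forms I n (edeg i)" if "i \<in> I" for i
    unfolding X_def using p that by (intro forms_var) auto
  have y_form: "y (i, l) \<in> forms I n (edeg i)" if "i \<in> I" "l \<le> n i" for i l
    unfolding y_def using X_form that by (auto intro!: forms_diff forms_mscale forms_var)
  have y_zero: "meval ?v (y (i, l)) = 0" if "i \<in> I" for i l
    using p that by (simp add: y_def meval_diff meval_mscale X_def c_def)
  have yPI: "y (i, l) \<in> ?PI" if "i \<in> I" "l \<le> n i" for i l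
    using y_form[OF that] y_zero[OF that(1)] vanishes_at_iff[OF fin P]
    by (intro vanishing_in_point_ideal) auto
  have y_piv: "y (i, p i) = 0" if "i \<in> I" for i
    using p that by (simp add: y_def c_def X_def)
  have Xd_form: "Xd e \<in> forms I n e" for e
  proof -
    have "Xd e \<in> forms I n (\<lambda>i'. \<Sum>i\<in>I. e i * edeg i i')"
      unfolding Xd_def using X_form by (intro forms_prod forms_power) auto
    also have "forms I n (\<lambda>i'. \<Sum>i\<in>I. e i * edeg i i') = forms I n e"
      using fin by (intro forms_cong) (simp add: edeg_def if_distrib cong: if_cong)
    finally show ?thesis .
  qed
  have Xd_add: "Xd e * X i = Xd (\<lambda>i'. e i' + edeg i i')" if "i \<in> I" for e i
  proof -
    have "(\<Prod>i'\<in>I. X i' ^ edeg i i') = X i"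
      using fin that by (simp add: edeg_def if_distrib cong: if_cong)
    then show ?thesis by (simp add: Xd_def power_add prod.distrib)
  qed
  have Xd_cong: "Xd e = Xd e'" if "\<And>i. i \<in> I \<Longrightarrow> e i = e' i" for e e'
    unfolding Xd_def using that by (intro prod.cong) auto
  have finD: "finite D" using fin by (simp add: D_def)
  have "card D = 1 + card (SIGMA i:I. {..n i} - {p i})"
    using fin by (simp add: D_def card_insert_if card_image)
  also have "card (SIGMA i:I. {..n i} - {p i}) = (\<Sum>i\<in>I. n i)"
    using fin p by (simp add: card_SigmaI)
  finally have cardD: "card D = 1 + (\<Sum>i\<in>I. n i)" .
  \<comment> \<open>Induction on the total degree: a variable \<open>(i, l)\<close> is removed from
    \<open>t\<close>, and the generators obtained for the smaller degree \<open>d'\<close> are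
    multiplied by \<open>c (i, l) X i + y (i, l)\<close>. The pivot part carries
    \<open>g d' q\<close> to \<open>g d q\<close>. The other part carries \<open>g d' None\<close>
    to \<open>g d (Some (i, l))\<close> and every remaining generator into the squared
    ideal.\<close>
  have step: "Xd (\<lambda>_. 1) * psingle t 1 \<in> mpoly.span (g d ` D \<union> ?I2)" if "t \<in> mons I n d" for t d
    using that
  proof (induction "\<Sum>i\<in>I. d i" arbitrary: t d rule: less_induct)
    case less
    show ?case
    proof (cases "t = 0")
      case True
      then have "d i = 0" if "i \<in> I" for i using less.prems that by (auto simp: mons_def)
      then have "g d None = Xd (\<lambda>_. 1)" unfolding g_def by (auto intro: Xd_cong)
      then have "Xd (\<lambda>_. 1) \<in> g d ` D" by (metis D_def image_eqI insertI1)
      then show ?thesis using True by (simp add: mpoly.span_base)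
    next
      case False
      then obtain x where "lkp t x \<noteq> 0" by (metis lookup_zero poly_mapping_eqI)
      then obtain i l where x: "lkp t (i, l) \<noteq> 0" by (cases x) auto
      note m = mons_diff_single[OF less.prems x]
      define t' where "t' = t - psingle (i, l) 1"
      define d' where "d' = (\<lambda>i'. d i' - edeg i i')"
      have "(\<Sum>i\<in>I. d' i) < (\<Sum>i\<in>I. d i)"
        using m(2,3) fin by (intro sum_strict_mono_ex1) (auto simp: d'_def edeg_def)
      then have IH: "Xd (\<lambda>_. 1) * psingle t' 1 \<in> mpoly.span (g d' ` D \<union> ?I2)"
        using less.hyps m(1) unfolding t'_def d'_def by blast
      have dd': "d i' = d' i' + edeg i i'" for i'
        using m(2) by (auto simp: d'_def edeg_def)
      let ?M = "mpoly.span (g d ` D \<union> ?I2)"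
      have var: "var (i, l) = mscale (c (i, l)) (X i) + y (i, l)"
        by (simp add: y_def)
      have "mpoly.subspace {z. z * var (i, l) \<in> ?M}"
        by (rule mpoly.subspaceI)
          (auto simp: mpoly.span_zero distrib_right mpoly.span_add mscale_mult_left mpoly.span_scale)
      moreover have "z * var (i, l) \<in> ?M" if "z \<in> ?I2" for z
        using ideal_prod_mult_form[OF fin P forms_var[where n = n, OF m(3,4)] that] by (intro mpoly.span_base) auto
      moreover have "g d' q * var (i, l) \<in> ?M" if q: "q \<in> D" for q
      proof (cases q)
        case None
        have e1: "g d' q * X i = g d q"
          unfolding None g_def using m(3) by (auto simp: Xd_add dd' intro!: Xd_cong)
        have e2: "g d' q * y (i, l) = g d (Some (i, l))"
        proof -
          have "Xd (\<lambda>i. d' i + 1) = Xd (\<lambda>i'. d i' + 1 - edeg i i')"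
            by (intro Xd_cong) (simp add: dd')
          then show ?thesis unfolding None g_def by (simp add: mult.commute)
        qed
        have "g d (Some (i, l)) \<in> ?M"
        proof (cases "l = p i")
          case True
          then show ?thesis using y_piv[OF m(3)] by (simp add: g_def mpoly.span_zero)
        next
          case False
          then show ?thesis using m(3,4) by (intro mpoly.span_base) (auto simp: D_def)
        qed
        moreover have "g d q \<in> ?M" using q by (intro mpoly.span_base) auto
        ultimately show ?thesis
          by (simp add: var distrib_left mscale_mult_right e1 e2 mpoly.span_add mpoly.span_scale)
      next
        case (Some x')
        then obtain i' l' where x': "x' = (i', l')" "i' \<in> I" "l' \<le> n i'"
          using q by (auto simp: D_def)
        have e1: "g d' q * X i = g d q"
        proof -
          have "Xd (\<lambda>j. d' j + 1 - edeg i' j) * X i = Xd (\<lambda>j. d j + 1 - edeg i' j)"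
            by (subst Xd_add[OF m(3)], rule Xd_cong) (simp add: dd' edeg_def)
          then show ?thesis unfolding Some g_def x' by (simp add: mult.assoc)
        qed
        have "Xd (\<lambda>j. d' j + 1 - edeg i' j) * y (i, l) \<in> forms I n (\<lambda>j. (d' j + 1 - edeg i' j) + edeg i j)"
          by (intro forms_mult Xd_form y_form m(3,4))
        then have "Xd (\<lambda>j. d' j + 1 - edeg i' j) * y (i, l) \<in> ?PI"
          using vanishes_at_iff[OF fin P] y_zero[OF m(3)]
          by (intro vanishing_in_point_ideal) (auto simp: meval_mult)
        then have "y (i', l') * (Xd (\<lambda>j. d' j + 1 - edeg i' j) * y (i, l)) \<in> ?I2"
          unfolding ideal_prod_def using yPI[OF x'(2,3)] by (intro mpoly.span_base) auto
        then have "g d' q * y (i, l) \<in> ?M"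
          unfolding Some g_def x' by (intro mpoly.span_base) (simp add: mult.assoc)
        moreover have "g d q \<in> ?M" using q by (intro mpoly.span_base) auto
        ultimately show ?thesis
          by (simp add: var distrib_left mscale_mult_right e1 mpoly.span_add mpoly.span_scale)
      qed
      ultimately have "mpoly.span (g d' ` D \<union> ?I2) \<subseteq> {z. z * var (i, l) \<in> ?M}"
        by (intro mpoly.span_minimal) auto
      then have "Xd (\<lambda>_. 1) * psingle t' 1 * var (i, l) \<in> ?M"
        using IH by blast
      also have "Xd (\<lambda>_. 1) * psingle t' 1 * var (i, l) = Xd (\<lambda>_. 1) * psingle t 1"
        using m(5) by (simp add: mult.assoc mult_single t'_def)
      finally show ?thesis .
    qed
  qed
  have I2: "mpoly.span ?I2 = ?I2"
    unfolding ideal_prod_def by (rule mpoly.span_span)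
  have "\<exists>\<gamma>. Xd (\<lambda>_. 1) * psingle t 1 - (\<Sum>q\<in>D. mscale (\<gamma> q) (g a q)) \<in> ?I2"
    if t: "t \<in> mons I n a" for t
  proof -
    obtain s r where sr: "Xd (\<lambda>_. 1) * psingle t 1 = s + r" "s \<in> mpoly.span (g a ` D)" "r \<in> ?I2"
      using step[OF t] unfolding mpoly.span_Un I2 by blast
    obtain \<gamma> where "s = (\<Sum>q\<in>D. mscale (\<gamma> q) (g a q))"
      using mpoly.span_image_coeffs[OF finD sr(2)] by blast
    then show ?thesis using sr by (intro exI[of _ \<gamma>]) simp
  qed
  then have "\<forall>t\<in>mons I n a. \<exists>\<gamma>. Xd (\<lambda>_. 1) * psingle t 1 - (\<Sum>q\<in>D. mscale (\<gamma> q) (g a q)) \<in> ?I2"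
    by blast
  from bchoice[OF this] obtain \<gamma> where \<gamma>: "\<And>t. t \<in> mons I n a \<Longrightarrow>
    Xd (\<lambda>_. 1) * psingle t 1 - (\<Sum>q\<in>D. mscale (\<gamma> t q) (g a q)) \<in> ?I2"
    by blast
  have "in_double_point I n P F" if F: "F \<in> forms I n a" and 0: "\<forall>q\<in>D. clf (\<lambda>t. \<gamma> t q) F = 0" for F
  proof -
    \<comment> \<open>The congruences for monomials are weighted by the coefficients of
      \<open>F\<close>. The functionals \<open>\<gamma>\<close> are exactly the resulting
      coefficients of the \<open>g a q\<close>, so their vanishing leaves
      \<open>Xd (\<lambda>_. 1) * F\<close> in the squared ideal; the multiplier is nonzero at
      \<open>P\<close> and plays the part of \<open>G\<close>.\<close>
    have "(\<Sum>t\<in>pkeys F. mscale (lkp F t) (Xd (\<lambda>_. 1) * psingle t 1 - (\<Sum>q\<in>D. mscale (\<gamma> t q) (g a q)))) \<in> mpoly.span ?I2"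
      using F by (intro mpoly.span_sum mpoly.span_scale mpoly.span_base \<gamma>) (auto simp: forms_eq)
    also have "(\<Sum>t\<in>pkeys F. mscale (lkp F t) (Xd (\<lambda>_. 1) * psingle t 1 - (\<Sum>q\<in>D. mscale (\<gamma> t q) (g a q))))
      = Xd (\<lambda>_. 1) * (\<Sum>t\<in>pkeys F. mscale (lkp F t) (psingle t 1))
        - (\<Sum>q\<in>D. mscale (\<Sum>t\<in>pkeys F. lkp F t * \<gamma> t q) (g a q))"
      unfolding mpoly.scale_right_diff_distrib sum_subtractf mpoly.scale_sum_left mpoly.scale_sum_right
      by (subst (2) sum.swap) (simp add: sum_distrib_left flip: mscale_mult_right)
    also have "(\<Sum>t\<in>pkeys F. mscale (lkp F t) (psingle t 1)) = F"
      by (subst (3) mpoly_monomials) simp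
    also have "(\<Sum>q\<in>D. mscale (\<Sum>t\<in>pkeys F. lkp F t * \<gamma> t q) (g a q)) = 0"
      using 0 by (intro sum.neutral) (auto simp: lf_def)
    finally have "Xd (\<lambda>_. 1) * F \<in> ?I2" by (simp add: I2)
    moreover have "\<not> vanishes_at I (Xd (\<lambda>_. 1)) P"
      unfolding vanishes_at_iff[OF fin P Xd_form] using p(2) fin
      by (simp add: Xd_def meval_prod X_def)
    ultimately show ?thesis
      unfolding in_double_point_def using Xd_form by blast
  qed
  then show ?thesis using finD cardD by (intro exI[of _ D] exI[of _ "\<lambda>q t. \<gamma> t q"]) auto
qed

text \<open>Valid for every tuple of points, without genericity: the conditions from the separate
  points at worst add up.\<close>

lemma dim_forms_le_sections:
  fixes I :: "'i set"
  assumes fin: "finite I" and P: "\<And>j. j < s \<Longrightarrow> reps I n (P j) (v j)"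
  shows "mpoly.dim (forms I n a) \<le>
    mpoly.dim (double_points_sections I n a s P) + s * (1 + (\<Sum>i\<in>I. n i))"
proof -
  have "\<exists>D. \<exists>\<gamma>. finite D \<and> card D = 1 + (\<Sum>i\<in>I. n i) \<and>
    (\<forall>F\<in>forms I n a. (\<forall>q\<in>(D::('i \<times> nat) option set). clf (\<gamma> q) F = 0) \<longrightarrow> in_double_point I n (P j) F)"
    if "j < s" for j
    by (rule in_double_point_codim[OF fin P[OF that]])
  then obtain D \<gamma> where D: "\<And>j. j < s \<Longrightarrow> finite (D j :: ('i \<times> nat) option set)"
    "\<And>j. j < s \<Longrightarrow> card (D j) = 1 + (\<Sum>i\<in>I. n i)"
    "\<And>j F. j < s \<Longrightarrow> F \<in> forms I n a \<Longrightarrow> (\<forall>q\<in>D j. clf (\<gamma> j q) F = 0) \<Longrightarrow> in_double_point I n (P j) F"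
    by metis
  let ?Q = "SIGMA j:{..<s}. D j"
  obtain W where W: "finite W" "forms I n a \<subseteq> mpoly.span W"
    by (rule forms_fin_span[OF fin])
  have "mpoly.dim (forms I n a) \<le> mpoly.dim (double_points_sections I n a s P) + card ?Q"
  proof (rule mpoly.dim_le_kernel[where \<phi> = "\<lambda>(j, q). clf (\<gamma> j q)"])
    show "{x \<in> forms I n a. \<forall>q\<in>?Q. (case q of (j, q) \<Rightarrow> clf (\<gamma> j q)) x = 0}
      \<subseteq> double_points_sections I n a s P"
      using D(3) by (auto simp: double_points_sections_def)
  qed (use W D(1) forms_subspace in \<open>auto simp: cx.lf_add cx.lf_mscale double_points_sections_def\<close>)
  also have "card ?Q = s * (1 + (\<Sum>i\<in>I. n i))"
    using D(1,2) by (simp add: card_SigmaI)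
  finally show ?thesis by simp
qed

subsection \<open>Semicontinuity\<close>

text \<open>Moves a monomial to the coordinates of the \<open>j\<close>-th point in the power of the
  product space.\<close>

definition rename :: "'j \<Rightarrow> ('i \<times> nat \<Rightarrow>\<^sub>0 nat) \<Rightarrow> (('j \<times> 'i) \<times> nat \<Rightarrow>\<^sub>0 nat)" where
  "rename j t = (\<Sum>x\<in>pkeys t. psingle ((j, fst x), snd x) (lkp t x))"

lemma lookup_rename: "lkp (rename j t) ((j', i), l) = (if j' = j then lkp t (i, l) else 0)"
proof -
  have "lkp (rename j t) ((j', i), l) = (\<Sum>x\<in>pkeys t. if x = (i, l) \<and> j' = j then lkp t x else 0)"
    unfolding rename_def lookup_sum lookup_single when_def
    by (intro sum.cong) auto
  then show ?thesis by (auto simp: in_keys_iff)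
qed

lemma mev_sum: "mev z (\<Sum>x\<in>A. f x) = (\<Prod>x\<in>A. mev z (f x))"
  by (induction A rule: infinite_finite_induct) (simp_all add: mev_add)

lemma mev_rename: "mev z (rename j t) = mev (\<lambda>(i, l). z ((j, i), l)) t"
  unfolding rename_def mev_sum mev_single by (simp add: mev_def case_prod_unfold)

lemma rename_mons:
  assumes "t \<in> mons I n d" "j \<in> J"
  shows "rename j t \<in> mons (J \<times> I) (\<lambda>(j, i). n i) (\<lambda>(j', i). if j' = j then d i else 0)"
proof -
  have "pkeys (rename j t) \<subseteq> (SIGMA p:J \<times> I. {..case p of (j, i) \<Rightarrow> n i})"
  proof
    fix x assume "x \<in> pkeys (rename j t)"
    moreover obtain j' i l where "x = ((j', i), l)" by (metis surj_pair)
    ultimately show "x \<in> (SIGMA p:J \<times> I. {..case p of (j, i) \<Rightarrow> n i})"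
      using assms by (auto simp: in_keys_iff lookup_rename mons_def subset_iff split: if_splits)
  qed
  then show ?thesis using assms by (auto simp: mons_def lookup_rename)
qed

text \<open>The value of the functional \<open>p\<close> on the monomial \<open>t\<close>, as a
  polynomial in the coordinates of a variable tuple of points.\<close>

fun entry :: "'j \<times> ('i \<times> nat) option \<Rightarrow> ('i \<times> nat \<Rightarrow>\<^sub>0 nat) \<Rightarrow> (('j \<times> 'i) \<times> nat) mpoly" where
  "entry (j, None) t = psingle (rename j t) 1"
| "entry (j, Some x) t = psingle (rename j (t - psingle x 1)) (of_nat (lkp t x))"

definition dpt :: "('j \<Rightarrow> 'i \<Rightarrow> nat \<Rightarrow> complex) \<Rightarrow> 'j \<times> ('i \<times> nat) option \<Rightarrow> ('i \<times> nat \<Rightarrow>\<^sub>0 nat) \<Rightarrow> complex" where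
  "dpt V p = dmon (\<lambda>(i, l). V (fst p) i l) (snd p)"

lemma meval_entry: "meval (\<lambda>((j, i), l). V j i l) (entry p t) = dpt V p t"
proof -
  obtain j q where p: "p = (j, q)" by (cases p)
  show ?thesis unfolding p dpt_def by (cases q) (simp_all add: mev_rename)
qed

text \<open>Independent of \<open>t\<close>, as a row of the determinant requires. A derivative that
  kills \<open>t\<close> gives the entry 0, which is a form of every degree.\<close>

fun entry_degree :: "('i \<Rightarrow> nat) \<Rightarrow> 'j \<times> ('i \<times> nat) option \<Rightarrow> 'j \<times> 'i \<Rightarrow> nat" where
  "entry_degree a (j, None) = (\<lambda>(j', i). if j' = j then a i else 0)"
| "entry_degree a (j, Some x) = (\<lambda>(j', i). if j' = j then a i - edeg (fst x) i else 0)"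

lemma entry_form:
  assumes "t \<in> mons I n a" "fst p \<in> J"
  shows "entry p t \<in> forms (J \<times> I) (\<lambda>(j, i). n i) (entry_degree a p)"
proof -
  obtain j q where p: "p = (j, q)" by (cases p)
  show ?thesis
  proof (cases q)
    case None
    then show ?thesis using assms rename_mons[of t I n a j J] by (auto simp: p intro: forms_single)
  next
    case (Some x)
    obtain i l where x: "x = (i, l)" by (cases x)
    show ?thesis
    proof (cases "lkp t x = 0")
      case False
      then show ?thesis
        using assms rename_mons[OF mons_diff_single(1)[OF assms(1), of i l], of j J]
        unfolding p Some x entry.simps entry_degree.simps fst_conv by (intro forms_single) simp
    qed (simp add: p Some)
  qed
qed

definition indep_on :: "'t set \<Rightarrow> 'p set \<Rightarrow> ('p \<Rightarrow> 't \<Rightarrow> complex) \<Rightarrow> bool" where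
  "indep_on T Q D \<longleftrightarrow> (\<forall>c. (\<forall>t\<in>T. (\<Sum>p\<in>Q. c p * D p t) = 0) \<longrightarrow> (\<forall>p\<in>Q. c p = 0))"

text \<open>For \<open>v\<close> in the kernel let \<open>u\<close> be the conjugate transpose of
  \<open>D\<close> applied to \<open>v\<close>. Then \<open>D\<close> kills \<open>u\<close>, so the
  sum of the \<open>|u t|^2\<close> is 0 and \<open>u\<close> vanishes on \<open>T\<close>;
  conjugated, this is a linear relation between the rows of \<open>D\<close>.\<close>

lemma gram_det_nonzero:
  fixes D :: "'p \<Rightarrow> 't \<Rightarrow> complex"
  assumes ind: "indep_on T Q D" and h: "bij_betw h {0..<r} Q" and "finite T"
  shows "det (mat r r (\<lambda>(\<alpha>, \<beta>). \<Sum>t\<in>T. cnj (D (h \<beta>) t) * D (h \<alpha>) t)) \<noteq> 0" (is "det ?G \<noteq> 0")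
proof
  assume "det ?G = 0"
  then obtain v where v: "v \<in> carrier_vec r" "v \<noteq> 0\<^sub>v r" "?G *\<^sub>v v = 0\<^sub>v r"
    using det_0_iff_vec_prod_zero[of ?G r] by auto
  define u where "u t = (\<Sum>\<beta><r. cnj (D (h \<beta>) t) * v $ \<beta>)" for t
  have Du: "(\<Sum>t\<in>T. D (h \<alpha>) t * u t) = 0" if "\<alpha> < r" for \<alpha>
  proof -
    have "0 = (?G *\<^sub>v v) $ \<alpha>" using v(3) that by simp
    also have "\<dots> = (\<Sum>\<beta><r. (\<Sum>t\<in>T. cnj (D (h \<beta>) t) * D (h \<alpha>) t) * v $ \<beta>)"
      using that v(1) by (simp add: scalar_prod_def atLeast0LessThan)
    also have "\<dots> = (\<Sum>t\<in>T. D (h \<alpha>) t * u t)"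
      unfolding u_def sum_distrib_left sum_distrib_right
      by (subst sum.swap) (simp add: algebra_simps)
    finally show ?thesis by simp
  qed
  have cu: "cnj (u t) = (\<Sum>\<alpha><r. cnj (v $ \<alpha>) * D (h \<alpha>) t)" for t
    by (simp add: u_def mult.commute)
  have "(\<Sum>t\<in>T. cnj (u t) * u t) = (\<Sum>\<alpha><r. cnj (v $ \<alpha>) * (\<Sum>t\<in>T. D (h \<alpha>) t * u t))"
    unfolding cu sum_distrib_left sum_distrib_right
    by (subst sum.swap) (simp add: mult.assoc)
  also have "\<dots> = 0" using Du by simp
  finally have "of_real (\<Sum>t\<in>T. (cmod (u t))\<^sup>2) = (0::complex)"
    by (simp add: complex_norm_square mult.commute del: of_real_power)
  then have "(\<Sum>t\<in>T. (cmod (u t))\<^sup>2) = 0" using of_real_eq_0_iff by blast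
  then have u0: "u t = 0" if "t \<in> T" for t
    using that \<open>finite T\<close> by (simp add: sum_nonneg_eq_0_iff)
  define c where "c p = cnj (v $ (inv_into {0..<r} h p))" for p
  have "(\<Sum>p\<in>Q. c p * D p t) = 0" if "t \<in> T" for t
  proof -
    have "(\<Sum>p\<in>Q. c p * D p t) = (\<Sum>\<alpha>\<in>{0..<r}. c (h \<alpha>) * D (h \<alpha>) t)"
      by (rule sum.reindex_bij_betw[OF h, symmetric])
    also have "\<dots> = (\<Sum>\<alpha><r. cnj (v $ \<alpha>) * D (h \<alpha>) t)"
      unfolding atLeast0LessThan[symmetric]
      using h by (intro sum.cong) (auto simp: c_def bij_betw_def inv_into_f_f)
    also have "\<dots> = 0" using u0[OF that] cu[of t] by simp
    finally show ?thesis .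
  qed
  then have "c p = 0" if "p \<in> Q" for p
    using ind that by (auto simp: indep_on_def)
  then have "v $ \<alpha> = 0" if "\<alpha> < r" for \<alpha>
    using that h by (force simp: c_def bij_betw_def)
  then have "v = 0\<^sub>v r" using v(1) by auto
  then show False using v(2) by simp
qed

text \<open>A determinant is a form in the coordinates of the points only if each of its rows has a fixed
  multidegree. Multiplying the matrix of functionals by the constant conjugate transpose of its
  value at one triple preserves this and gives a Gram matrix there.\<close>

lemma indep_functionals_open:
  fixes I :: "'i set" and V :: "nat \<Rightarrow> 'i \<Rightarrow> nat \<Rightarrow> complex"
  assumes fin: "finite I" and "finite Q" and Q: "\<And>p. p \<in> Q \<Longrightarrow> fst p < s"
    and V: "\<And>j i. j < s \<Longrightarrow> i \<in> I \<Longrightarrow> V j i \<in> nonzero_vectors (n i)"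
    and ind: "indep_on (mons I n a) Q (dpt V)"
  shows "\<exists>U. zariski_open ({..<s} \<times> I) (\<lambda>(j, i). n i) U \<and> U \<noteq> {} \<and>
    (\<forall>P\<in>U. card Q + mpoly.dim (double_points_sections I n a s (\<lambda>j i. P (j, i))) \<le> mpoly.dim (forms I n a))"
proof -
  let ?J = "{..<s} \<times> I" and ?n = "\<lambda>(j::nat, i). n i"
  let ?T = "mons I n a"
  define r where "r = card Q"
  obtain h where h: "bij_betw h {0..<r} Q"
    using ex_bij_betw_nat_finite[OF \<open>finite Q\<close>] by (auto simp: r_def)
  have hQ: "h \<alpha> \<in> Q" if "\<alpha> < r" for \<alpha> using h that by (auto simp: bij_betw_def)
  have finT: "finite ?T" by (rule finite_mons[OF fin])
  have finJ: "finite ?J" using fin by simp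
  define w where "w \<beta> t = cnj (dpt V (h \<beta>) t)" for \<beta> t
  define M where "M = mat r r (\<lambda>(\<alpha>, \<beta>). \<Sum>t\<in>?T. mscale (w \<beta> t) (entry (h \<alpha>) t))"
  define ev where "ev V' = (\<lambda>((j, i), l). V' j i l :: complex)" for V' :: "nat \<Rightarrow> 'i \<Rightarrow> nat \<Rightarrow> complex"
  have M: "map_mat (meval (ev V')) M = mat r r (\<lambda>(\<alpha>, \<beta>). \<Sum>t\<in>?T. w \<beta> t * dpt V' (h \<alpha>) t)" for V'
    unfolding M_def ev_def
    by (intro eq_matI) (auto simp: meval_sum meval_mscale meval_entry)
  have detM: "det M \<in> forms ?J ?n (\<lambda>x. \<Sum>\<alpha>\<in>{0..<r}. entry_degree a (h \<alpha>) x)"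
  proof -
    have "M $$ (\<alpha>, \<beta>) \<in> forms ?J ?n (entry_degree a (h \<alpha>))" if "\<alpha> < r" "\<beta> < r" for \<alpha> \<beta>
      using that Q[OF hQ] by (simp add: M_def forms_sum forms_mscale entry_form)
    then have "(\<Prod>\<alpha> = 0..<r. M $$ (\<alpha>, p \<alpha>)) \<in> forms ?J ?n (\<lambda>x. \<Sum>\<alpha>\<in>{0..<r}. entry_degree a (h \<alpha>) x)"
      if "p permutes {0..<r}" for p
      using permutes_in_image[OF that] by (intro forms_prod) auto
    then show ?thesis
      by (subst det_def'[of _ r]) (auto simp: M_def sign_def intro!: forms_sum forms_neg)
  qed
  define U where "U = {P \<in> multiproj ?J ?n. \<exists>f\<in>{det M}. \<not> vanishes_at ?J f P}"
  have "zariski_open ?J ?n U"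
    unfolding zariski_open_def U_def using detM by (intro exI[of _ "{det M}"]) auto
  moreover have "U \<noteq> {}"
  proof -
    let ?V = "\<lambda>(j, i). V j i"
    let ?P = "\<lambda>x\<in>?J. ray (?V x)"
    have P: "?P \<in> multiproj ?J ?n" "reps ?J ?n ?P ?V"
      using reps_multiproj[of ?J ?V ?n] V by auto
    have "meval (ev V) (det M) = det (map_mat (meval (ev V)) M)"
      by (simp add: meval_hom.hom_det)
    also have "\<dots> \<noteq> 0"
      using gram_det_nonzero[OF ind h finT] by (simp add: M w_def)
    finally have "\<not> vanishes_at ?J (det M) ?P"
      unfolding vanishes_at_iff[OF finJ P(2) detM] ev_def by (simp add: case_prod_unfold)
    then show ?thesis using P(1) by (auto simp: U_def)
  qed
  moreover have "card Q + mpoly.dim (double_points_sections I n a s (\<lambda>j i. P (j, i)))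
      \<le> mpoly.dim (forms I n a)" if P: "P \<in> U" for P
  proof -
    let ?K = "double_points_sections I n a s (\<lambda>j i. P (j, i))"
    obtain V'' where V'': "reps ?J ?n P V''"
      using multiproj_reps P unfolding U_def by blast
    define V' where "V' j i = V'' (j, i)" for j i
    have reps: "reps I n (\<lambda>i. P (j, i)) (V' j)" if "j < s" for j
      using V'' that by (auto simp: reps_def V'_def)
    have ker: "clf (dpt V' p) F = 0" if "F \<in> ?K" "p \<in> Q" for F p
      using that Q[of p] in_double_point_dmon[OF fin reps, of "fst p" F "snd p"]
      by (simp add: double_points_sections_def dpt_def)
    have "mpoly.subspace {F. \<forall>p\<in>Q. clf (dpt V' p) F = 0}"
      by (rule mpoly.subspaceI) (auto simp: cx.lf_add cx.lf_mscale)
    then have kerspan: "mpoly.span ?K \<subseteq> {F. \<forall>p\<in>Q. clf (dpt V' p) F = 0}"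
      using ker by (intro mpoly.span_minimal) auto
    let ?G = "mat r r (\<lambda>(\<alpha>, \<beta>). \<Sum>t\<in>?T. w \<beta> t * dpt V' (h \<alpha>) t)"
    have "meval (ev V') (det M) \<noteq> 0"
      using P vanishes_at_iff[OF finJ V'' detM]
      by (simp add: U_def ev_def V'_def case_prod_unfold)
    then have detG: "det ?G \<noteq> 0"
      by (simp flip: M add: meval_hom.hom_det)
    obtain W where W: "finite W" "forms I n a \<subseteq> mpoly.span W"
      by (rule forms_fin_span[OF fin])
    \<comment> \<open>The weights \<open>w \<beta>\<close> define \<open>r\<close> forms on which
      the functionals at the new tuple take the entries of \<open>?G\<close> as values. Since
      \<open>?G\<close> is invertible, no nontrivial combination of them lies in the span of the
      sections.\<close>
    have "card {..<r} + mpoly.dim ?K \<le> mpoly.dim (forms I n a)"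
    proof (rule mpoly.family_dim_le[where f = "\<lambda>\<beta>. \<Sum>t\<in>?T. psingle t (w \<beta> t)"])
      fix c :: "nat \<Rightarrow> complex"
      assume c: "(\<Sum>\<beta><r. mscale (c \<beta>) (\<Sum>t\<in>?T. psingle t (w \<beta> t))) \<in> mpoly.span ?K"
      have "?G *\<^sub>v vec r c = 0\<^sub>v r"
      proof (rule eq_vecI)
        fix \<alpha> assume "\<alpha> < dim_vec (0\<^sub>v r :: complex vec)"
        then have \<alpha>: "\<alpha> < r" by simp
        have "0 = clf (dpt V' (h \<alpha>)) (\<Sum>\<beta><r. mscale (c \<beta>) (\<Sum>t\<in>?T. psingle t (w \<beta> t)))"
          using c kerspan hQ[OF \<alpha>] by auto
        also have "\<dots> = (\<Sum>\<beta><r. c \<beta> * (\<Sum>t\<in>?T. w \<beta> t * dpt V' (h \<alpha>) t))"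
          by (simp add: cx.lf_sum cx.lf_mscale)
        also have "\<dots> = (?G *\<^sub>v vec r c) $ \<alpha>"
          using \<alpha> by (simp add: scalar_prod_def atLeast0LessThan mult.commute)
        finally show "(?G *\<^sub>v vec r c) $ \<alpha> = 0\<^sub>v r $ \<alpha>" using \<alpha> by simp
      qed simp
      then have "vec r c = 0\<^sub>v r"
        using detG det_0_iff_vec_prod_zero[of ?G r] vec_carrier[of r c] by fastforce
      then show "\<forall>\<beta>\<in>{..<r}. c \<beta> = 0"
        by (metis index_vec index_zero_vec(1) lessThan_iff)
    qed (use W forms_subspace in \<open>auto simp: double_points_sections_def intro!: forms_sum forms_single\<close>)
    then show ?thesis by (simp add: r_def)
  qed
  ultimately show ?thesis by blast
qed

text \<open>The open set gives the lower bound \<open>card Q\<close>. The upper bounds, by the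
  number of conditions and by the number of monomials, hold at every tuple.\<close>

lemma general_hilbert_eq:
  fixes I :: "'i set" and V :: "nat \<Rightarrow> 'i \<Rightarrow> nat \<Rightarrow> complex"
  assumes fin: "finite I" and "finite Q" and Q: "\<And>p. p \<in> Q \<Longrightarrow> fst p < s"
    and V: "\<And>j i. j < s \<Longrightarrow> i \<in> I \<Longrightarrow> V j i \<in> nonzero_vectors (n i)"
    and ind: "indep_on (mons I n a) Q (dpt V)"
    and card: "min (s * (1 + (\<Sum>i\<in>I. n i))) (card (mons I n a)) \<le> card Q"
  shows "for_general_points s I n (\<lambda>P. hilbert_double_points I n a s P =
    int (min (s * (1 + (\<Sum>i\<in>I. n i))) (card (mons I n a))))"
proof -
  obtain U where U: "zariski_open ({..<s} \<times> I) (\<lambda>(j, i). n i) U" "U \<noteq> {}"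
    "\<And>P. P \<in> U \<Longrightarrow> card Q + mpoly.dim (double_points_sections I n a s (\<lambda>j i. P (j, i))) \<le> mpoly.dim (forms I n a)"
    using indep_functionals_open[OF fin \<open>finite Q\<close> Q V ind] by blast
  have "hilbert_double_points I n a s (\<lambda>j i. P (j, i)) =
    int (min (s * (1 + (\<Sum>i\<in>I. n i))) (card (mons I n a)))" if P: "P \<in> U" for P
  proof -
    have "P \<in> multiproj ({..<s} \<times> I) (\<lambda>(j, i). n i)"
      using U(1) P by (auto simp: zariski_open_def)
    then obtain v where v: "reps ({..<s} \<times> I) (\<lambda>(j, i). n i) P v"
      using multiproj_reps by blast
    have "mpoly.dim (forms I n a) \<le>
      mpoly.dim (double_points_sections I n a s (\<lambda>j i. P (j, i))) + s * (1 + (\<Sum>i\<in>I. n i))"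
      by (rule dim_forms_le_sections[OF fin, where v = "\<lambda>j i. v (j, i)"]) (use v in \<open>auto simp: reps_def\<close>)
    then show ?thesis
      using U(3)[OF P] card dim_forms[OF fin, of n a]
      unfolding hilbert_double_points_def by linarith
  qed
  then show ?thesis
    unfolding for_general_points_def using U(1,2) by blast
qed

text \<open>Every functional in \<open>Q\<close> depends on a maximal independent subset
  \<open>Q'\<close>, which therefore has the same kernel. When this kernel is 0, there are at least
  as many functionals in \<open>Q'\<close> as monomials.\<close>

lemma trivial_kernel_indep_subset:
  fixes D :: "'p \<Rightarrow> ('i \<times> nat \<Rightarrow>\<^sub>0 nat) \<Rightarrow> complex"
  assumes fin: "finite I" and "finite Q"
    and ker: "\<And>F. F \<in> forms I n a \<Longrightarrow> \<forall>p\<in>Q. clf (D p) F = 0 \<Longrightarrow> F = 0"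
  shows "\<exists>Q'\<subseteq>Q. indep_on (mons I n a) Q' D \<and> card (mons I n a) \<le> card Q'"
proof -
  let ?S = "{Q'. Q' \<subseteq> Q \<and> indep_on (mons I n a) Q' D}"
  have "finite ?S" "?S \<noteq> {}" using \<open>finite Q\<close> by (auto simp: indep_on_def)
  from finite_has_maximal[OF this] obtain Q' where
    Q': "Q' \<in> ?S" "\<forall>B\<in>?S. Q' \<subseteq> B \<longrightarrow> Q' = B"
    by (elim bexE)
  then have sub: "Q' \<subseteq> Q" and ind: "indep_on (mons I n a) Q' D" by auto
  have finQ': "finite Q'" using sub \<open>finite Q\<close> finite_subset by blast
  have "clf (D p) F = 0" if F: "F \<in> forms I n a" "\<forall>p\<in>Q'. clf (D p) F = 0" and p: "p \<in> Q" for p F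
  proof (cases "p \<in> Q'")
    case False
    have "\<not> indep_on (mons I n a) (insert p Q') D"
      using Q'(2) False p sub by blast
    then obtain c where c: "\<forall>t\<in>mons I n a. (\<Sum>p'\<in>insert p Q'. c p' * D p' t) = 0"
      "\<exists>p'\<in>insert p Q'. c p' \<noteq> 0"
      by (auto simp: indep_on_def)
    have c1: "c p * D p t + (\<Sum>p'\<in>Q'. c p' * D p' t) = 0" if "t \<in> mons I n a" for t
      using c(1) that False finQ' by simp
    have "c p \<noteq> 0"
    proof
      assume "c p = 0"
      then have "\<forall>p'\<in>Q'. c p' = 0" using c1 ind by (auto simp: indep_on_def)
      then show False using c(2) \<open>c p = 0\<close> by auto
    qed
    have "c p * clf (D p) F = (\<Sum>t\<in>mons I n a. lkp F t * (c p * D p t))"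
      by (simp add: clf_form[OF fin F(1)] sum_distrib_left mult.left_commute)
    also have "\<dots> = (\<Sum>t\<in>mons I n a. lkp F t * (- (\<Sum>p'\<in>Q'. c p' * D p' t)))"
      using c1 by (intro sum.cong) (simp_all add: eq_neg_iff_add_eq_0 flip: distrib_left)
    also have "\<dots> = - (\<Sum>p'\<in>Q'. c p' * clf (D p') F)"
      unfolding clf_form[OF fin F(1)] sum_distrib_left mult_minus_right sum_negf
      by (subst sum.swap) (simp add: mult.left_commute)
    also have "\<dots> = 0" using F(2) by simp
    finally show ?thesis using \<open>c p \<noteq> 0\<close> by simp
  qed (use F in auto)
  then have "{F \<in> forms I n a. \<forall>p\<in>Q'. clf (D p) F = 0} \<subseteq> {0}"
    using ker by blast
  moreover obtain W where W: "finite W" "forms I n a \<subseteq> mpoly.span W"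
    by (rule forms_fin_span[OF fin])
  ultimately have "mpoly.dim (forms I n a) \<le> mpoly.dim {0::('i \<times> nat) mpoly} + card Q'"
    by (intro mpoly.dim_le_kernel[OF forms_subspace finQ', where \<phi> = "\<lambda>p. clf (D p)"])
      (auto simp: cx.lf_add cx.lf_mscale)
  moreover have "mpoly.dim {0::('i \<times> nat) mpoly} \<le> 0"
    using mpoly.dim_le_card[of "{0}" "{}"] by simp
  ultimately show ?thesis using sub ind dim_forms[OF fin, of n a] by auto
qed

text \<open>The determinants say that, in each factor, the first two coordinates of the three points
  define three distinct points of a projective line.\<close>

lemma nonvanishing_on_line:
  fixes I :: "'i set"
  assumes fin: "finite I" and n: "\<And>i. i \<in> I \<Longrightarrow> 1 \<le> n i"
    and U: "zariski_open ({..<3::nat} \<times> I) (\<lambda>(j, i). n i) U" "U \<noteq> {}"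
  shows "\<exists>P\<in>U. \<exists>V. (\<forall>j<3. reps I n (\<lambda>i. P (j, i)) (V j)) \<and>
    (\<forall>i\<in>I. \<forall>j<3. \<forall>j'<3. j \<noteq> j' \<longrightarrow> V j i 0 * V j' i 1 - V j i 1 * V j' i 0 \<noteq> 0)"
proof -
  let ?J = "{..<3::nat} \<times> I" and ?n = "\<lambda>(j::nat, i). n i"
  have finJ: "finite ?J" using fin by simp
  obtain P0 f d where P0: "P0 \<in> multiproj ?J ?n" and f: "f \<in> forms ?J ?n d" "\<not> vanishes_at ?J f P0"
    and fU: "\<And>P. P \<in> multiproj ?J ?n \<Longrightarrow> \<not> vanishes_at ?J f P \<Longrightarrow> P \<in> U"
    using U by (fastforce simp: zariski_open_def)
  obtain v where v: "reps ?J ?n P0 v" using multiproj_reps[OF P0] by blast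
  \<comment> \<open>In every factor the three vectors start with (1, 0), (0, 1), (1, 1), so all
    determinants are nonzero at the end of the line where the parameter is 1.\<close>
  define w :: "nat \<times> 'i \<Rightarrow> nat \<Rightarrow> complex" where
    "w = (\<lambda>(j, i) l. if l = 0 \<and> j \<noteq> 1 \<or> l = 1 \<and> j \<noteq> 0 then 1 else 0)"
  define z where "z x l = [:v x l, w x l - v x l:]" for x l
  define br where "br = (\<lambda>(i, j, j'). z (j, i) 0 * z (j', i) 1 - z (j, i) 1 * z (j', i) 0)"
  define S where "S = {(i, j, j'). i \<in> I \<and> j < 3 \<and> j' < 3 \<and> j \<noteq> (j'::nat)}"
  have finS: "finite S"
    by (rule finite_subset[of _ "I \<times> {..<3} \<times> {..<3}"]) (use fin in \<open>auto simp: S_def\<close>)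
  have "poly (pev (\<lambda>(x, l). z x l) f) 0 = meval (\<lambda>(x, l). v x l) f"
    by (simp add: poly_pev case_prod_unfold z_def)
  also have "\<dots> \<noteq> 0" using f(2) vanishes_at_iff[OF finJ v f(1)] by simp
  finally have "pev (\<lambda>(x, l). z x l) f \<noteq> 0" by auto
  moreover have "br p \<noteq> 0" if p: "p \<in> S" for p
  proof -
    obtain i j j' where ijj: "p = (i, j, j')" "j < 3" "j' < 3" "j \<noteq> j'"
      using p by (auto simp: S_def)
    then have "j \<in> {0, 1, 2}" "j' \<in> {0, 1, 2}" by auto
    moreover have "poly (z x l) 1 = w x l" for x l by (simp add: z_def)
    ultimately have "poly (br p) 1 \<noteq> 0" using ijj(4)
      by (auto simp: br_def w_def ijj(1))
    then show ?thesis by auto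
  qed
  \<comment> \<open>The form is nonzero at parameter 0 and each determinant at parameter 1. The
    product is thus a nonzero polynomial, and any parameter that is not a root gives the
    triple.\<close>
  ultimately have R: "pev (\<lambda>(x, l). z x l) f * (\<Prod>p\<in>S. br p) \<noteq> 0" (is "?R \<noteq> 0")
    using finS by simp
  obtain \<tau> where \<tau>: "poly ?R \<tau> \<noteq> 0"
  proof -
    have "finite {x. poly ?R x = 0}" by (rule poly_roots_finite[OF R])
    then show thesis using that ex_new_if_finite[OF infinite_UNIV_char_0] by blast
  qed
  define y where "y x l = poly (z x l) \<tau>" for x l
  have ybr: "y (j, i) 0 * y (j', i) 1 - y (j, i) 1 * y (j', i) 0 \<noteq> 0"
    if "i \<in> I" "j < 3" "j' < 3" "j \<noteq> j'" for i j j'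
  proof -
    have "(i, j, j') \<in> S" using that by (auto simp: S_def)
    then have "poly (br (i, j, j')) \<tau> \<noteq> 0" using \<tau> finS by (auto simp: poly_prod)
    then show ?thesis by (simp add: br_def y_def)
  qed
  have ynz: "y x \<in> nonzero_vectors (?n x)" if xJ: "x \<in> ?J" for x
  proof -
    obtain j i where x: "x = (j, i)" "j < 3" "i \<in> I" using xJ by auto
    obtain j' :: nat where j': "j' < 3" "j' \<noteq> j" using that[of 0] that[of 1] by fastforce
    have "y x 0 \<noteq> 0 \<or> y x 1 \<noteq> 0" using ybr[OF x(3,2) j'(1)] j'(2) x(1) by auto
    moreover have "y x l = 0" if "l > n i" for l
      using v xJ that n[OF x(3)]
      by (auto simp: y_def z_def w_def x(1) reps_def nonzero_vectors_def)
    ultimately show ?thesis using n[OF x(3)] by (auto simp: nonzero_vectors_def x(1))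
  qed
  let ?P = "\<lambda>x\<in>?J. ray (y x)"
  have P: "?P \<in> multiproj ?J ?n" "reps ?J ?n ?P y"
    using reps_multiproj[of ?J y ?n] ynz by auto
  have "meval (\<lambda>(x, l). y x l) f = poly (pev (\<lambda>(x, l). z x l) f) \<tau>"
    by (simp add: poly_pev y_def case_prod_unfold)
  also have "\<dots> \<noteq> 0" using \<tau> by auto
  finally have "?P \<in> U"
    using fU[OF P(1)] vanishes_at_iff[OF finJ P(2) f(1)] by simp
  moreover have "reps I n (\<lambda>i. ?P (j, i)) (\<lambda>i. y (j, i))" if "j < 3" for j
    using P(2) that by (auto simp: reps_def)
  ultimately show ?thesis
    using ybr by (intro bexI[of _ ?P] exI[of _ "\<lambda>j i. y (j, i)"]) auto
qed

subsection \<open>Three special points\<close>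

definition wt :: "('v \<Rightarrow> bool) \<Rightarrow> ('v \<Rightarrow>\<^sub>0 nat) \<Rightarrow> nat" where
  "wt S t = (\<Sum>x\<in>pkeys t. if S x then lkp t x else 0)"

lemma wt_superset: "finite T \<Longrightarrow> pkeys t \<subseteq> T \<Longrightarrow> wt S t = (\<Sum>x\<in>T. if S x then lkp t x else 0)"
  unfolding wt_def by (intro sum.mono_neutral_left) (auto simp: in_keys_iff)

lemma wt_add: "wt S (s + t) = wt S s + wt S t"
proof -
  let ?T = "pkeys s \<union> pkeys t"
  have "pkeys (s + t) \<subseteq> ?T" by (rule Poly_Mapping.keys_add)
  then show ?thesis
    using wt_superset[of ?T s S] wt_superset[of ?T t S] wt_superset[of ?T "s + t" S]
    by (simp flip: sum.distrib) (intro sum.cong, auto simp: lookup_add)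
qed

lemma wt_single: "wt S (psingle x m) = (if S x then m else 0)"
  by (simp add: wt_def)

lemma wt_mons:
  assumes "finite I" "t \<in> mons I n d"
  shows "wt S t = (\<Sum>i\<in>I. \<Sum>l\<le>n i. if S (i, l) then lkp t (i, l) else 0)"
proof -
  let ?X = "SIGMA i:I. {..n i}"
  have "finite ?X" "pkeys t \<subseteq> ?X" using assms by (auto simp: mons_def)
  then have "wt S t = (\<Sum>x\<in>?X. if S x then lkp t x else 0)" by (rule wt_superset)
  also have "\<dots> = (\<Sum>(i, l)\<in>?X. if S (i, l) then lkp t (i, l) else 0)"
    by (intro sum.cong) auto
  also have "\<dots> = (\<Sum>i\<in>I. \<Sum>l\<le>n i. if S (i, l) then lkp t (i, l) else 0)"
    using assms(1) by (subst sum.Sigma) auto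
  finally show ?thesis .
qed

lemma wt_ge_sum:
  assumes "finite Y" "\<And>x. x \<in> Y \<Longrightarrow> S x"
  shows "(\<Sum>x\<in>Y. lkp t x) \<le> wt S t"
proof -
  have "(\<Sum>x\<in>Y. lkp t x) = (\<Sum>x\<in>Y. if S x then lkp t x else 0)"
    using assms(2) by (intro sum.cong) auto
  also have "\<dots> \<le> (\<Sum>x\<in>Y \<union> pkeys t. if S x then lkp t x else 0)"
    using assms(1) by (intro sum_mono2) auto
  also have "\<dots> = wt S t" using assms(1) by (subst wt_superset[of "Y \<union> pkeys t"]) auto
  finally show ?thesis .
qed

lemma wt_ge: "S x \<Longrightarrow> lkp t x \<le> wt S t"
  using wt_ge_sum[of "{x}" S t] by simp

lemma wt_ge2: "S x \<Longrightarrow> S y \<Longrightarrow> x \<noteq> y \<Longrightarrow> lkp t x + lkp t y \<le> wt S t"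
  using wt_ge_sum[of "{x, y}" S t] by auto

lemma wt_pos: "wt S t \<noteq> 0 \<Longrightarrow> \<exists>x\<in>pkeys t. S x"
  by (rule ccontr) (auto simp: wt_def)

lemma wt_disj:
  assumes "\<And>x. x \<in> pkeys t \<Longrightarrow> (if S x then 1 else 0) = (if S1 x then 1 else 0) + (if S2 x then 1 else (0::nat))"
  shows "wt S t = wt S1 t + wt S2 t"
  unfolding wt_def sum.distrib[symmetric]
proof (rule sum.cong[OF refl])
  fix x assume "x \<in> pkeys t"
  from assms[OF this]
  show "(if S x then lkp t x else 0) = (if S1 x then lkp t x else 0) + (if S2 x then lkp t x else 0)"
    by (auto split: if_splits)
qed

text \<open>Homogeneity in factor \<open>i\<close> recovers the exponent of the one variable
  \<open>(i, p i)\<close> that \<open>eq\<close> leaves out.\<close>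

lemma mons_eqI:
  fixes I :: "'i set"
  assumes t: "t \<in> mons I n d" and t': "t' \<in> mons I n d"
    and p: "\<And>i. i \<in> I \<Longrightarrow> p i \<le> n i"
    and eq: "\<And>i l. i \<in> I \<Longrightarrow> l \<le> n i \<Longrightarrow> l \<noteq> p i \<Longrightarrow> lkp t (i, l) = lkp t' (i, l)"
  shows "t = t'"
proof (rule poly_mapping_eqI)
  fix x :: "'i \<times> nat"
  obtain i l where x: "x = (i, l)" by (cases x)
  show "lkp t x = lkp t' x"
  proof (cases "i \<in> I \<and> l \<le> n i")
    case True
    have s: "(\<Sum>l\<le>n i. lkp u (i, l)) = lkp u (i, p i) + (\<Sum>l\<in>{..n i} - {p i}. lkp u (i, l))" for u
      using p True by (subst sum.remove[of _ "p i"]) auto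
    have "(\<Sum>l\<le>n i. lkp t (i, l)) = (\<Sum>l\<le>n i. lkp t' (i, l))"
      using t t' True by (auto simp: mons_def)
    moreover have "(\<Sum>l\<in>{..n i} - {p i}. lkp t (i, l)) = (\<Sum>l\<in>{..n i} - {p i}. lkp t' (i, l))"
      using eq True by (intro sum.cong) auto
    ultimately have "lkp t (i, p i) = lkp t' (i, p i)" using s[of t] s[of t'] by simp
    then show ?thesis using eq True by (cases "l = p i") (auto simp: x)
  next
    case False
    then have "x \<notin> pkeys t" "x \<notin> pkeys t'" using t t' by (auto simp: mons_def x)
    then show ?thesis by (simp add: in_keys_iff)
  qed
qed

lemma mons_move:
  assumes t: "t \<in> mons I n d" and x: "lkp t (i, l') \<noteq> 0" and l: "l \<le> n i"
  shows "t - psingle (i, l') 1 + psingle (i, l) 1 \<in> mons I n d"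
proof -
  note m = mons_diff_single[OF t x]
  have "t - psingle (i, l') 1 + psingle (i, l) 1 \<in> mons I n (\<lambda>i'. (d i' - edeg i i') + edeg i i')"
    by (rule mons_add[OF m(1) mons_single[where n = n, OF m(3) l]])
  also have "mons I n (\<lambda>i'. (d i' - edeg i i') + edeg i i') = mons I n d"
    using m(2) by (intro mons_cong) (auto simp: edeg_def)
  finally show ?thesis .
qed

lemma wt_move:
  assumes "lkp t x \<noteq> 0"
  shows "wt S (t - psingle x 1 + psingle y 1) + (if S x then 1 else 0) = wt S t + (if S y then 1 else 0)"
proof -
  have eq: "t = (t - psingle x 1) + psingle x 1"
    using assms by (intro poly_mapping_eqI) (auto simp: lookup_add lookup_minus lookup_single when_def)
  have "wt S t = wt S (t - psingle x 1) + (if S x then 1 else 0)"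
    using arg_cong[OF eq, of "wt S"] unfolding wt_add wt_single .
  then show ?thesis by (simp add: wt_add wt_single)
qed

lemma lookup_move:
  "x \<noteq> y \<Longrightarrow> lkp (t - psingle x 1 + psingle y 1) z = (if z = x then lkp t z - 1 else if z = y then lkp t z + 1 else lkp t z)"
  by (auto simp: lookup_add lookup_minus lookup_single when_def)

lemma exists_bounded_sum:
  fixes b :: "'i \<Rightarrow> nat"
  assumes "finite B" "s \<le> sum b B"
  shows "\<exists>z. (\<forall>i\<in>B. z i \<le> b i) \<and> sum z B = s"
  using assms
proof (induction B arbitrary: s rule: finite_induct)
  case (insert x B)
  have "s - min s (b x) \<le> sum b B" using insert.prems insert.hyps by auto
  then obtain z where z: "\<forall>i\<in>B. z i \<le> b i" "sum z B = s - min s (b x)"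
    using insert.IH by blast
  have "sum (z(x := min s (b x))) B = sum z B" using insert.hyps by (intro sum.cong) auto
  then show ?case
    using z insert.hyps by (intro exI[of _ "z(x := min s (b x))"]) auto
qed auto

section \<open>The special triple and the orders of monomials at its points\<close>

locale three_points =
  fixes I :: "'i set" and n a :: "'i \<Rightarrow> nat"
  assumes fin: "finite I" and n: "\<And>i. i \<in> I \<Longrightarrow> 1 \<le> n i" and a: "\<And>i. i \<in> I \<Longrightarrow> 1 \<le> a i"
begin

definition "A = {i \<in> I. 2 \<le> n i}"
definition "B = {i \<in> I. n i = 1}"
definition "degA = sum a A"
definition "degB = sum a B"

lemma AB: "finite A" "finite B" "A \<union> B = I" "A \<inter> B = {}"
proof -
  show "finite A" "finite B" using fin by (auto simp: A_def B_def)
  show "A \<inter> B = {}" by (auto simp: A_def B_def)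
  have "2 \<le> n i \<or> n i = 1" if "i \<in> I" for i using n[OF that] by linarith
  then show "A \<union> B = I" by (auto simp: A_def B_def)
qed

lemma deg_sum: "sum a I = degA + degB"
  using sum.union_disjoint[OF AB(1,2,4), of a] unfolding AB(3) degA_def degB_def .

text \<open>\<open>nz j\<close> is the support of the \<open>j\<close>-th special point. By Euler's relation, the derivative along
  one coordinate of each factor, chosen by \<open>piv\<close>, is redundant once the value is known.\<close>

definition nz :: "nat \<Rightarrow> 'i \<times> nat \<Rightarrow> bool" where
  "nz j = (\<lambda>(i, l). if j = 2 \<and> n i = 1 then l \<le> 1 else l = j)"

definition pt :: "nat \<Rightarrow> 'i \<Rightarrow> nat \<Rightarrow> complex" where
  "pt j i l = (if nz j (i, l) then 1 else 0)"

definition piv :: "nat \<Rightarrow> 'i \<Rightarrow> nat" where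
  "piv j i = (if j = 2 \<and> n i = 1 then 1 else j)"

definition dirs :: "nat \<Rightarrow> ('i \<times> nat) set" where
  "dirs j = (SIGMA i:I. {..n i} - {piv j i})"

definition Q :: "(nat \<times> ('i \<times> nat) option) set" where
  "Q = (SIGMA j:{..<3}. insert None (Some ` dirs j))"

abbreviation "Mon \<equiv> mons I n a"
text \<open>The order of vanishing of \<open>t\<close> at the \<open>j\<close>-th special point:
  variables in the support are units there, the others are local parameters.\<close>

abbreviation "off j t \<equiv> wt (\<lambda>x. \<not> nz j x) t"

lemma piv_le: "j < 3 \<Longrightarrow> i \<in> I \<Longrightarrow> piv j i \<le> n i"
  using n[of i] by (auto simp: piv_def)

lemma finite_dirs: "finite (dirs j)"
  using fin by (auto simp: dirs_def)

lemma finite_Q: "finite Q"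
  using finite_dirs by (auto simp: Q_def)

lemma card_Q: "card Q = 3 * (1 + sum n I)"
proof -
  have "card (dirs j) = sum n I" if "j < 3" for j
    using fin piv_le[OF that] by (simp add: dirs_def card_SigmaI)
  then have "card (insert None (Some ` dirs j)) = 1 + sum n I" if "j < 3" for j
    using that finite_dirs[of j] by (simp add: card_insert_if card_image)
  then show ?thesis
    unfolding Q_def using finite_dirs by (subst card_SigmaI) auto
qed

lemma pt_nonzero:
  assumes "j < 3" "i \<in> I"
  shows "pt j i \<in> nonzero_vectors (n i)"
proof -
  have "pt j i (piv j i) \<noteq> 0" by (simp add: pt_def nz_def piv_def)
  moreover have "pt j i l = 0" if "n i < l" for l
    using that assms n[OF assms(2)] by (auto simp: pt_def nz_def)
  ultimately show ?thesis using piv_le[OF assms] by (auto simp: nonzero_vectors_def)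
qed

lemma mev_pt: "mev (\<lambda>(i, l). pt j i l) t = (if off j t = 0 then 1 else 0)"
proof (cases "off j t = 0")
  case True
  then have "nz j x" if "x \<in> pkeys t" for x
    using wt_ge[of "\<lambda>x. \<not> nz j x" x t] that by (auto simp: in_keys_iff)
  then show ?thesis using True by (auto simp: mev_def pt_def case_prod_unfold)
next
  case False
  then obtain x where x: "x \<in> pkeys t" "\<not> nz j x" using wt_pos[OF False] by blast
  then have "(case x of (i, l) \<Rightarrow> pt j i l) ^ lkp t x = 0"
    by (cases x) (simp add: pt_def in_keys_iff)
  then have "mev (\<lambda>(i, l). pt j i l) t = 0"
    unfolding mev_def by (intro prod_zero[OF finite_keys] bexI[OF _ x(1)])
  then show ?thesis using False by simp
qed

lemma dpt_None: "dpt pt (j, None) t = (if off j t = 0 then 1 else 0)"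
  by (simp add: dpt_def mev_pt)

text \<open>A derivative along \<open>x\<close> is nonzero only if no variable off the support
  remains afterwards. The order of \<open>t\<close> is then 0 for \<open>x\<close> in the support,
  and otherwise 1, used up by \<open>x\<close> itself.\<close>

lemma dpt_Some: "dpt pt (j, Some x) t = (if off j t = (if nz j x then 0 else 1) then of_nat (lkp t x) else 0)"
proof (cases "lkp t x = 0")
  case False
  then have eq: "t = (t - psingle x 1) + psingle x 1"
    by (intro poly_mapping_eqI) (auto simp: lookup_add lookup_minus lookup_single when_def)
  have "off j t = off j (t - psingle x 1) + (if nz j x then 0 else 1)"
    using arg_cong[OF eq, of "wt (\<lambda>x. \<not> nz j x)"] unfolding wt_add wt_single by simp
  then show ?thesis by (auto simp: dpt_def mev_pt)
qed (simp add: dpt_def)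

lemma sum_Q: "(\<Sum>p\<in>Q. f p) = (\<Sum>j<3. f (j, None) + (\<Sum>x\<in>dirs j. f (j, Some x)))"
proof -
  have "(\<Sum>j<3. \<Sum>q\<in>insert None (Some ` dirs j). f (j, q)) = (\<Sum>p\<in>Q. f p)"
    unfolding Q_def using finite_dirs by (subst sum.Sigma) auto
  then have "(\<Sum>p\<in>Q. f p) = (\<Sum>j<3. \<Sum>q\<in>insert None (Some ` dirs j). f (j, q))" ..
  then show ?thesis
    using finite_dirs by (simp add: sum.reindex)
qed

lemma wt_total: "t \<in> Mon \<Longrightarrow> wt (\<lambda>_. True) t = sum a I"
  using wt_mons[OF fin, of t n a "\<lambda>_. True"] by (simp add: mons_def)

lemma off_add_nz: "t \<in> Mon \<Longrightarrow> off j t + wt (nz j) t = sum a I"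
  using wt_disj[of t "\<lambda>_. True" "\<lambda>x. \<not> nz j x" "nz j"] wt_total by auto

text \<open>The monomials of order 0 at the third point. On the lines the degree may be shared
  freely between the two coordinates, and \<open>z i\<close> is the share of index 0.\<close>

definition base :: "('i \<Rightarrow> nat) \<Rightarrow> 'i \<times> nat \<Rightarrow>\<^sub>0 nat" where
  "base z = monomial (\<lambda>(i, l). if n i = 1 then (if l = 0 then z i else a i - z i)
     else if l = 2 then a i else 0) (SIGMA i:I. {..n i})"

lemma lookup_base: "lkp (base z) (i, l) = (if i \<in> I \<and> l \<le> n i then
    (if n i = 1 then (if l = 0 then z i else a i - z i) else if l = 2 then a i else 0) else 0)"
  unfolding base_def using fin by (subst lookup_monomial) auto

lemma base_mons:
  assumes "\<And>i. i \<in> B \<Longrightarrow> z i \<le> a i"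
  shows "base z \<in> Mon"
proof -
  have "(\<Sum>l\<le>n i. lkp (base z) (i, l)) = a i" if i: "i \<in> I" for i
  proof (cases "n i = 1")
    case True
    then have "{..n i} = {0, 1}" by auto
    then show ?thesis using i True assms by (simp add: lookup_base B_def)
  next
    case False
    then have "(\<Sum>l\<le>n i. lkp (base z) (i, l)) = (\<Sum>l\<le>n i. if l = 2 then a i else 0)"
      using i by (intro sum.cong) (auto simp: lookup_base)
    also have "\<dots> = a i" using False n[OF i] by auto
    finally show ?thesis .
  qed
  then show ?thesis by (auto simp: mons_def in_keys_iff lookup_base split: if_splits)
qed

lemma off_base:
  assumes z: "\<And>i. i \<in> B \<Longrightarrow> z i \<le> a i"
  shows "off 0 (base z) = degA + (degB - sum z B)" "off 1 (base z) = degA + sum z B" "off 2 (base z) = 0"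
proof -
  have *: "wt S (base z) = (\<Sum>i\<in>A. if S (i, 2) then a i else 0) +
     (\<Sum>i\<in>B. (if S (i, 0) then z i else 0) + (if S (i, 1) then a i - z i else 0))" for S
  proof -
    have "wt S (base z) = (\<Sum>i\<in>A \<union> B. \<Sum>l\<le>n i. if S (i, l) then lkp (base z) (i, l) else 0)"
      unfolding AB(3) by (rule wt_mons[OF fin base_mons[OF z]])
    also have "\<dots> = (\<Sum>i\<in>A. \<Sum>l\<le>n i. if S (i, l) then lkp (base z) (i, l) else 0) +
      (\<Sum>i\<in>B. \<Sum>l\<le>n i. if S (i, l) then lkp (base z) (i, l) else 0)"
      by (rule sum.union_disjoint) (use AB in auto)
    also have "(\<Sum>i\<in>A. \<Sum>l\<le>n i. if S (i, l) then lkp (base z) (i, l) else 0) =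
      (\<Sum>i\<in>A. if S (i, 2) then a i else 0)"
    proof (rule sum.cong[OF refl])
      fix i assume i: "i \<in> A"
      then have "(\<Sum>l\<le>n i. if S (i, l) then lkp (base z) (i, l) else 0) =
        (\<Sum>l\<le>n i. if l = 2 then (if S (i, 2) then a i else 0) else 0)"
        by (intro sum.cong) (auto simp: lookup_base A_def)
      then show "(\<Sum>l\<le>n i. if S (i, l) then lkp (base z) (i, l) else 0) = (if S (i, 2) then a i else 0)"
        using i by (auto simp: A_def)
    qed
    also have "(\<Sum>i\<in>B. \<Sum>l\<le>n i. if S (i, l) then lkp (base z) (i, l) else 0) =
      (\<Sum>i\<in>B. (if S (i, 0) then z i else 0) + (if S (i, 1) then a i - z i else 0))"
    proof (rule sum.cong[OF refl])
      fix i assume i: "i \<in> B"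
      then have "{..n i} = {0, 1}" by (auto simp: B_def)
      then show "(\<Sum>l\<le>n i. if S (i, l) then lkp (base z) (i, l) else 0) =
        (if S (i, 0) then z i else 0) + (if S (i, 1) then a i - z i else 0)"
        using i by (simp add: lookup_base B_def)
    qed
    finally show ?thesis .
  qed
  have "(\<Sum>i\<in>B. a i - z i) = degB - sum z B"
    unfolding degB_def by (rule sum_subtractf_nat) (use z in auto)
  then show "off 0 (base z) = degA + (degB - sum z B)"
    unfolding * by (simp add: nz_def degA_def)
  show "off 1 (base z) = degA + sum z B"
    unfolding * by (simp add: nz_def degA_def)
  have "(\<Sum>i\<in>A. if \<not> nz 2 (i, 2) then a i else 0) = 0"
    by (intro sum.neutral) (auto simp: nz_def A_def)
  moreover have "(\<Sum>i\<in>B. (if \<not> nz 2 (i, 0) then z i else 0) + (if \<not> nz 2 (i, 1) then a i - z i else 0)) = 0"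
    by (intro sum.neutral) (auto simp: nz_def B_def)
  ultimately show "off 2 (base z) = 0" unfolding * by simp
qed

definition pure :: "nat \<Rightarrow> 'i \<times> nat \<Rightarrow>\<^sub>0 nat" where
  "pure j = monomial (\<lambda>(i, l). if l = j then a i else 0) (SIGMA i:I. {..n i})"

lemma lookup_pure: "j < 2 \<Longrightarrow> lkp (pure j) (i, l) = (if i \<in> I \<and> l = j then a i else 0)"
  unfolding pure_def using fin n by (subst lookup_monomial) fastforce+

lemma pure_mons: "j < 2 \<Longrightarrow> pure j \<in> Mon"
  using n by (fastforce simp: mons_def in_keys_iff lookup_pure split: if_splits)

lemma off_pure:
  assumes "j < 2" "j' < 2"
  shows "off j' (pure j) = (if j = j' then 0 else sum a I)"
proof -
  have "off j' (pure j) = (\<Sum>i\<in>I. \<Sum>l\<le>n i. if l = j then (if j = j' then 0 else a i) else 0)"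
    unfolding wt_mons[OF fin pure_mons[OF assms(1)]]
    using assms by (intro sum.cong) (auto simp: nz_def lookup_pure)
  also have "\<dots> = (\<Sum>i\<in>I. if j = j' then 0 else a i)"
    using assms n by (intro sum.cong) (auto, fastforce)
  finally show ?thesis by auto
qed

end

lemma sum_less_3: "(\<Sum>j<3. f j) = f 0 + f 1 + f (2::nat)"
  by (simp add: eval_nat_numeral One_nat_def)

lemma sum_fun_upd:
  fixes f :: "'i \<Rightarrow> nat"
  assumes "finite S" "i \<in> S"
  shows "sum (f(i := y)) S + f i = sum f S + y"
proof -
  have "sum (f(i := y)) (S - {i}) = sum f (S - {i})" by (intro sum.cong) auto
  then show ?thesis using assms by (simp add: sum.remove[of S i])
qed

section \<open>Independence of all functionals in large degree\<close>

context three_points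
begin

lemma base_off_support: "\<not> nz 2 x \<Longrightarrow> lkp (base z) x = 0"
  by (cases x) (auto simp: lookup_base nz_def)

lemma exists_z:
  assumes "s \<le> degB"
  obtains z where "\<And>i. i \<in> B \<Longrightarrow> z i \<le> a i" "sum z B = s"
  using exists_bounded_sum[OF AB(2), of s a] assms unfolding degB_def by blast

text \<open>Evaluated at a monomial of order at least 2 at the first two points, a linear relation
  involves only the coefficients of the third. These are eliminated by monomials close to
  \<open>base z\<close>; then monomials close to \<open>pure j\<close> eliminate the coefficients at
  the other two points.\<close>

lemma special_indep:
  assumes deg: "5 \<le> 2 * degA + degB"
  shows "indep_on Mon Q (dpt pt)"
  unfolding indep_on_def
proof (rule allI, rule impI)
  fix c assume c: "\<forall>t\<in>Mon. (\<Sum>p\<in>Q. c p * dpt pt p t) = 0"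
  define L where "L j t = c (j, None) * dpt pt (j, None) t + (\<Sum>x\<in>dirs j. c (j, Some x) * dpt pt (j, Some x) t)" for j t
  have L: "L 0 t + L 1 t + L 2 t = 0" if "t \<in> Mon" for t
    using c that by (simp add: sum_Q sum_less_3 L_def)
  have L_big: "L j t = 0" if "2 \<le> off j t" for j t
    unfolding L_def dpt_None dpt_Some using that by (auto intro!: sum.neutral)
  have L_0: "L j t = c (j, None) + (\<Sum>x\<in>dirs j. if nz j x then c (j, Some x) * of_nat (lkp t x) else 0)"
    if "off j t = 0" for j t
    unfolding L_def dpt_None dpt_Some using that by (auto intro!: sum.cong)
  have L_1: "L j t = (\<Sum>x\<in>dirs j. if nz j x then 0 else c (j, Some x) * of_nat (lkp t x))"
    if "off j t = 1" for j t
    unfolding L_def dpt_None dpt_Some using that by (auto intro!: sum.cong)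
  have L2: "L 2 t = 0" if "t \<in> Mon" "2 \<le> off 0 t" "2 \<le> off 1 t" for t
    using L[OF that(1)] L_big[OF that(2)] L_big[OF that(3)] by simp
  have out: "c (2, Some x) = 0" if x: "x \<in> dirs 2" "\<not> nz 2 x" for x
  proof -
    obtain i l where il: "x = (i, l)" "i \<in> I" "l \<le> n i" "n i \<noteq> 1" "l \<noteq> 2"
      using x by (auto simp: dirs_def nz_def piv_def split: if_splits)
    have iA: "i \<in> A" using il n[of i] by (auto simp: A_def)
    then have dA: "1 \<le> degA"
      using a[OF il(2)] member_le_sum[of i A a] AB(1) unfolding degA_def by linarith
    \<comment> \<open>Putting \<open>(i, l)\<close> in place of \<open>(i, 2)\<close> costs one
      order at the point \<open>l\<close> if \<open>l \<le> 1\<close>. The split grants the opposite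
      point just the \<open>2 - degA\<close> line variables it may lack, and the rest goes to the
      point that pays. For \<open>l \<ge> 3\<close> nothing is lost.\<close>
    define s where "s = (if l = 1 then degB - (2 - degA) else 2 - degA)"
    have s: "s \<le> degB" using deg dA by (auto simp: s_def)
    obtain z where z: "\<And>i. i \<in> B \<Longrightarrow> z i \<le> a i" "sum z B = s" using exists_z[OF s] by metis
    define t where "t = base z - psingle (i, 2) 1 + psingle (i, l) 1"
    have b2: "lkp (base z) (i, 2) \<noteq> 0" using il n[of i] a[of i] by (auto simp: lookup_base)
    have tM: "t \<in> Mon" unfolding t_def by (rule mons_move[OF base_mons[OF z(1)] b2 il(3)])
    have ofs: "off j t + (if \<not> nz j (i, 2) then 1 else 0) = off j (base z) + (if \<not> nz j (i, l) then 1 else 0)" for j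
      unfolding t_def using wt_move[OF b2, of "\<lambda>x. \<not> nz j x" "(i, l)"] by simp
    have o0: "off 0 t + 1 = degA + (degB - s) + (if l = 0 then 0 else 1)"
      using ofs[of 0] off_base(1)[OF z(1)] z(2) by (simp add: nz_def)
    have o1: "off 1 t + 1 = degA + s + (if l = 1 then 0 else 1)"
      using ofs[of 1] off_base(2)[OF z(1)] z(2) by (simp add: nz_def)
    have o2: "off 2 t = 1"
      using ofs[of 2] off_base(3)[OF z(1)] il by (simp add: nz_def)
    have "2 \<le> off 0 t" "2 \<le> off 1 t"
      using o0 o1 deg dA s unfolding s_def by (auto split: if_splits)
    then have "0 = L 2 t" using L2[OF tM] by simp
    also have "\<dots> = (\<Sum>y\<in>dirs 2. if y = x then c (2, Some x) else 0)"
      unfolding L_1[OF o2]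
    proof (rule sum.cong[OF refl])
      fix y assume y: "y \<in> dirs 2"
      have "nz 2 (i, 2)" using il by (simp add: nz_def)
      then have "lkp t y = (if y = x then 1 else 0)" if "\<not> nz 2 y"
        using that base_off_support[of _ z] x(2) il(1,5) unfolding t_def
        by (subst lookup_move) auto
      then show "(if nz 2 y then 0 else c (2, Some y) * of_nat (lkp t y)) = (if y = x then c (2, Some x) else 0)"
        using x(2) by auto
    qed
    also have "\<dots> = c (2, Some x)" using x(1) finite_dirs by simp
    finally show ?thesis by simp
  qed
  \<comment> \<open>Directions inside the support exist only on lines, one for each after removal of
    the pivot. On the monomials \<open>base z\<close> the contribution of the third point is
    therefore an affine function of \<open>z\<close>.\<close>
  have dir2: "dirs 2 \<inter> {x. nz 2 x} = (\<lambda>i. (i, 0)) ` B"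
    using n by (force simp: dirs_def nz_def piv_def B_def split: if_splits)
  have L2_base: "L 2 (base z) = c (2, None) + (\<Sum>i\<in>B. c (2, Some (i, 0)) * of_nat (z i))"
    if z: "\<And>i. i \<in> B \<Longrightarrow> z i \<le> a i" for z
  proof -
    have "(\<Sum>x\<in>dirs 2. if nz 2 x then c (2, Some x) * of_nat (lkp (base z) x) else 0)
      = (\<Sum>x\<in>dirs 2 \<inter> {x. nz 2 x}. c (2, Some x) * of_nat (lkp (base z) x))"
      using finite_dirs by (simp add: sum.inter_restrict)
    also have "\<dots> = (\<Sum>i\<in>B. c (2, Some (i, 0)) * of_nat (z i))"
      unfolding dir2 by (subst sum.reindex) (auto intro!: inj_onI sum.cong simp: lookup_base B_def)
    finally show ?thesis using L_0[OF off_base(3)[OF z]] by simp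
  qed
  have L2_base_zero: "L 2 (base z) = 0"
    if z: "\<And>i. i \<in> B \<Longrightarrow> z i \<le> a i" and s: "2 \<le> degA + sum z B" "2 \<le> degA + (degB - sum z B)" for z
    using L2[OF base_mons[OF z]] off_base[OF z] s by simp
  have inB: "c (2, Some (i, 0)) = 0" if i: "i \<in> B" for i
  proof -
    \<comment> \<open>The least split that keeps order 2 at the point \<open>e1\<close>. The bound
      is lowered by one at \<open>i\<close>, so that \<open>z i\<close> can be raised afterwards;
      the difference of the two equations isolates the coefficient of \<open>(i, 0)\<close>.\<close>
    define s where "s = 2 - degA"
    define b where "b = a(i := a i - 1)"
    have ai: "1 \<le> a i" using i a by (auto simp: B_def)
    have "sum b B + 1 = degB"
      unfolding degB_def b_def using sum_fun_upd[OF AB(2) i, of a "a i - 1"] ai by simp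
    then have "s \<le> sum b B" using deg by (auto simp: s_def)
    then obtain z where z: "\<forall>i\<in>B. z i \<le> b i" "sum z B = s"
      using exists_bounded_sum[OF AB(2)] by blast
    define z' where "z' = z(i := z i + 1)"
    have za: "z j \<le> a j" "z' j \<le> a j" if "j \<in> B" for j
      using bspec[OF z(1) that] ai by (cases "j = i"; simp add: b_def z'_def)+
    have s': "sum z' B = s + 1"
      using sum_fun_upd[OF AB(2) i, of z "z i + 1"] z(2) by (simp add: z'_def)
    have "s + 1 \<le> degB" using \<open>s \<le> sum b B\<close> \<open>sum b B + 1 = degB\<close> by simp
    have "L 2 (base z) = 0"
      using za z(2) deg \<open>s + 1 \<le> degB\<close> by (intro L2_base_zero) (auto simp: s_def)
    moreover have "L 2 (base z') = 0"
      using za s' deg \<open>s + 1 \<le> degB\<close> by (intro L2_base_zero) (auto simp: s_def)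
    moreover have "(\<Sum>j\<in>B. c (2, Some (j, 0)) * of_nat (z' j)) =
      (\<Sum>j\<in>B. c (2, Some (j, 0)) * of_nat (z j) + (if j = i then c (2, Some (i, 0)) else 0))"
      by (intro sum.cong) (auto simp: z'_def algebra_simps)
    moreover have "L 2 (base z') = L 2 (base z) + c (2, Some (i, 0))"
      if "(\<Sum>j\<in>B. c (2, Some (j, 0)) * of_nat (z' j)) =
        (\<Sum>j\<in>B. c (2, Some (j, 0)) * of_nat (z j)) + c (2, Some (i, 0))"
      using L2_base[of z] L2_base[of z'] za that by simp
    ultimately show ?thesis
      using AB(2) i by (simp add: sum.distrib)
  qed
  have none2: "c (2, None) = 0"
  proof -
    have s: "2 - degA \<le> degB" using deg by auto
    obtain z where z: "\<And>i. i \<in> B \<Longrightarrow> z i \<le> a i" "sum z B = 2 - degA" using exists_z[OF s] by metis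
    have "L 2 (base z) = 0"
      using z deg by (intro L2_base_zero) auto
    then show ?thesis using L2_base[OF z(1)] inB by simp
  qed
  have some2: "c (2, Some x) = 0" if "x \<in> dirs 2" for x
  proof (cases "nz 2 x")
    case True
    with that have "x \<in> dirs 2 \<inter> {x. nz 2 x}" by simp
    then have "x \<in> (\<lambda>i. (i, 0)) ` B" unfolding dir2 .
    then obtain i where "i \<in> B" "x = (i, 0)" by (rule imageE)
    then show ?thesis using inB by simp
  qed (rule out[OF that])
  have L2_zero: "L 2 t = 0" for t
    unfolding L_def using none2 some2 by simp
  have Lj: "L j t = 0" if "t \<in> Mon" "j < 2" "2 \<le> off (1 - j) t" for j t
  proof -
    have "j = 0 \<or> j = 1" using that(2) by linarith
    then show ?thesis
      using L[OF that(1)] L2_zero[of t] L_big[OF that(3)] by auto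
  qed
  have nzj: "nz j (i, l) \<longleftrightarrow> l = j" if "j < 2" for j i l
    using that by (auto simp: nz_def)
  have dirsj: "(i, l) \<in> dirs j \<longleftrightarrow> i \<in> I \<and> l \<le> n i \<and> l \<noteq> j" if "j < 2" for j i l
    using that by (auto simp: dirs_def piv_def)
  have noff: "\<not> nz j x" if "x \<in> dirs j" "j < 2" for j x
    using that dirsj nzj by (cases x) auto
  have ne: "(j = 1 - j) = False" for j :: nat by presburger
  \<comment> \<open>\<open>pure j\<close> has the total degree as its order at the other coordinate
    point, and one variable is replaced below: 3 leaves the required order 2.\<close>
  have d3: "3 \<le> sum a I" using deg deg_sum by auto
  have nonej: "c (j, None) = 0" if j: "j < 2" for j
  proof -
    have "0 = L j (pure j)"
      using Lj[OF pure_mons[OF j] j] off_pure[OF j, of "1 - j"] d3 j by (simp add: ne)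
    also have "\<dots> = c (j, None)"
      using L_0[of j "pure j"] off_pure[OF j j] noff[OF _ j] by simp
    finally show ?thesis by simp
  qed
  have somej: "c (j, Some x) = 0" if j: "j < 2" and x: "x \<in> dirs j" for j x
  proof -
    obtain i l where il: "x = (i, l)" "i \<in> I" "l \<le> n i" "l \<noteq> j"
      using x dirsj[OF j] by (cases x) auto
    define t where "t = pure j - psingle (i, j) 1 + psingle (i, l) 1"
    have b2: "lkp (pure j) (i, j) \<noteq> 0" using il a[of i] j by (auto simp: lookup_pure)
    have tM: "t \<in> Mon" unfolding t_def by (rule mons_move[OF pure_mons[OF j] b2 il(3)])
    have ofs: "off j' t + (if \<not> nz j' (i, j) then 1 else 0) = off j' (pure j) + (if \<not> nz j' (i, l) then 1 else 0)" for j'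
      unfolding t_def using wt_move[OF b2, of "\<lambda>x. \<not> nz j' x" "(i, l)"] by simp
    have o: "off j t = 1"
      using ofs[of j] off_pure[OF j j] nzj[OF j] il(4) by simp
    have "1 - j < 2" "j \<noteq> 1 - j" using j ne by auto
    then have "2 \<le> off (1 - j) t"
      using ofs[of "1 - j"] off_pure[OF j, of "1 - j"] d3 nzj[of "1 - j"] by (auto split: if_splits)
    then have "0 = L j t" using Lj[OF tM j] by simp
    also have "\<dots> = (\<Sum>y\<in>dirs j. if y = x then c (j, Some x) else 0)"
      unfolding L_1[OF o]
    proof (rule sum.cong[OF refl])
      fix y assume y: "y \<in> dirs j"
      then have "lkp t y = (if y = x then 1 else 0)"
        unfolding t_def using il j dirsj[OF j] by (cases y) (auto simp: lookup_move lookup_pure)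
      then show "(if nz j y then 0 else c (j, Some y) * of_nat (lkp t y)) = (if y = x then c (j, Some x) else 0)"
        using noff[OF y j] by auto
    qed
    also have "\<dots> = c (j, Some x)" using x finite_dirs by simp
    finally show ?thesis by simp
  qed
  show "\<forall>p\<in>Q. c p = 0"
  proof
    fix p assume "p \<in> Q"
    then obtain j q where p: "p = (j, q)" "j < 3" "q = None \<or> (\<exists>x\<in>dirs j. q = Some x)"
      by (auto simp: Q_def)
    then have "j < 2 \<or> j = 2" by auto
    then show "c p = 0" using p nonej somej none2 some2 by auto
  qed
qed

end

section \<open>Common zeros of the functionals in small degree\<close>

context three_points
begin

text \<open>Used in every small case with a functional that sees only one of the monomials of
  \<open>F\<close> not yet excluded.\<close>

lemma kernel_collapse:
  assumes F: "F \<in> forms I n a" "clf (dpt pt p) F = 0" and t: "t \<in> Mon" "dpt pt p t \<noteq> 0"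
    and other: "\<And>t'. t' \<in> Mon \<Longrightarrow> dpt pt p t' \<noteq> 0 \<Longrightarrow> lkp F t' \<noteq> 0 \<Longrightarrow> t' = t"
  shows "lkp F t = 0"
proof -
  have "0 = (\<Sum>t'\<in>Mon. lkp F t' * dpt pt p t')"
    using F clf_form[OF fin F(1)] by simp
  also have "\<dots> = (\<Sum>t'\<in>{t}. lkp F t' * dpt pt p t')"
    using finite_mons[OF fin] t(1) other by (intro sum.mono_neutral_right) auto
  finally show ?thesis using t(2) by simp
qed

lemma Q_None: "j < 3 \<Longrightarrow> (j, None) \<in> Q"
  by (simp add: Q_def)

lemma Q_Some: "j < 3 \<Longrightarrow> i \<in> I \<Longrightarrow> l \<le> n i \<Longrightarrow> l \<noteq> piv j i \<Longrightarrow> (j, Some (i, l)) \<in> Q"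
  by (auto simp: Q_def dirs_def)

lemma mons_support: "t \<in> Mon \<Longrightarrow> lkp t (i, l) \<noteq> 0 \<Longrightarrow> i \<in> I \<and> l \<le> n i"
  using mons_diff_single[of t I n a i l] by auto

text \<open>When each factor has one support coordinate, a monomial of order 0 is a product of pure
  powers and one of order 1 is determined by its single variable off the support, so a single
  functional isolates it. At the third point this requires that there be no lines.\<close>

lemma near_vanish:
  assumes F: "F \<in> forms I n a" and ker: "\<And>p. p \<in> Q \<Longrightarrow> clf (dpt pt p) F = 0"
    and j: "j < 3" "j \<noteq> 2 \<or> B = {}" and t: "t \<in> Mon" "off j t \<le> 1"
  shows "lkp F t = 0"
proof -
  have nzj: "nz j (i, l) \<longleftrightarrow> l = j" "piv j i = j" if "i \<in> I" for i l
    using that j(2) by (auto simp: nz_def piv_def B_def)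
  have jn: "j \<le> n i" if "i \<in> I" for i using piv_le[OF j(1) that] nzj(2)[OF that] by simp
  consider "off j t = 0" | "off j t = 1" using t(2) by linarith
  then show ?thesis
  proof cases
    case 1
    show ?thesis
    proof (rule kernel_collapse[OF F ker[OF Q_None[OF j(1)]] t(1)])
      fix t' assume t': "t' \<in> Mon" "dpt pt (j, None) t' \<noteq> 0"
      then have "off j t' = 0" by (simp add: dpt_None split: if_splits)
      then have "lkp t' (i, l) = 0" "lkp t (i, l) = 0" if "i \<in> I" "l \<noteq> j" for i l
        using wt_ge[of "\<lambda>x. \<not> nz j x" "(i, l)"] nzj that 1 by (metis le_zero_eq)+
      then show "t' = t" using jn by (intro mons_eqI[OF t'(1) t(1), of "\<lambda>_. j"]) auto
    qed (simp add: dpt_None 1)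
  next
    case 2
    then obtain x where x: "x \<in> pkeys t" "\<not> nz j x" using wt_pos[of "\<lambda>x. \<not> nz j x" t] by auto
    obtain i l where il: "x = (i, l)" by (cases x)
    have il': "i \<in> I" "l \<le> n i" "l \<noteq> j"
      using x mons_support[OF t(1), of i l] nzj by (auto simp: il in_keys_iff)
    have one: "lkp u x = 1" "\<And>y. \<not> nz j y \<Longrightarrow> y \<noteq> x \<Longrightarrow> lkp u y = 0"
      if u: "off j u = 1" "lkp u x \<noteq> 0" for u
    proof -
      show "lkp u x = 1" using wt_ge[of "\<lambda>x. \<not> nz j x" x u] x(2) u by simp
      show "lkp u y = 0" if "\<not> nz j y" "y \<noteq> x" for y
        using wt_ge2[of "\<lambda>x. \<not> nz j x" x y u] x(2) u that by simp
    qed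
    show ?thesis
    proof (rule kernel_collapse[OF F ker[OF Q_Some[OF j(1) il'(1,2)]] t(1)])
      fix t' assume t': "t' \<in> Mon" "dpt pt (j, Some (i, l)) t' \<noteq> 0"
      then have "off j t' = 1" "lkp t' x \<noteq> 0"
        using x(2) by (auto simp: dpt_Some il split: if_splits)
      note o' = one[OF this] and o = one[OF 2]
      have "lkp t x \<noteq> 0" using x(1) by (simp add: in_keys_iff)
      have "lkp t' (i', l') = lkp t (i', l')" if "i' \<in> I" "l' \<noteq> j" for i' l'
        using o' o[OF \<open>lkp t x \<noteq> 0\<close>] nzj that by (cases "(i', l') = x") auto
      then show "t' = t" using jn by (intro mons_eqI[OF t'(1) t(1), of "\<lambda>_. j"]) auto
    qed (use il' nzj x 2 in \<open>auto simp: dpt_Some il in_keys_iff\<close>)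
  qed
qed

text \<open>In total degree at most 2, one variable in the support of a point already brings the
  order there down to at most 1. Factor \<open>i\<close> offers such a variable; if it has index 2
  and lines are present, a variable of a line, with index 0 or 1, is used instead.\<close>

lemma kernel_degree_2:
  assumes F: "F \<in> forms I n a" and ker: "\<And>p. p \<in> Q \<Longrightarrow> clf (dpt pt p) F = 0"
    and d: "sum a I \<le> 2" and i: "i \<in> I" "n i \<le> 2" and t: "t \<in> Mon"
  shows "lkp F t = 0"
proof -
  have *: "lkp F t = 0" if "lkp t (i', l) \<noteq> 0" "nz l (i', l)" "l < 3" "l \<noteq> 2 \<or> B = {}" for i' l
  proof (rule near_vanish[OF F ker that(3,4) t])
    show "off l t \<le> 1"
      using off_add_nz[OF t, of l] wt_ge[of "nz l" "(i', l)" t] that d by linarith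
  qed
  have ex: "\<exists>l\<le>n i'. lkp t (i', l) \<noteq> 0" if "i' \<in> I" for i'
  proof (rule ccontr)
    assume "\<not> ?thesis"
    then have "(\<Sum>l\<le>n i'. lkp t (i', l)) = 0" by auto
    then show False using t that a[OF that] by (auto simp: mons_def)
  qed
  obtain l where l: "l \<le> n i" "lkp t (i, l) \<noteq> 0" using ex[OF i(1)] by blast
  show ?thesis
  proof (cases "l = 2")
    case False
    then have "l < 2" using l i by linarith
    then show ?thesis using * l(2) by (auto simp: nz_def)
  next
    case True
    then have ni: "n i = 2" using l i by simp
    show ?thesis
    proof (cases "B = {}")
      case True
      then show ?thesis using * l(2) \<open>l = 2\<close> ni by (auto simp: nz_def)
    next
      case False
      then obtain b where b: "b \<in> I" "n b = 1" by (auto simp: B_def)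
      obtain l' where l': "l' \<le> n b" "lkp t (b, l') \<noteq> 0" using ex[OF b(1)] by blast
      then have "l' < 2" using b by linarith
      then show ?thesis using * l'(2) by (auto simp: nz_def)
    qed
  qed
qed

lemma kernel_degree_1:
  assumes F: "F \<in> forms I n a" and ker: "\<And>p. p \<in> Q \<Longrightarrow> clf (dpt pt p) F = 0"
    and d: "sum a I \<le> 1" and t: "t \<in> Mon"
  shows "lkp F t = 0"
  using near_vanish[OF F ker, of 0 t] off_add_nz[OF t, of 0] d t by simp

lemma counts:
  assumes t: "t \<in> Mon"
  shows "off 0 t = wt (\<lambda>x. snd x = 1) t + wt (\<lambda>x. 2 \<le> snd x) t"
    "off 1 t = wt (\<lambda>x. snd x = 0) t + wt (\<lambda>x. 2 \<le> snd x) t"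
    "wt (\<lambda>x. snd x = 0) t + wt (\<lambda>x. snd x = 1) t + wt (\<lambda>x. 2 \<le> snd x) t = sum a I"
    "wt (\<lambda>x. 2 \<le> snd x) t = (\<Sum>i\<in>A. \<Sum>l\<in>{2..n i}. lkp t (i, l))"
proof -
  have nz01: "nz 0 x \<longleftrightarrow> snd x = 0" "nz 1 x \<longleftrightarrow> snd x = 1" for x
    by (cases x; simp add: nz_def)+
  show "off 0 t = wt (\<lambda>x. snd x = 1) t + wt (\<lambda>x. 2 \<le> snd x) t"
    unfolding nz01 by (rule wt_disj) auto
  show "off 1 t = wt (\<lambda>x. snd x = 0) t + wt (\<lambda>x. 2 \<le> snd x) t"
    unfolding nz01 by (rule wt_disj) auto
  then show "wt (\<lambda>x. snd x = 0) t + wt (\<lambda>x. snd x = 1) t + wt (\<lambda>x. 2 \<le> snd x) t = sum a I"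
    using off_add_nz[OF t, of 1] unfolding nz01 by simp
  have "wt (\<lambda>x. 2 \<le> snd x) t = (\<Sum>i\<in>I. \<Sum>l\<in>{2..n i}. lkp t (i, l))"
    unfolding wt_mons[OF fin t] by (intro sum.cong sum.mono_neutral_cong_right) auto
  also have "\<dots> = (\<Sum>i\<in>A. \<Sum>l\<in>{2..n i}. lkp t (i, l))"
    using fin by (intro sum.mono_neutral_right) (auto simp: A_def)
  finally show "wt (\<lambda>x. 2 \<le> snd x) t = (\<Sum>i\<in>A. \<Sum>l\<in>{2..n i}. lkp t (i, l))" .
qed

lemma kernel_far:
  assumes F: "F \<in> forms I n a" and ker: "\<And>p. p \<in> Q \<Longrightarrow> clf (dpt pt p) F = 0"
    and t: "t \<in> Mon" "lkp F t \<noteq> 0"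
  shows "2 \<le> off 0 t" "2 \<le> off 1 t"
  using near_vanish[OF F ker, of 0 t] near_vanish[OF F ker, of 1 t] t
  by (auto simp: not_less_eq_eq intro: leI)

lemma cnt_B:
  assumes t: "t \<in> Mon" and "A = {}"
  shows "wt (\<lambda>x. snd x = 0) t = (\<Sum>i\<in>B. lkp t (i, 0))" "off 2 t = 0"
proof -
  have IB: "I = B" using AB(3) assms(2) by simp
  have n1: "n i = 1" if "i \<in> I" for i using that IB by (auto simp: B_def)
  have "(\<Sum>l\<le>n i. if snd (i, l) = 0 then lkp t (i, l) else 0) = lkp t (i, 0)" for i
    by simp
  then show "wt (\<lambda>x. snd x = 0) t = (\<Sum>i\<in>B. lkp t (i, 0))"
    unfolding wt_mons[OF fin t] using IB by simp
  show "off 2 t = 0"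
    unfolding wt_mons[OF fin t] using n1 by (intro sum.neutral ballI) (auto simp: nz_def)
qed

lemma eqI_B:
  assumes t: "t \<in> Mon" "t' \<in> Mon" and "A = {}" and eq: "\<And>i. i \<in> B \<Longrightarrow> lkp t (i, 0) = lkp t' (i, 0)"
  shows "t = t'"
proof (rule mons_eqI[OF t, of "\<lambda>_. 1"])
  have IB: "I = B" using AB(3) assms(3) by simp
  then have n1: "n i = 1" if "i \<in> I" for i using that by (auto simp: B_def)
  then show "1 \<le> n i" if "i \<in> I" for i using that by simp
  show "lkp t (i, l) = lkp t' (i, l)" if "i \<in> I" "l \<le> n i" "l \<noteq> 1" for i l
    using that n1 eq IB by (cases "l = 0") auto
qed

text \<open>On lines alone the orders at \<open>e0\<close> and \<open>e1\<close> add up to the total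
  degree 3, so they cannot both be at least 2.\<close>

lemma kernel_lines_3:
  assumes F: "F \<in> forms I n a" and ker: "\<And>p. p \<in> Q \<Longrightarrow> clf (dpt pt p) F = 0"
    and "A = {}" "sum a I = 3" and t: "t \<in> Mon"
  shows "lkp F t = 0"
proof (rule ccontr)
  assume "lkp F t \<noteq> 0"
  from kernel_far[OF F ker t this] show False
    using counts[OF t] assms(3,4) by simp
qed

text \<open>The surviving monomials contain exactly two variables of index 0. One factor leaves a
  single survivor, seen by the value at the third point. Degrees 1 and 3 leave two: the derivative
  along \<open>(b, 0)\<close> removes the one that contains it, and the value removes the
  other.\<close>

lemma kernel_lines_4:
  assumes F: "F \<in> forms I n a" and ker: "\<And>p. p \<in> Q \<Longrightarrow> clf (dpt pt p) F = 0"
    and A: "A = {}" and d: "sum a I = 4" and k: "(\<exists>b. I = {b}) \<or> (\<exists>b b'. I = {b, b'} \<and> b \<noteq> b' \<and> a b = 1)"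
    and t: "t \<in> Mon"
  shows "lkp F t = 0"
proof -
  have IB: "I = B" using AB(3) A by simp
  have n1: "n i = 1" if "i \<in> I" for i using that IB by (auto simp: B_def)
  have two: "(\<Sum>i\<in>I. lkp u (i, 0)) = 2" if u: "u \<in> Mon" "lkp F u \<noteq> 0" for u
    using kernel_far[OF F ker u] counts[OF u(1)] cnt_B(1)[OF u(1) A] d A IB by simp
  show ?thesis
    using k
  proof (elim disjE exE conjE)
    fix b assume Ib: "I = {b}"
    show ?thesis
    proof (rule ccontr)
      assume nz: "lkp F t \<noteq> 0"
      have "lkp F t = 0"
      proof (rule kernel_collapse[OF F ker[OF Q_None[of 2]] t])
        fix t' assume t': "t' \<in> Mon" "lkp F t' \<noteq> 0"
        show "t' = t"
          using two[OF t'] two[OF t nz] Ib IB by (intro eqI_B[OF t'(1) t A]) auto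
      qed (use cnt_B(2)[OF t A] in \<open>auto simp: dpt_None\<close>)
      then show False using nz by simp
    qed
  next
    fix b b' assume Ib: "I = {b, b'}" "b \<noteq> b'" "a b = 1"
    have le1: "lkp u (b, 0) \<le> 1" if "u \<in> Mon" for u
    proof -
      have "(\<Sum>l\<le>n b. lkp u (b, l)) = 1" using that Ib by (auto simp: mons_def)
      moreover have "lkp u (b, 0) \<le> (\<Sum>l\<le>n b. lkp u (b, l))" by (intro member_le_sum) auto
      ultimately show ?thesis by simp
    qed
    have s: "lkp u (b, 0) + lkp u (b', 0) = 2" if "u \<in> Mon" "lkp F u \<noteq> 0" for u
      using two[OF that] Ib by simp
    have eq: "u = u'" if "u \<in> Mon" "lkp F u \<noteq> 0" "u' \<in> Mon" "lkp F u' \<noteq> 0" "lkp u (b, 0) = lkp u' (b, 0)" for u u'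
      using s[OF that(1,2)] s[OF that(3,4)] that(5) Ib IB by (intro eqI_B[OF that(1,3) A]) auto
    have first: "lkp F u = 0" if u: "u \<in> Mon" "lkp u (b, 0) = 1" for u
    proof (rule ccontr)
      assume nz: "lkp F u \<noteq> 0"
      have "lkp F u = 0"
      proof (rule kernel_collapse[OF F ker[OF Q_Some[of 2 b 0]] u(1)])
        fix t' assume t': "t' \<in> Mon" "dpt pt (2, Some (b, 0)) t' \<noteq> 0" "lkp F t' \<noteq> 0"
        then have "lkp t' (b, 0) \<noteq> 0" by (auto simp: dpt_Some split: if_splits)
        then have "lkp t' (b, 0) = 1" using le1[OF t'(1)] by simp
        then show "t' = u" using eq[OF t'(1,3) u(1) nz] u(2) by simp
      qed (use cnt_B(2)[OF u(1) A] Ib n1 u in \<open>auto simp: dpt_Some piv_def nz_def\<close>)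
      then show False using nz by simp
    qed
    show ?thesis
    proof (rule ccontr)
      assume nz: "lkp F t \<noteq> 0"
      have z: "lkp u (b, 0) = 0" if "u \<in> Mon" "lkp F u \<noteq> 0" for u
        using first[OF that(1)] le1[OF that(1)] that(2) by linarith
      have "lkp F t = 0"
      proof (rule kernel_collapse[OF F ker[OF Q_None[of 2]] t])
        fix t' assume t': "t' \<in> Mon" "lkp F t' \<noteq> 0"
        show "t' = t" using eq[OF t' t nz] z[OF t'] z[OF t nz] by simp
      qed (use cnt_B(2)[OF t A] in \<open>auto simp: dpt_None\<close>)
      then show False using nz by simp
    qed
  qed
qed

text \<open>Survivors with index 2 in factor \<open>i0\<close> are told apart by the derivatives
  along the lines at the third point. Those with larger index \<open>l\<close> have order 1 there
  and are seen only by the derivative along \<open>(i0, l)\<close>, which for two lines mixes the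
  two ways of distributing the indices 0 and 1. Hypothesis \<open>k\<close> excludes this
  combination, which is the exception of two lines and a factor of dimension at least 3.\<close>

lemma kernel_mixed_3:
  assumes F: "F \<in> forms I n a" and ker: "\<And>p. p \<in> Q \<Longrightarrow> clf (dpt pt p) F = 0"
    and A: "A = {i0}" "a i0 = 1" and dB: "degB = 2" and k: "(\<exists>b. B = {b}) \<or> n i0 = 2"
    and t: "t \<in> Mon"
  shows "lkp F t = 0"
proof (rule ccontr)
  assume nz: "lkp F t \<noteq> 0"
  have i0: "i0 \<in> I" "2 \<le> n i0" using A by (auto simp: A_def)
  have d: "sum a I = 3" using deg_sum dB A by (simp add: degA_def)
  have n1: "n i = 1" if "i \<in> B" for i using that by (simp add: B_def)
  have IB: "i \<in> I \<Longrightarrow> i \<noteq> i0 \<Longrightarrow> i \<in> B" for i using AB(3) A by auto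
  have i0B: "i0 \<notin> B" using i0(2) by (simp add: B_def)
  \<comment> \<open>A monomial that is far from both coordinate points is a variable \<open>(i0, l)\<close> with \<open>l \<ge> 2\<close>
    times one variable of index 0 and one of index 1 from the projective lines.\<close>
  have shape: "(\<Sum>l\<in>{2..n i0}. lkp u (i0, l)) = 1" "lkp u (i0, 0) = 0" "lkp u (i0, 1) = 0"
    "(\<Sum>i\<in>B. lkp u (i, 0)) = 1" if u: "u \<in> Mon" "lkp F u \<noteq> 0" for u
  proof -
    have s: "(\<Sum>l\<le>n i0. lkp u (i0, l)) = 1" using u(1) i0 A by (auto simp: mons_def)
    have "{..n i0} = {0, 1} \<union> {2..n i0}" using i0(2) by auto
    then have s': "(\<Sum>l\<le>n i0. lkp u (i0, l)) = lkp u (i0, 0) + lkp u (i0, 1) + (\<Sum>l\<in>{2..n i0}. lkp u (i0, l))"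
      by (simp only:) (subst sum.union_disjoint; auto)
    have o: "wt (\<lambda>x. 2 \<le> snd x) u = (\<Sum>l\<in>{2..n i0}. lkp u (i0, l))"
      using counts(4)[OF u(1)] A by simp
    note c = counts[OF u(1)] kernel_far[OF F ker u]
    show 1: "(\<Sum>l\<in>{2..n i0}. lkp u (i0, l)) = 1"
      using s s' c(1-3,5,6) d o by linarith
    then show 2: "lkp u (i0, 0) = 0" "lkp u (i0, 1) = 0" using s s' by auto
    have "wt (\<lambda>x. snd x = 0) u = (\<Sum>i\<in>I. lkp u (i, 0))"
      unfolding wt_mons[OF fin u(1)] by simp
    also have "\<dots> = (\<Sum>i\<in>B. lkp u (i, 0))"
    proof (rule sum.mono_neutral_right[OF fin])
      show "B \<subseteq> I" using AB(3) by blast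
      show "\<forall>i\<in>I - B. lkp u (i, 0) = 0" using IB 2 by blast
    qed
    finally have "(\<Sum>i\<in>B. lkp u (i, 0)) = wt (\<lambda>x. snd x = 0) u" ..
    moreover have "wt (\<lambda>x. snd x = 0) u = 1"
      using 1 c(1-3,5,6) d o by linarith
    ultimately show "(\<Sum>i\<in>B. lkp u (i, 0)) = 1" by simp
  qed
  have eq: "u = u'" if u: "u \<in> Mon" "lkp F u \<noteq> 0" and u': "u' \<in> Mon" "lkp F u' \<noteq> 0"
    and l: "2 \<le> l" "l \<le> n i0" "lkp u (i0, l) \<noteq> 0" "lkp u' (i0, l) \<noteq> 0"
    and b: "b \<in> B" "lkp u (b, 0) \<noteq> 0" "lkp u' (b, 0) \<noteq> 0" for u u' l b
  proof (rule mons_eqI[OF u(1) u'(1), of "\<lambda>i. if i = i0 then l else 1"])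
    have single: "f y = (0::nat)" if "finite S" "sum f S = 1" "x \<in> S" "f x \<noteq> 0" "y \<in> S" "y \<noteq> x" for f :: "'c \<Rightarrow> nat" and S x y
    proof -
      have "sum f {x, y} \<le> sum f S" using that by (intro sum_mono2) auto
      then show ?thesis using that by simp
    qed
    have single1: "f x = (1::nat)" if "finite S" "sum f S = 1" "x \<in> S" "f x \<noteq> 0" for f :: "'c \<Rightarrow> nat" and S x
      using member_le_sum[of x S f] that by simp
    show "(if i = i0 then l else 1) \<le> n i" if "i \<in> I" for i using l n[OF that] by simp
    show "lkp u (i, l') = lkp u' (i, l')" if i: "i \<in> I" "l' \<le> n i" "l' \<noteq> (if i = i0 then l else 1)" for i l'
    proof (cases "i = i0")
      case True
      have "l' = 0 \<or> l' = 1 \<or> l' \<in> {2..n i0}" using i True by auto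
      moreover have "lkp v (i0, l') = 0" if "v \<in> Mon" "lkp F v \<noteq> 0" "lkp v (i0, l) \<noteq> 0" "l' \<in> {2..n i0}" for v
        using single[of "{2..n i0}" "\<lambda>l. lkp v (i0, l)" l l'] shape(1)[OF that(1,2)] l that i True by auto
      ultimately show ?thesis using True shape(2,3)[OF u] shape(2,3)[OF u'] u u' l by auto
    next
      case False
      then have iB: "i \<in> B" and "l' = 0" using i IB n1 by auto
      have v: "lkp v (i, 0) = (if i = b then 1 else 0)" if "v \<in> Mon" "lkp F v \<noteq> 0" "lkp v (b, 0) \<noteq> 0" for v
        using single[OF AB(2) shape(4)[OF that(1,2)] b(1) that(3) iB]
          single1[OF AB(2) shape(4)[OF that(1,2)] b(1) that(3)] by auto
      show ?thesis using v[OF u b(2)] v[OF u' b(3)] \<open>l' = 0\<close> by simp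
    qed
  qed
  have obt: "\<exists>l. 2 \<le> l \<and> l \<le> n i0 \<and> lkp u (i0, l) \<noteq> 0" "\<exists>b\<in>B. lkp u (b, 0) \<noteq> 0"
    if u: "u \<in> Mon" "lkp F u \<noteq> 0" for u
  proof -
    show "\<exists>l. 2 \<le> l \<and> l \<le> n i0 \<and> lkp u (i0, l) \<noteq> 0"
      using shape(1)[OF u] by (metis atLeastAtMost_iff sum.neutral zero_neq_one)
    show "\<exists>b\<in>B. lkp u (b, 0) \<noteq> 0"
      using shape(4)[OF u] by (metis sum.neutral zero_neq_one)
  qed
  obtain l where l: "2 \<le> l" "l \<le> n i0" "lkp t (i0, l) \<noteq> 0" using obt(1)[OF t nz] by blast
  obtain b where b: "b \<in> B" "lkp t (b, 0) \<noteq> 0" using obt(2)[OF t nz] by blast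
  have bI: "b \<in> I" using b by (simp add: B_def)
  have off2: "off 2 u = (\<Sum>l\<in>{2..n i0} - {2}. lkp u (i0, l))" if u: "u \<in> Mon" "lkp F u \<noteq> 0" for u
  proof -
    have "off 2 u = (\<Sum>i\<in>I. \<Sum>l\<le>n i. if \<not> nz 2 (i, l) then lkp u (i, l) else 0)"
      by (rule wt_mons[OF fin u(1)])
    also have "\<dots> = (\<Sum>i\<in>{i0}. \<Sum>l\<le>n i. if \<not> nz 2 (i, l) then lkp u (i, l) else 0)"
    proof (rule sum.mono_neutral_right)
      show "\<forall>i\<in>I - {i0}. (\<Sum>l\<le>n i. if \<not> nz 2 (i, l) then lkp u (i, l) else 0) = 0"
        using IB n1 by (auto simp: nz_def)
    qed (use fin i0 in auto)
    also have "\<dots> = (\<Sum>l\<le>n i0. if \<not> nz 2 (i0, l) then lkp u (i0, l) else 0)" by simp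
    also have "\<dots> = (\<Sum>l\<in>{2..n i0} - {2}. lkp u (i0, l))"
    proof (rule sum.mono_neutral_cong_right)
      show "\<forall>l\<in>{..n i0} - ({2..n i0} - {2}). (if \<not> nz 2 (i0, l) then lkp u (i0, l) else 0) = 0"
      proof
        fix l assume "l \<in> {..n i0} - ({2..n i0} - {2})"
        then consider "l = 0" | "l = 1" | "l = 2" by force
        then show "(if \<not> nz 2 (i0, l) then lkp u (i0, l) else 0) = 0"
          using i0(2) shape(2,3)[OF u] by cases (auto simp: nz_def)
      qed
    qed (use i0(2) in \<open>auto simp: nz_def\<close>)
    finally show ?thesis .
  qed
  have split1: "(\<Sum>l\<in>{2..n i0}. lkp u (i0, l)) = lkp u (i0, 2) + (\<Sum>l\<in>{2..n i0} - {2}. lkp u (i0, l))" for u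
    using i0(2) by (subst sum.remove[of _ 2]) auto
  have "lkp F t = 0"
  proof (cases "l = 2")
    \<comment> \<open>Among the survivors, order 0 at the third point forces index 2 in factor
      \<open>i0\<close>, and exponent 1 at \<open>(b, 0)\<close> then fixes the rest.\<close>
    case True
    show ?thesis
    proof (rule kernel_collapse[OF F ker[OF Q_Some[of 2 b 0]] t])
      have "lkp t (i0, 2) \<noteq> 0" using l(3) True by simp
      then have "off 2 t = 0"
        using off2[OF t nz] split1[of t] shape(1)[OF t nz] by linarith
      moreover have nzb: "nz 2 (b, 0)" using n1[OF b(1)] by (simp add: nz_def)
      ultimately show "dpt pt (2, Some (b, 0)) t \<noteq> 0"
        using b(2) by (simp add: dpt_Some)
      fix t' assume t': "t' \<in> Mon" "dpt pt (2, Some (b, 0)) t' \<noteq> 0" "lkp F t' \<noteq> 0"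
      then have "lkp t' (b, 0) \<noteq> 0" "off 2 t' = 0"
        using nzb by (auto simp: dpt_Some split: if_splits)
      moreover from this have "lkp t' (i0, 2) \<noteq> 0"
        using off2[OF t'(1,3)] split1[of t'] shape(1)[OF t'(1,3)] by simp
      ultimately show "t' = t" using eq[OF t'(1,3) t nz, of 2 b] l True b by simp
    qed (use bI n1[OF b(1)] in \<open>auto simp: piv_def\<close>)
  next
    case False
    then have "n i0 \<noteq> 2" using l by auto
    then obtain b0 where "B = {b0}" using k by blast
    then have Bb: "B = {b}" using b(1) by simp
    show ?thesis
    proof (rule kernel_collapse[OF F ker[OF Q_Some[of 2 i0 l]] t])
      have "lkp t (i0, l) \<le> (\<Sum>l\<in>{2..n i0} - {2}. lkp t (i0, l))"
        using l False by (intro member_le_sum) auto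
      then have "off 2 t = 1"
        using off2[OF t nz] split1[of t] shape(1)[OF t nz] l(3) by linarith
      moreover have "\<not> nz 2 (i0, l)" using False i0(2) by (simp add: nz_def)
      ultimately show "dpt pt (2, Some (i0, l)) t \<noteq> 0"
        using l(3) by (simp add: dpt_Some)
      fix t' assume t': "t' \<in> Mon" "dpt pt (2, Some (i0, l)) t' \<noteq> 0" "lkp F t' \<noteq> 0"
      then have "lkp t' (i0, l) \<noteq> 0" by (auto simp: dpt_Some split: if_splits)
      moreover have "lkp t' (b, 0) \<noteq> 0" using obt(2)[OF t'(1,3)] Bb by simp
      ultimately show "t' = t" using eq[OF t'(1,3) t nz, of l b] l b by simp
    qed (use i0 l False in \<open>auto simp: piv_def\<close>)
  qed
  then show False using nz by simp
qed

lemma general_hilbert_of_cases: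
  assumes "5 \<le> 2 * degA + degB \<or> (\<forall>F\<in>forms I n a. (\<forall>p\<in>Q. clf (dpt pt p) F = 0) \<longrightarrow> (\<forall>t\<in>Mon. lkp F t = 0))"
  shows "for_general_points 3 I n (\<lambda>P. hilbert_double_points I n a 3 P =
    int (min (3 * (1 + sum n I)) (\<Prod>i\<in>I. (n i + a i) choose a i)))"
proof -
  have "\<exists>Q'\<subseteq>Q. indep_on Mon Q' (dpt pt) \<and> min (3 * (1 + sum n I)) (card Mon) \<le> card Q'"
    using assms
  proof
    assume "5 \<le> 2 * degA + degB"
    then have "indep_on Mon Q (dpt pt)" by (rule special_indep)
    moreover have "min (3 * (1 + sum n I)) (card Mon) \<le> card Q"
      unfolding card_Q by (rule min.cobounded1)
    ultimately show ?thesis by blast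
  next
    assume k: "\<forall>F\<in>forms I n a. (\<forall>p\<in>Q. clf (dpt pt p) F = 0) \<longrightarrow> (\<forall>t\<in>Mon. lkp F t = 0)"
    have "F = 0" if F: "F \<in> forms I n a" "\<forall>p\<in>Q. clf (dpt pt p) F = 0" for F
    proof (rule poly_mapping_eqI)
      fix t show "lkp F t = lkp 0 t"
      proof (cases "t \<in> Mon")
        case True
        then show ?thesis using k F by simp
      next
        case False
        then have "t \<notin> pkeys F" using F(1) by (auto simp: forms_eq)
        then show ?thesis by (simp add: in_keys_iff)
      qed
    qed
    from trivial_kernel_indep_subset[OF fin finite_Q this]
    obtain Q' where "Q' \<subseteq> Q" "indep_on Mon Q' (dpt pt)" "card Mon \<le> card Q'" by blast
    then show ?thesis by (intro exI[of _ Q']) simp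
  qed
  then obtain Q' where Q': "Q' \<subseteq> Q" "indep_on Mon Q' (dpt pt)"
    "min (3 * (1 + sum n I)) (card Mon) \<le> card Q'" by blast
  have "finite Q'" using Q'(1) finite_Q finite_subset by blast
  moreover have "fst p < 3" if "p \<in> Q'" for p using that Q'(1) by (auto simp: Q_def)
  ultimately show ?thesis
    using general_hilbert_eq[OF fin, of Q' 3 pt n a] pt_nonzero Q'(2,3) card_mons[OF fin, of n a] by simp
qed

end

subsection \<open>Sections singular at three points\<close>

lemma span_mult:
  assumes "f \<in> mpoly.span X" "g \<in> mpoly.span Y"
  shows "f * g \<in> mpoly.span {f * g | f g. f \<in> X \<and> g \<in> Y}"
proof -
  let ?S = "mpoly.span {f * g | f g. f \<in> X \<and> g \<in> Y}"
  have 1: "x * g \<in> ?S" if "x \<in> X" for x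
  proof -
    have "mpoly.subspace {g. x * g \<in> ?S}"
      by (rule mpoly.subspaceI)
        (simp_all add: mpoly.span_zero distrib_left mpoly.span_add mscale_mult_right mpoly.span_scale)
    then have "mpoly.span Y \<subseteq> {g. x * g \<in> ?S}"
      using that by (intro mpoly.span_minimal) (auto intro: mpoly.span_base)
    then show ?thesis using assms(2) by auto
  qed
  have "mpoly.subspace {f. f * g \<in> ?S}"
    by (rule mpoly.subspaceI)
      (simp_all add: mpoly.span_zero distrib_right mpoly.span_add mscale_mult_left mpoly.span_scale)
  then have "mpoly.span X \<subseteq> {f. f * g \<in> ?S}"
    using 1 by (intro mpoly.span_minimal) auto
  then show ?thesis using assms(1) by auto
qed

text \<open>One variable of factor \<open>i\<close> is split off each monomial. Spanning sets
  adapted to the three points can then be multiplied, and the products that are not sections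
  counted.\<close>

lemma forms_span_mult:
  assumes i: "i \<in> I" "1 \<le> d i" and X: "forms I n (\<lambda>i'. d i' - edeg i i') \<subseteq> mpoly.span X"
    and Y: "forms I n (edeg i) \<subseteq> mpoly.span Y"
  shows "forms I n d \<subseteq> mpoly.span {f * g | f g. f \<in> X \<and> g \<in> Y}"
proof -
  have "psingle t 1 \<in> mpoly.span {f * g | f g. f \<in> X \<and> g \<in> Y}" if t: "t \<in> mons I n d" for t
  proof -
    have "\<exists>l\<le>n i. lkp t (i, l) \<noteq> 0"
    proof (rule ccontr)
      assume "\<not> ?thesis"
      then have "(\<Sum>l\<le>n i. lkp t (i, l)) = 0" by auto
      then show False using t i by (auto simp: mons_def)
    qed
    then obtain l where l: "l \<le> n i" "lkp t (i, l) \<noteq> 0" by blast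
    note m = mons_diff_single[OF t l(2)]
    have "psingle (t - psingle (i, l) 1) 1 * var (i, l) \<in> mpoly.span {f * g | f g. f \<in> X \<and> g \<in> Y}"
      using X Y forms_single[OF m(1)] forms_var[where n = n, OF i(1) l(1)] by (intro span_mult) auto
    then show ?thesis using m(5) by (simp add: mult_single)
  qed
  then show ?thesis
    unfolding forms_span[of I n d] by (intro mpoly.span_minimal) auto
qed

text \<open>By commutativity only unordered pairs count; the bound is doubled to avoid a
  division.\<close>

lemma card_products:
  fixes T :: "'b::comm_semiring_1 set"
  assumes "finite T"
  shows "2 * card {f * g | f g. f \<in> T \<and> g \<in> T} \<le> card T * (card T + 1)"
  using assms
proof (induction T rule: finite_induct)
  case (insert x T)
  have "{f * g | f g. f \<in> insert x T \<and> g \<in> insert x T} \<subseteq>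
    {f * g | f g. f \<in> T \<and> g \<in> T} \<union> (\<lambda>g. x * g) ` insert x T"
    by (auto simp: mult.commute)
  moreover have fin: "finite {f * g | f g. f \<in> T \<and> g \<in> T}"
    using insert.hyps finite_image_set2[of "\<lambda>f. f \<in> T" "\<lambda>g. g \<in> T" "(*)"] by simp
  ultimately have "card {f * g | f g. f \<in> insert x T \<and> g \<in> insert x T} \<le>
    card ({f * g | f g. f \<in> T \<and> g \<in> T} \<union> (\<lambda>g. x * g) ` insert x T)"
    using insert.hyps by (intro card_mono) auto
  also have "\<dots> \<le> card {f * g | f g. f \<in> T \<and> g \<in> T} + card ((\<lambda>g. x * g) ` insert x T)"
    by (rule card_Un_le)
  also have "card ((\<lambda>g. x * g) ` insert x T) \<le> card T + 1"
    using card_image_le[of "insert x T" "\<lambda>g. x * g"] insert.hyps by simp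
  finally show ?case using insert by (simp add: algebra_simps)
qed simp

section \<open>Products of forms through three points in general position\<close>

locale three_general =
  fixes I :: "'i set" and n :: "'i \<Rightarrow> nat" and P :: "nat \<Rightarrow> 'i \<Rightarrow> (nat \<Rightarrow> complex) set"
    and V :: "nat \<Rightarrow> 'i \<Rightarrow> nat \<Rightarrow> complex"
  assumes fin: "finite I" and n: "\<And>i. i \<in> I \<Longrightarrow> 1 \<le> n i"
    and reps: "\<And>j. j < 3 \<Longrightarrow> reps I n (P j) (V j)"
    and bracket: "\<And>i j j'. i \<in> I \<Longrightarrow> j < 3 \<Longrightarrow> j' < 3 \<Longrightarrow> j \<noteq> j' \<Longrightarrow> V j i 0 * V j' i 1 - V j i 1 * V j' i 0 \<noteq> 0"
begin

definition vanish :: "('i \<times> nat) mpoly \<Rightarrow> bool" where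
  "vanish f \<longleftrightarrow> (\<forall>j<3. meval (\<lambda>(i, l). V j i l) f = 0)"

lemma sections_mult:
  assumes "f \<in> forms I n d" "vanish f" "g \<in> forms I n d'" "vanish g"
    and "\<And>i. i \<in> I \<Longrightarrow> d i + d' i = a i"
  shows "f * g \<in> double_points_sections I n a 3 P"
proof -
  have "f * g \<in> forms I n a"
    using forms_mult[OF assms(1,3)] forms_cong[of I "\<lambda>i. d i + d' i" a n] assms(5) by simp
  moreover have "in_double_point I n (P j) (f * g)" if "j < 3" for j
    using in_double_point_mult[OF fin reps[OF that] assms(1) _ assms(3)] assms(2,4) that
    by (simp add: vanish_def)
  ultimately show ?thesis by (simp add: double_points_sections_def)
qed

lemma sections_forms: "double_points_sections I n a 3 P \<subseteq> forms I n a"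
  by (auto simp: double_points_sections_def)

lemma sections_card:
  assumes "mpoly.independent S" "S \<subseteq> double_points_sections I n a 3 P"
  shows "card S \<le> mpoly.dim (double_points_sections I n a 3 P)"
proof -
  obtain W where W: "finite W" "forms I n a \<subseteq> mpoly.span W" by (rule forms_fin_span[OF fin])
  then show ?thesis
    using mpoly.dim_mono_fin[OF assms(2), of W] sections_forms mpoly.dim_eq_card_independent[OF assms(1)]
    by (metis subset_trans)
qed

lemma forms_le_sections:
  assumes "forms I n a \<subseteq> mpoly.span (double_points_sections I n a 3 P \<union> R)" "finite R"
  shows "mpoly.dim (forms I n a) \<le> mpoly.dim (double_points_sections I n a 3 P) + card R"
proof -
  obtain W where "finite W" "forms I n a \<subseteq> mpoly.span W" by (rule forms_fin_span[OF fin])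
  then show ?thesis
    using mpoly.dim_le_of_span_Un[OF assms] sections_forms subset_trans by blast
qed

lemma extend_basis:
  assumes "B \<subseteq> forms I n d" "mpoly.independent B"
  shows "\<exists>T. finite (B \<union> T) \<and> B \<inter> T = {} \<and> B \<union> T \<subseteq> forms I n d \<and> forms I n d \<subseteq> mpoly.span (B \<union> T) \<and>
    card B + card T = mpoly.dim (forms I n d)"
proof -
  obtain C where C: "B \<subseteq> C" "C \<subseteq> forms I n d" "mpoly.independent C" "forms I n d \<subseteq> mpoly.span C"
    using mpoly.maximal_independent_subset_extend[OF assms] by blast
  obtain W where W: "finite W" "forms I n d \<subseteq> mpoly.span W" by (rule forms_fin_span[OF fin])
  have "finite C" using mpoly.independent_span_bound[OF W(1) C(3)] C(2) W(2) by auto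
  moreover have "card C = mpoly.dim (forms I n d)" by (rule mpoly.basis_card_eq_dim[OF C(2,4,3)])
  moreover have "card C = card B + card (C - B)"
    using \<open>finite C\<close> C(1) by (metis card_Diff_subset card_mono finite_subset le_add_diff_inverse)
  ultimately show ?thesis
    using C by (intro exI[of _ "C - B"]) (auto simp: Un_absorb1)
qed

text \<open>Three vanishing conditions cut out a subspace of codimension at most 3. Its basis
  \<open>B\<close> is completed by \<open>T\<close> to a basis of all linear forms on the
  factor.\<close>

lemma linear_forms:
  assumes i: "i \<in> I"
  obtains B T where "finite B" "finite T" "B \<union> T \<subseteq> forms I n (edeg i)"
    "\<And>f. f \<in> B \<Longrightarrow> vanish f" "forms I n (edeg i) \<subseteq> mpoly.span (B \<union> T)"
    "card B + card T = n i + 1" "card T \<le> 3"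
proof -
  let ?V = "forms I n (edeg i)"
  let ?K = "{f \<in> ?V. \<forall>j\<in>{..<3}. clf (mev (\<lambda>(i, l). V j i l)) f = 0}"
  obtain W where W: "finite W" "?V \<subseteq> mpoly.span W" by (rule forms_fin_span[OF fin])
  have dimV: "mpoly.dim ?V = n i + 1"
  proof -
    have "mpoly.dim ?V = (\<Prod>i'\<in>I. (n i' + edeg i i') choose edeg i i')"
      using dim_forms[OF fin, of n] card_mons[OF fin, of n] by simp
    also have "\<dots> = (\<Prod>i'\<in>I. if i' = i then n i + 1 else 1)"
      by (intro prod.cong) (auto simp: edeg_def choose_one)
    also have "\<dots> = n i + 1" using fin i by simp
    finally show ?thesis .
  qed
  have le: "mpoly.dim ?V \<le> mpoly.dim ?K + card {..<3::nat}"
    by (rule mpoly.dim_le_kernel[OF forms_subspace _ W(2,1), where \<phi> = "\<lambda>j. clf (mev (\<lambda>(i, l). V j i l))"])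
      (auto simp: cx.lf_add cx.lf_mscale)
  obtain B where B: "B \<subseteq> ?K" "mpoly.independent B" "card B = mpoly.dim ?K"
    by (rule mpoly.basis_exists[of ?K])
  have "B \<subseteq> ?V" using B(1) by auto
  from extend_basis[OF this B(2)]
  obtain T where T: "finite (B \<union> T)" "B \<union> T \<subseteq> ?V" "?V \<subseteq> mpoly.span (B \<union> T)"
    "card B + card T = mpoly.dim ?V"
    by (elim exE conjE)
  show thesis
  proof (rule that[of B T])
    show "vanish f" if "f \<in> B" for f
      using that B(1) by (auto simp: vanish_def meval_eq)
    show "card T \<le> 3" using le B(3) T(4) by simp
  qed (use T dimV in auto)
qed

lemma card_set_mult: "finite X \<Longrightarrow> finite Y \<Longrightarrow> card {f * g | f g. f \<in> X \<and> g \<in> Y} \<le> card X * card Y"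
proof -
  assume "finite X" "finite Y"
  then have "card ((\<lambda>(f, g). f * g) ` (X \<times> Y)) \<le> card (X \<times> Y)"
    by (intro card_image_le) auto
  moreover have "{f * g | f g. f \<in> X \<and> g \<in> Y} = (\<lambda>(f, g). f * g) ` (X \<times> Y)" by auto
  ultimately show ?thesis by (simp add: card_cartesian_product)
qed

lemma finite_set_mult: "finite X \<Longrightarrow> finite Y \<Longrightarrow> finite {f * g | f g. f \<in> X \<and> g \<in> Y}"
  by (rule finite_image_set2) simp_all

text \<open>Products of two members of \<open>B\<close> are sections. The rest consists of
  \<open>T\<close> times \<open>B\<close> and the unordered products in \<open>T\<close>, which for
  \<open>card T = 3\<close> number at most \<open>3 (n i - 2) + 6\<close>.\<close>

lemma quadrics:
  assumes I: "I = {i}" and a: "a i = 2" and ni: "3 \<le> n i"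
  shows "mpoly.dim (forms I n a) \<le> mpoly.dim (double_points_sections I n a 3 P) + 3 * n i"
proof -
  have iI: "i \<in> I" using I by simp
  obtain B T where BT: "finite B" "finite T" "B \<union> T \<subseteq> forms I n (edeg i)"
    "\<And>f. f \<in> B \<Longrightarrow> vanish f" "forms I n (edeg i) \<subseteq> mpoly.span (B \<union> T)"
    "card B + card T = n i + 1" "card T \<le> 3"
    using linear_forms[OF iI] by blast
  let ?R = "{f * g | f g. f \<in> T \<and> g \<in> B} \<union> {f * g | f g. f \<in> T \<and> g \<in> T}"
  let ?S = "double_points_sections I n a 3 P"
  have "forms I n (\<lambda>i'. a i' - edeg i i') = forms I n (edeg i)"
    using a I by (intro forms_cong) (auto simp: edeg_def)
  then have "forms I n a \<subseteq> mpoly.span {f * g | f g. f \<in> B \<union> T \<and> g \<in> B \<union> T}"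
    using BT(5) a iI by (intro forms_span_mult[of i]) auto
  also have "\<dots> \<subseteq> mpoly.span (?S \<union> ?R)"
  proof (rule mpoly.span_mono, rule subsetI)
    fix h assume "h \<in> {f * g | f g. f \<in> B \<union> T \<and> g \<in> B \<union> T}"
    then obtain f g where h: "h = f * g" "f \<in> B \<union> T" "g \<in> B \<union> T" by blast
    have "f * g \<in> ?S" if "f \<in> B" "g \<in> B"
      using BT(3,4) that a I by (intro sections_mult[of f "edeg i" g "edeg i"]) (auto simp: edeg_def)
    moreover have "f * g \<in> {f * g | f g. f \<in> T \<and> g \<in> B}" if "f \<in> B" "g \<in> T"
      using that mult.commute[of f g] by blast
    ultimately show "h \<in> ?S \<union> ?R" using h by blast
  qed
  finally have "mpoly.dim (forms I n a) \<le> mpoly.dim ?S + card ?R"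
    using finite_set_mult BT(1,2) by (intro forms_le_sections) auto
  moreover have "card ?R \<le> 3 * n i"
  proof -
    have "card ?R \<le> card {f * g | f g. f \<in> T \<and> g \<in> B} + card {f * g | f g. f \<in> T \<and> g \<in> T}"
      by (rule card_Un_le)
    also have "\<dots> \<le> card T * card B + card {f * g | f g. f \<in> T \<and> g \<in> T}"
      using card_set_mult[OF BT(2,1)] by simp
    finally have "2 * card ?R \<le> 2 * (card T * card B) + card T * (card T + 1)"
      using card_products[OF BT(2)] by linarith
    moreover have "card T = 0 \<or> card T = 1 \<or> card T = 2 \<or> card T = 3" using BT(7) by linarith
    ultimately show ?thesis using BT(6) ni by (elim disjE) simp_all
  qed
  ultimately show ?thesis by linarith
qed

text \<open>Products of \<open>B\<close> with \<open>B'\<close> are sections. For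
  \<open>card T = card T' = 3\<close> at most \<open>3 (n j + 1) + 3 (n i - 2)\<close> products
  remain.\<close>

lemma bilinear:
  assumes I: "I = {i, j}" "i \<noteq> j" and a: "a i = 1" "a j = 1" and ni: "3 \<le> n i" "3 \<le> n j"
  shows "mpoly.dim (forms I n a) \<le> mpoly.dim (double_points_sections I n a 3 P) + (3 * (n i + n j) - 3)"
proof -
  have iI: "i \<in> I" "j \<in> I" using I by auto
  obtain B T where BT: "finite B" "finite T" "B \<union> T \<subseteq> forms I n (edeg i)"
    "\<And>f. f \<in> B \<Longrightarrow> vanish f" "forms I n (edeg i) \<subseteq> mpoly.span (B \<union> T)"
    "card B + card T = n i + 1" "card T \<le> 3"
    using linear_forms[OF iI(1)] by blast
  obtain B' T' where BT': "finite B'" "finite T'" "B' \<union> T' \<subseteq> forms I n (edeg j)"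
    "\<And>f. f \<in> B' \<Longrightarrow> vanish f" "forms I n (edeg j) \<subseteq> mpoly.span (B' \<union> T')"
    "card B' + card T' = n j + 1" "card T' \<le> 3"
    using linear_forms[OF iI(2)] by blast
  let ?R = "{f * g | f g. f \<in> T \<and> g \<in> B' \<union> T'} \<union> {f * g | f g. f \<in> B \<and> g \<in> T'}"
  let ?S = "double_points_sections I n a 3 P"
  have "forms I n (\<lambda>i'. a i' - edeg j i') = forms I n (edeg i)"
    using a I by (intro forms_cong) (auto simp: edeg_def)
  then have "forms I n a \<subseteq> mpoly.span {f * g | f g. f \<in> B \<union> T \<and> g \<in> B' \<union> T'}"
    using BT(5) BT'(5) a iI by (intro forms_span_mult[of j]) auto
  also have "\<dots> \<subseteq> mpoly.span (?S \<union> ?R)"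
  proof (rule mpoly.span_mono, rule subsetI)
    fix h assume "h \<in> {f * g | f g. f \<in> B \<union> T \<and> g \<in> B' \<union> T'}"
    then obtain f g where h: "h = f * g" "f \<in> B \<union> T" "g \<in> B' \<union> T'" by blast
    have "f * g \<in> ?S" if "f \<in> B" "g \<in> B'"
      using BT(3,4) BT'(3,4) that a I by (intro sections_mult[of f "edeg i" g "edeg j"]) (auto simp: edeg_def)
    then show "h \<in> ?S \<union> ?R" using h by blast
  qed
  finally have "mpoly.dim (forms I n a) \<le> mpoly.dim ?S + card ?R"
    using BT(1,2) BT'(1,2) by (intro forms_le_sections finite_UnI finite_set_mult)
  moreover have "card ?R \<le> 3 * (n i + n j) - 3"
  proof -
    have "card ?R \<le> card {f * g | f g. f \<in> T \<and> g \<in> B' \<union> T'} + card {f * g | f g. f \<in> B \<and> g \<in> T'}"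
      by (rule card_Un_le)
    also have "\<dots> \<le> card T * card (B' \<union> T') + card B * card T'"
      using BT(1,2) BT'(1,2) by (intro add_mono card_set_mult) auto
    also have "\<dots> \<le> card T * (n j + 1) + card B * card T'"
      using card_Un_le[of B' T'] BT'(6) by simp
    finally have "card ?R \<le> card T * (n j + 1) + card B * card T'" .
    moreover have "card T = 0 \<or> card T = 1 \<or> card T = 2 \<or> card T = 3" using BT(7) by linarith
    moreover have "card T' = 0 \<or> card T' = 1 \<or> card T' = 2 \<or> card T' = 3" using BT'(7) by linarith
    ultimately show ?thesis using BT(6) ni by (elim disjE) simp_all
  qed
  ultimately show ?thesis by linarith
qed

text \<open>The \<open>(1, 1)\<close>-form \<open>conic i j\<close> is the graph of the projectivity between two lines that
  matches the three points.\<close>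

definition br :: "nat \<Rightarrow> 'i \<Rightarrow> ('i \<times> nat) mpoly" where
  "br p i = mscale (V p i 1) (var (i, 0)) - mscale (V p i 0) (var (i, 1))"

definition brv :: "nat \<Rightarrow> nat \<Rightarrow> 'i \<Rightarrow> complex" where
  "brv p q i = V p i 1 * V q i 0 - V p i 0 * V q i 1"

definition conic :: "'i \<Rightarrow> 'i \<Rightarrow> ('i \<times> nat) mpoly" where
  "conic i j = mscale (brv 1 2 i * brv 0 2 j) (br 0 i * br 1 j) - mscale (brv 0 2 i * brv 1 2 j) (br 1 i * br 0 j)"

lemma br_form: "i \<in> I \<Longrightarrow> br p i \<in> forms I n (edeg i)"
  unfolding br_def using n by (intro forms_diff forms_mscale forms_var) auto

lemma conic_form: "i \<in> I \<Longrightarrow> j \<in> I \<Longrightarrow> conic i j \<in> forms I n (\<lambda>i'. edeg i i' + edeg j i')"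
  unfolding conic_def by (intro forms_diff forms_mscale forms_mult br_form)

lemma brv_self [simp]: "brv p p i = 0"
  by (simp add: brv_def)

lemma brv_nonzero: "i \<in> I \<Longrightarrow> p < 3 \<Longrightarrow> q < 3 \<Longrightarrow> p \<noteq> q \<Longrightarrow> brv p q i \<noteq> 0"
  using bracket[of i p q] by (auto simp: brv_def algebra_simps)

lemma meval_br: "meval (\<lambda>(i, l). V (s i) i l) (br p i) = brv p (s i) i"
  by (simp add: br_def brv_def meval_diff meval_mscale)

lemma meval_conic: "meval (\<lambda>(i, l). V (s i) i l) (conic i j) =
    brv 1 2 i * brv 0 2 j * (brv 0 (s i) i * brv 1 (s j) j) - brv 0 2 i * brv 1 2 j * (brv 1 (s i) i * brv 0 (s j) j)"
  by (simp add: conic_def meval_diff meval_mscale meval_mult meval_br)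

text \<open>At the points 0 and 1 each of the two products contains a vanishing bracket. At the
  point 2 they cancel, which is what the coefficients of \<open>conic\<close> are chosen
  for.\<close>

lemma conic_diag: "s i < 3 \<Longrightarrow> s i = s j \<Longrightarrow> meval (\<lambda>(i, l). V (s i) i l) (conic i j) = 0"
proof -
  assume "s i < 3" "s i = s j"
  then consider "s i = 0" "s j = 0" | "s i = 1" "s j = 1" | "s i = 2" "s j = 2" by linarith
  then show ?thesis by cases (simp_all add: meval_conic)
qed

lemma conic_vanish: "vanish (conic i j)"
  unfolding vanish_def using conic_diag[of "\<lambda>_. p" for p] by auto

text \<open>\<open>s\<close> mixes the three points factor by factor. Here only the second product
  of \<open>conic\<close> survives, which certifies that the form is not 0.\<close>

lemma conic_nonzero:
  "i \<in> I \<Longrightarrow> j \<in> I \<Longrightarrow> s i = 0 \<Longrightarrow> s j = 1 \<Longrightarrow> meval (\<lambda>(i, l). V (s i) i l) (conic i j) \<noteq> 0"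
  by (simp add: meval_conic brv_nonzero)

lemma square_conic:
  assumes I: "I = {i, j}" "i \<noteq> j" and a: "a i = 2" "a j = 2"
  shows "1 \<le> mpoly.dim (double_points_sections I n a 3 P)"
proof -
  let ?s = "\<lambda>k. if k = j then 1 else 0::nat"
  have "conic i j * conic i j \<in> double_points_sections I n a 3 P"
    using a I by (intro sections_mult[OF conic_form conic_vanish conic_form conic_vanish]) (auto simp: edeg_def)
  moreover have "meval (\<lambda>(i, l). V (?s i) i l) (conic i j) \<noteq> 0"
    using I by (intro conic_nonzero) auto
  then have "meval (\<lambda>(i, l). V (?s i) i l) (conic i j * conic i j) \<noteq> 0"
    by (simp add: meval_mult)
  then have "conic i j * conic i j \<noteq> 0" by (metis meval_zero)
  ultimately show ?thesis
    using sections_card[of "{conic i j * conic i j}" a] by simp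
qed

lemma conic_product:
  assumes I: "I = {i, j, m}" "i \<noteq> j" "i \<noteq> m" "j \<noteq> m" and a: "a i = 1" "a j = 1" "a m = 2"
  shows "1 \<le> mpoly.dim (double_points_sections I n a 3 P)"
proof -
  let ?s = "\<lambda>k. if k = m then 1 else 0::nat"
  have "conic i m * conic j m \<in> double_points_sections I n a 3 P"
    using a I by (intro sections_mult[OF conic_form conic_vanish conic_form conic_vanish]) (auto simp: edeg_def)
  moreover have "meval (\<lambda>(i, l). V (?s i) i l) (conic i m) \<noteq> 0" "meval (\<lambda>(i, l). V (?s i) i l) (conic j m) \<noteq> 0"
    using I by (intro conic_nonzero; auto)+
  then have "meval (\<lambda>(i, l). V (?s i) i l) (conic i m * conic j m) \<noteq> 0"
    by (simp add: meval_mult)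
  then have "conic i m * conic j m \<noteq> 0" by (metis meval_zero)
  ultimately show ?thesis
    using sections_card[of "{conic i m * conic j m}" a] by simp
qed

text \<open>Four factors can be paired in different ways, and two pairings already give independent
  products. At the mixed point \<open>?s'\<close> the factors \<open>i\<close> and \<open>m\<close>
  take the same original point, so \<open>?g\<close> vanishes there while \<open>?f\<close> does
  not.\<close>

lemma conic_pencil:
  assumes I: "I = {i, j, m, k}" "distinct [i, j, m, k]" and a: "\<And>i'. i' \<in> I \<Longrightarrow> a i' = 1"
  shows "2 \<le> mpoly.dim (double_points_sections I n a 3 P)"
proof -
  let ?s = "\<lambda>x. if x = m \<or> x = k then 1 else 0::nat" and ?s' = "\<lambda>x. if x = j \<or> x = k then 1 else 0::nat"
  let ?f = "conic i j * conic m k" and ?g = "conic i m * conic j k"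
  have sub: "{?f, ?g} \<subseteq> double_points_sections I n a 3 P"
  proof -
    have "?f \<in> double_points_sections I n a 3 P"
      using a I by (intro sections_mult[OF conic_form conic_vanish conic_form conic_vanish]) (auto simp: edeg_def)
    moreover have "?g \<in> double_points_sections I n a 3 P"
      using a I by (intro sections_mult[OF conic_form conic_vanish conic_form conic_vanish]) (auto simp: edeg_def)
    ultimately show ?thesis by simp
  qed
  have "meval (\<lambda>(i, l). V (?s i) i l) (conic i m) \<noteq> 0" "meval (\<lambda>(i, l). V (?s i) i l) (conic j k) \<noteq> 0"
    using I by (intro conic_nonzero; auto)+
  then have g: "meval (\<lambda>(i, l). V (?s i) i l) ?g \<noteq> 0" by (simp add: meval_mult)
  have "meval (\<lambda>(i, l). V (?s' i) i l) (conic i j) \<noteq> 0" "meval (\<lambda>(i, l). V (?s' i) i l) (conic m k) \<noteq> 0"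
    using I by (intro conic_nonzero; auto)+
  then have f: "meval (\<lambda>(i, l). V (?s' i) i l) ?f \<noteq> 0" by (simp add: meval_mult)
  have "meval (\<lambda>(i, l). V (?s' i) i l) (conic i m) = 0"
    using I(2) by (intro conic_diag) auto
  then have g': "meval (\<lambda>(i, l). V (?s' i) i l) ?g = 0" by (simp add: meval_mult)
  have "?g \<noteq> 0" using g by (metis meval_zero)
  moreover have "?f \<notin> mpoly.span {?g}"
  proof
    assume "?f \<in> mpoly.span {?g}"
    then obtain c where "?f = mscale c ?g" by (auto simp: mpoly.span_singleton)
    then show False using f g' by (simp add: meval_mscale)
  qed
  moreover from this have "?f \<noteq> ?g" using mpoly.span_base[of ?g "{?g}"] by auto
  ultimately show ?thesis
    using sections_card[OF _ sub] by (simp add: mpoly.independent_insert)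
qed

text \<open>\<open>conic i j\<close> times a linear form through the points is a section. With
  \<open>D\<close> completing \<open>conic i j\<close> to a basis of the 4-dimensional space of (1,
  1)-forms on the lines, at most \<open>4 card T + 3 card B\<close> products remain, and
  \<open>card T \<le> 3\<close> gives the constant.\<close>

lemma two_lines:
  assumes I: "I = {i, j, m}" "i \<noteq> j" "i \<noteq> m" "j \<noteq> m" and a: "a i = 1" "a j = 1" "a m = 1"
    and nn: "n i = 1" "n j = 1"
  shows "mpoly.dim (forms I n a) \<le> mpoly.dim (double_points_sections I n a 3 P) + (3 * n m + 6)"
proof -
  let ?S = "double_points_sections I n a 3 P"
  let ?d = "\<lambda>i'. edeg i i' + edeg j i'"
  let ?C = "conic i j"
  have iI: "i \<in> I" "j \<in> I" "m \<in> I" using I by auto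
  obtain B T where BT: "finite B" "finite T" "B \<union> T \<subseteq> forms I n (edeg m)"
    "\<And>f. f \<in> B \<Longrightarrow> vanish f" "forms I n (edeg m) \<subseteq> mpoly.span (B \<union> T)"
    "card B + card T = n m + 1" "card T \<le> 3"
    using linear_forms[OF iI(3)] by blast
  have "meval (\<lambda>(i, l). V (if i = j then 1 else 0) i l) ?C \<noteq> 0"
    using I iI by (intro conic_nonzero) auto
  then have "?C \<noteq> 0" by (metis meval_zero)
  then obtain D where D: "finite ({?C} \<union> D)" "forms I n ?d \<subseteq> mpoly.span ({?C} \<union> D)"
    "card {?C} + card D = mpoly.dim (forms I n ?d)"
    using extend_basis[of "{?C}" ?d] conic_form[OF iI(1,2)] by auto
  have "mpoly.dim (forms I n ?d) = 4"
    using dim_forms[OF fin, of n ?d] card_mons[OF fin, of n ?d] I nn by (simp add: edeg_def choose_one)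
  then have cD: "card D = 3" using D(3) by simp
  have finD: "finite D" using D(1) by simp
  let ?R = "{f * g | f g. f \<in> {?C} \<union> D \<and> g \<in> T} \<union> {f * g | f g. f \<in> D \<and> g \<in> B}"
  have "forms I n (\<lambda>i'. a i' - edeg m i') = forms I n ?d"
    using a I by (intro forms_cong) (auto simp: edeg_def)
  then have "forms I n a \<subseteq> mpoly.span {f * g | f g. f \<in> {?C} \<union> D \<and> g \<in> B \<union> T}"
    using BT(5) D(2) a iI by (intro forms_span_mult[of m]) auto
  also have "\<dots> \<subseteq> mpoly.span (?S \<union> ?R)"
  proof (rule mpoly.span_mono, rule subsetI)
    fix h assume "h \<in> {f * g | f g. f \<in> {?C} \<union> D \<and> g \<in> B \<union> T}"
    then obtain f g where h: "h = f * g" "f \<in> {?C} \<union> D" "g \<in> B \<union> T" by blast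
    have "?C * g \<in> ?S" if "g \<in> B"
      using BT(3,4) that a I
      by (intro sections_mult[OF conic_form[OF iI(1,2)] conic_vanish, of g "edeg m"]) (auto simp: edeg_def)
    then show "h \<in> ?S \<union> ?R" using h by blast
  qed
  finally have "mpoly.dim (forms I n a) \<le> mpoly.dim ?S + card ?R"
    using finite_set_mult[OF D(1) BT(2)] finite_set_mult[OF finD BT(1)] by (intro forms_le_sections) auto
  moreover have "card ?R \<le> 3 * n m + 6"
  proof -
    have "card ?R \<le> card {f * g | f g. f \<in> {?C} \<union> D \<and> g \<in> T} + card {f * g | f g. f \<in> D \<and> g \<in> B}"
      by (rule card_Un_le)
    also have "\<dots> \<le> card ({?C} \<union> D) * card T + card D * card B"
      using D(1) finD BT(1,2) by (intro add_mono card_set_mult) auto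
    also have "\<dots> \<le> 4 * card T + 3 * card B"
      using card_Un_le[of "{?C}" D] cD by (simp add: mult_right_mono)
    finally show ?thesis using BT(6,7) by linarith
  qed
  ultimately show ?thesis by linarith
qed

end

subsection \<open>The exceptions\<close>

abbreviation general_three :: "'i set \<Rightarrow> ('i \<Rightarrow> nat) \<Rightarrow> ('i \<Rightarrow> nat) \<Rightarrow> bool" where
  "general_three I n a \<equiv> for_general_points 3 I n (\<lambda>P. hilbert_double_points I n a 3 P =
    int (min (3 * (1 + sum n I)) (\<Prod>i\<in>I. (n i + a i) choose a i)))"

text \<open>An open set witnessing truth would contain a triple in general position. There
  \<open>bad\<close> bounds the Hilbert function by \<open>r\<close>, which lies below both numbers
  in the expected minimum.\<close>

lemma not_general_hilbert:
  fixes I :: "'i set" and n a :: "'i \<Rightarrow> nat"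
  assumes fin: "finite I" and n: "\<And>i. i \<in> I \<Longrightarrow> 1 \<le> n i"
    and r: "r < 3 * (1 + sum n I)" "r < (\<Prod>i\<in>I. (n i + a i) choose a i)"
    and bad: "\<And>P V. three_general I n P V \<Longrightarrow> mpoly.dim (forms I n a) \<le> mpoly.dim (double_points_sections I n a 3 P) + r"
  shows "\<not> general_three I n a"
proof
  assume "general_three I n a"
  then obtain U where U: "zariski_open ({..<3} \<times> I) (\<lambda>(j, i). n i) U" "U \<noteq> {}"
    "\<forall>P\<in>U. hilbert_double_points I n a 3 (\<lambda>j i. P (j, i)) =
      int (min (3 * (1 + sum n I)) (\<Prod>i\<in>I. (n i + a i) choose a i))"
    unfolding for_general_points_def by blast
  obtain P V where P: "P \<in> U" "\<forall>j<3. reps I n (\<lambda>i. P (j, i)) (V j)"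
    "\<forall>i\<in>I. \<forall>j<3. \<forall>j'<3. j \<noteq> j' \<longrightarrow> V j i 0 * V j' i 1 - V j i 1 * V j' i 0 \<noteq> 0"
    using nonvanishing_on_line[of I n U, OF fin n U(1,2)] by blast
  have "mpoly.dim (forms I n a) \<le> mpoly.dim (double_points_sections I n a 3 (\<lambda>j i. P (j, i))) + r"
    using P(2,3) fin n by (intro bad[of _ V]) (unfold_locales, auto)
  moreover have "mpoly.dim (forms I n a) = (\<Prod>i\<in>I. (n i + a i) choose a i)"
    using dim_forms[OF fin, of n a] card_mons[OF fin, of n a] by simp
  ultimately show False
    using bspec[OF U(3) P(1)] r unfolding hilbert_double_points_def by linarith
qed

lemma dim_forms_prod: "finite I \<Longrightarrow> mpoly.dim (forms I n a) = (\<Prod>i\<in>I. (n i + a i) choose a i)"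
  by (simp add: dim_forms card_mons)

text \<open>The number of quadrics exceeds \<open>3 n i\<close> by
  \<open>(n i - 1) (n i - 2) / 2\<close>.\<close>

lemma not_general_quadrics:
  assumes I: "I = {i}" and a: "a i = 2" and nn: "3 \<le> n i"
  shows "\<not> general_three I n a"
proof (rule not_general_hilbert[where r = "3 * n i"])
  obtain q where q: "n i = 3 + q" using nn nat_le_iff_add by blast
  have "2 * (3 * n i) < (n i + 2) * (n i + 1)" by (simp add: q algebra_simps)
  moreover have "2 * ((n i + 2) choose 2) = (n i + 2) * (n i + 1)"
    by (simp add: choose_two algebra_simps)
  ultimately show "3 * n i < (\<Prod>i\<in>I. (n i + a i) choose a i)" using I a by simp
  fix P V
  assume "three_general I n P V"
  then interpret three_general I n P V .
  show "mpoly.dim (forms I n a) \<le> mpoly.dim (double_points_sections I n a 3 P) + 3 * n i"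
    by (rule quadrics[where a = a, OF I a nn])
qed (use I nn in auto)

text \<open>The space of forms exceeds \<open>r\<close> by \<open>(n i - 2) (n j - 2)\<close>,
  positive because both dimensions are at least 3.\<close>

lemma not_general_bilinear:
  assumes I: "I = {i, j}" "i \<noteq> j" and a: "a i = 1" "a j = 1" and nn: "3 \<le> n i" "3 \<le> n j"
  shows "\<not> general_three I n a"
proof (rule not_general_hilbert[where r = "3 * (n i + n j) - 3"])
  obtain p q where pq: "n i = 3 + p" "n j = 3 + q" using nn nat_le_iff_add by metis
  have "3 * (n i + n j) - 3 < (n i + 1) * (n j + 1)" by (simp add: pq algebra_simps)
  then show "3 * (n i + n j) - 3 < (\<Prod>i\<in>I. (n i + a i) choose a i)"
    using I a by (simp add: choose_one)
  fix P V
  assume "three_general I n P V"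
  then interpret three_general I n P V .
  show "mpoly.dim (forms I n a) \<le> mpoly.dim (double_points_sections I n a 3 P) + (3 * (n i + n j) - 3)"
    by (rule bilinear[OF I a nn])
qed (use I nn in auto)

text \<open>Three double points impose 9 conditions on a space of dimension 9, so a single section
  is already unexpected.\<close>

lemma not_general_square_conic:
  assumes I: "I = {i, j}" "i \<noteq> j" and a: "a i = 2" "a j = 2" and nn: "n i = 1" "n j = 1"
  shows "\<not> general_three I n a"
proof (rule not_general_hilbert[where r = 8])
  have prod: "(\<Prod>i\<in>I. (n i + a i) choose a i) = 9"
    using I a nn by (simp add: choose_two)
  then show "8 < (\<Prod>i\<in>I. (n i + a i) choose a i)" by simp
  fix P V
  assume "three_general I n P V"
  then interpret three_general I n P V .
  show "mpoly.dim (forms I n a) \<le> mpoly.dim (double_points_sections I n a 3 P) + 8"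
    using square_conic[where a = a, OF I a] dim_forms_prod[OF fin, of n a] prod by simp
qed (use I nn in auto)

text \<open>Here 12 conditions meet a space of dimension 12, and again one section suffices.\<close>

lemma not_general_conic_product:
  assumes I: "I = {i, j, m}" "i \<noteq> j" "i \<noteq> m" "j \<noteq> m" and a: "a i = 1" "a j = 1" "a m = 2"
    and nn: "n i = 1" "n j = 1" "n m = 1"
  shows "\<not> general_three I n a"
proof (rule not_general_hilbert[where r = 11])
  have prod: "(\<Prod>i\<in>I. (n i + a i) choose a i) = 12"
    using I a nn by (simp add: choose_two choose_one)
  then show "11 < (\<Prod>i\<in>I. (n i + a i) choose a i)" by simp
  fix P V
  assume "three_general I n P V"
  then interpret three_general I n P V .
  show "mpoly.dim (forms I n a) \<le> mpoly.dim (double_points_sections I n a 3 P) + 11"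
    using conic_product[where a = a, OF I a] dim_forms_prod[OF fin, of n a] prod by simp
qed (use I nn in auto)

text \<open>The space of forms has dimension \<open>4 (n m + 1)\<close> and exceeds \<open>r\<close>
  by \<open>n m - 2\<close>; the number of conditions is \<open>r + 3\<close>.\<close>

lemma not_general_two_lines:
  assumes I: "I = {i, j, m}" "i \<noteq> j" "i \<noteq> m" "j \<noteq> m" and a: "a i = 1" "a j = 1" "a m = 1"
    and nn: "n i = 1" "n j = 1" "3 \<le> n m"
  shows "\<not> general_three I n a"
proof (rule not_general_hilbert[where r = "3 * n m + 6"])
  show "3 * n m + 6 < (\<Prod>i\<in>I. (n i + a i) choose a i)"
    using I a nn by (simp add: choose_one)
  fix P V
  assume "three_general I n P V"
  then interpret three_general I n P V .
  show "mpoly.dim (forms I n a) \<le> mpoly.dim (double_points_sections I n a 3 P) + (3 * n m + 6)"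
    by (rule two_lines[OF I a nn(1,2)])
qed (use I nn in auto)

text \<open>From 15 conditions on a space of dimension 16 one section is expected, so two
  independent ones are required.\<close>

lemma not_general_conic_pencil:
  assumes I: "I = {i, j, m, k}" "distinct [i, j, m, k]" and a: "\<And>i'. i' \<in> I \<Longrightarrow> a i' = 1"
    and nn: "\<And>i'. i' \<in> I \<Longrightarrow> n i' = 1"
  shows "\<not> general_three I n a"
proof (rule not_general_hilbert[where r = 14])
  have "(\<Prod>i\<in>I. (n i + a i) choose a i) = (\<Prod>i\<in>I. 2)"
    using a nn by (intro prod.cong) (auto simp: choose_one)
  also have "\<dots> = 16" using I by simp
  finally have prod: "(\<Prod>i\<in>I. (n i + a i) choose a i) = 16" .
  then show "14 < (\<Prod>i\<in>I. (n i + a i) choose a i)" by simp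
  have "sum n I = (\<Sum>i\<in>I. 1)" using nn by (intro sum.cong) auto
  also have "\<dots> = 4" using I by simp
  finally show "14 < 3 * (1 + sum n I)" by simp
  fix P V
  assume "three_general I n P V"
  then interpret three_general I n P V .
  show "mpoly.dim (forms I n a) \<le> mpoly.dim (double_points_sections I n a 3 P) + 14"
    using conic_pencil[where a = a, OF I a] dim_forms_prod[OF fin, of n a] prod by simp
qed (use I nn in auto)

section \<open>Lists, permutations and the classification\<close>

lemma T_stmt_general: "T_stmt n a 3 \<longleftrightarrow> general_three {..<length n} (nth n) (nth a)"
  by (simp add: T_stmt_def)

lemma lessThan_small:
  "{..<1::nat} = {0}" "{..<2::nat} = {0, 1}" "{..<3::nat} = {0, 1, 2}" "{..<4::nat} = {0, 1, 2, 3}"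
  by (auto simp: One_nat_def)

text \<open>The preceding lemmas name the factors abstractly, so the permutation enters only through
  the names \<open>\<sigma> 0\<close>, \<open>\<sigma> 1\<close>, and so on of the factors.\<close>

lemma not_T_exceptional:
  assumes len: "length n = k" "length a = k" and \<sigma>: "\<sigma> permutes {..<k}"
    and exc: "exceptional (permute_list \<sigma> n) (permute_list \<sigma> a)"
  shows "\<not> T_stmt n a 3"
proof -
  have nth_n: "n ! \<sigma> i = permute_list \<sigma> n ! i" and nth_a: "a ! \<sigma> i = permute_list \<sigma> a ! i"
    if "i < k" for i
    using permute_list_nth[of \<sigma> n i] permute_list_nth[of \<sigma> a i] \<sigma> len that by auto
  have len': "length (permute_list \<sigma> n) = k" using len by simp
  have I: "{..<length n} = \<sigma> ` {..<k}" using permutes_image[OF \<sigma>] len by simp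
  have inj: "\<sigma> i = \<sigma> j \<longleftrightarrow> i = j" for i j using permutes_inj[OF \<sigma>] by (simp add: inj_eq)
  show ?thesis
    using exc unfolding exceptional_def T_stmt_general
  proof (elim disjE exE conjE)
    fix m :: nat assume e: "3 \<le> m" "permute_list \<sigma> n = [m]" "permute_list \<sigma> a = [2]"
    then have k: "k = 1" using len' by simp
    show "\<not> general_three {..<length n} (nth n) (nth a)"
      by (rule not_general_quadrics[of _ "\<sigma> 0"]) (use e nth_n[of 0] nth_a[of 0] k I in \<open>auto simp: lessThan_small\<close>)
  next
    fix m m' :: nat assume e: "3 \<le> m" "m \<le> m'" "permute_list \<sigma> n = [m, m']" "permute_list \<sigma> a = [1, 1]"
    then have k: "k = 2" using len' by simp
    show "\<not> general_three {..<length n} (nth n) (nth a)"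
      by (rule not_general_bilinear[of _ "\<sigma> 0" "\<sigma> 1"])
        (use e nth_n[of 0] nth_a[of 0] nth_n[of 1] nth_a[of 1] k I in \<open>auto simp: lessThan_small inj\<close>)
  next
    assume e: "permute_list \<sigma> n = [1, 1]" "permute_list \<sigma> a = [2, 2]"
    then have k: "k = 2" using len' by simp
    show "\<not> general_three {..<length n} (nth n) (nth a)"
      by (rule not_general_square_conic[of _ "\<sigma> 0" "\<sigma> 1"])
        (use e nth_n[of 0] nth_a[of 0] nth_n[of 1] nth_a[of 1] k I in \<open>auto simp: lessThan_small inj\<close>)
  next
    fix m :: nat assume e: "3 \<le> m" "permute_list \<sigma> n = [1, 1, m]" "permute_list \<sigma> a = [1, 1, 1]"
    then have k: "k = 3" using len' by simp
    show "\<not> general_three {..<length n} (nth n) (nth a)"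
      by (rule not_general_two_lines[of _ "\<sigma> 0" "\<sigma> 1" "\<sigma> 2"])
        (use e nth_n[of 0] nth_a[of 0] nth_n[of 1] nth_a[of 1] nth_n[of 2] nth_a[of 2] k I
         in \<open>auto simp: lessThan_small inj\<close>)
  next
    assume e: "permute_list \<sigma> n = [1, 1, 1]" "permute_list \<sigma> a = [1, 1, 2]"
    then have k: "k = 3" using len' by simp
    show "\<not> general_three {..<length n} (nth n) (nth a)"
      by (rule not_general_conic_product[of _ "\<sigma> 0" "\<sigma> 1" "\<sigma> 2"])
        (use e nth_n[of 0] nth_a[of 0] nth_n[of 1] nth_a[of 1] nth_n[of 2] nth_a[of 2] k I
         in \<open>auto simp: lessThan_small inj\<close>)
  next
    assume e: "permute_list \<sigma> n = [1, 1, 1, 1]" "permute_list \<sigma> a = [1, 1, 1, 1]"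
    then have k: "k = 4" using len' by simp
    have I4: "{..<length n} = {\<sigma> 0, \<sigma> 1, \<sigma> 2, \<sigma> 3}" using I k by (simp add: lessThan_small)
    show "\<not> general_three {..<length n} (nth n) (nth a)"
    proof (rule not_general_conic_pencil[OF I4])
      fix i assume "i \<in> {..<length n}"
      then obtain j where "i = \<sigma> j" "j < 4" using I k by auto
      moreover from this have "j = 0 \<or> j = 1 \<or> j = 2 \<or> j = 3" by linarith
      ultimately show "a ! i = 1" "n ! i = 1"
        using nth_n[of j] nth_a[of j] e k by auto
    qed (simp add: inj)
  qed
qed

lemma permute_list_transpose_last:
  assumes "i < 3" "length xs = 3"
  shows "permute_list (Transposition.transpose i 2) xs = 
    [xs ! Transposition.transpose i 2 0, xs ! Transposition.transpose i 2 1, xs ! i]"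
proof -
  have "[0..<3] = [0, 1, 2::nat]" by (simp add: numeral_3_eq_3 numeral_2_eq_2 One_nat_def)
  then show ?thesis using assms by (simp add: permute_list_def)
qed

lemma list_by_length:
  "length xs = 1 \<Longrightarrow> xs = [xs ! 0]" "length xs = 2 \<Longrightarrow> xs = [xs ! 0, xs ! 1]"
  "length xs = 4 \<Longrightarrow> xs = [xs ! 0, xs ! 1, xs ! 2, xs ! 3]"
  by (auto simp: eval_nat_numeral length_Suc_conv One_nat_def)

text \<open>Failure of \<open>T_stmt\<close> leaves \<open>2 * degA + degB \<le> 4\<close> and a
  nonzero form \<open>F\<close> killed by all functionals. Each kernel lemma applied to
  \<open>F\<close> rules out some shapes of \<open>n\<close> and \<open>a\<close>; what remains is
  the list of exceptions.\<close>

lemma exceptional_of_not_T: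
  fixes n a :: "nat list"
  assumes len: "length n = k" "length a = k" "1 \<le> k"
    and n1: "\<forall>i<k. 1 \<le> n ! i" and a1: "\<forall>i<k. 1 \<le> a ! i"
    and notT: "\<not> T_stmt n a 3"
  shows "\<exists>\<sigma>. \<sigma> permutes {..<k} \<and> exceptional (permute_list \<sigma> n) (permute_list \<sigma> a)"
proof -
  interpret three_points "{..<k}" "nth n" "nth a"
    by unfold_locales (use n1 a1 in auto)
  have not5: "2 * degA + degB \<le> 4"
    using general_hilbert_of_cases notT len(1) unfolding T_stmt_general by fastforce
  obtain F t where F: "F \<in> forms {..<k} (nth n) (nth a)" "\<And>p. p \<in> Q \<Longrightarrow> clf (dpt pt p) F = 0"
    and t: "t \<in> Mon" "lkp F t \<noteq> 0"
    using general_hilbert_of_cases notT len(1) unfolding T_stmt_general by blast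
  note deg = deg_sum
  define d where "d = sum (nth a) {..<k}"
  have dAB: "d = degA + degB" using deg by (simp add: d_def)
  have c1: "2 \<le> d" using kernel_degree_1[OF F _ t(1)] t(2) unfolding d_def by linarith
  have c2: "3 \<le> n ! i" if "d \<le> 2" "i < k" for i
    using kernel_degree_2[OF F, of i t] t that unfolding d_def by fastforce
  have kd: "k \<le> d"
    using sum_mono[of "{..<k}" "\<lambda>_. 1" "nth a"] a1 by (simp add: d_def)
  have idI: ?thesis if "exceptional n a"
    using that permutes_id[of "{..<k}"] by (intro exI[of _ id]) simp
  have A0: "A = {}" if "degA = 0"
  proof (rule ccontr)
    assume "A \<noteq> {}"
    then obtain i where i: "i \<in> A" by blast
    then have "1 \<le> a ! i" using a1 by (auto simp: A_def)
    then show False using member_le_sum[of i A "nth a"] AB(1) i that unfolding degA_def by auto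
  qed
  have B0: "B = {}" if "degB = 0"
  proof (rule ccontr)
    assume "B \<noteq> {}"
    then obtain i where i: "i \<in> B" by blast
    then have "1 \<le> a ! i" using a1 by (auto simp: B_def)
    then show False using member_le_sum[of i B "nth a"] AB(2) i that unfolding degB_def by auto
  qed
  have tr: "Transposition.transpose i 2 permutes {..<3}" if "i < 3" for i :: nat
    using that by (intro permutes_swap_id) auto
  consider "degA = 0" | "degA = 1" | "degA = 2" "degB = 0" using not5 by linarith
  then show ?thesis
  proof cases
    case 1
    then have A: "A = {}" by (rule A0)
    then have all1: "n ! i = 1" if "i < k" for i using AB(3) that by (auto simp: B_def)
    have "d \<noteq> 3" using kernel_lines_3[OF F A _ t(1)] t(2) unfolding d_def by blast
    moreover have "d \<noteq> 2" using c2[of 0] all1[of 0] len(3) by auto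
    ultimately have d: "d = 4" using c1 dAB 1 not5 by linarith
    then have c4: "\<not> ((\<exists>b. {..<k} = {b}) \<or> (\<exists>b b'. {..<k} = {b, b'} \<and> b \<noteq> b' \<and> a ! b = 1))"
      using kernel_lines_4[OF F A _ _ t(1)] t(2) unfolding d_def by blast
    have "k = 1 \<or> k = 2 \<or> k = 3 \<or> k = 4" using kd d len(3) by linarith
    then show ?thesis
    proof (elim disjE)
      assume "k = 1"
      then show ?thesis using c4 lessThan_small(1) by auto
    next
      assume k: "k = 2"
      then have "a ! 0 + a ! 1 = 4" using d by (simp add: d_def lessThan_small)
      moreover have "a ! 0 \<noteq> 1" "a ! 1 \<noteq> 1"
        using c4 k lessThan_small(2) by (metis insert_commute zero_neq_one)+
      moreover have "1 \<le> a ! 0" "1 \<le> a ! 1" using a1 k by auto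
      ultimately have "a ! 0 = 2" "a ! 1 = 2" by linarith+
      then have "a = [2, 2]" "n = [1, 1]"
        using len k all1[of 0] all1[of 1] list_by_length(2)[of n] list_by_length(2)[of a] by simp_all
      then show ?thesis by (intro idI) (simp add: exceptional_def)
    next
      assume k: "k = 3"
      have s: "a ! 0 + a ! 1 + a ! 2 = 4" using d k by (simp add: d_def lessThan_small)
      moreover have "1 \<le> a ! 0" "1 \<le> a ! 1" "1 \<le> a ! 2" using a1 k by auto
      ultimately have "\<exists>i<3. a ! i = 2 \<and> (\<forall>j<3. j \<noteq> i \<longrightarrow> a ! j = 1)"
      proof -
        have "a ! 0 = 2 \<and> a ! 1 = 1 \<and> a ! 2 = 1 \<or> a ! 0 = 1 \<and> a ! 1 = 2 \<and> a ! 2 = 1 \<or>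
          a ! 0 = 1 \<and> a ! 1 = 1 \<and> a ! 2 = 2"
          using s \<open>1 \<le> a ! 0\<close> \<open>1 \<le> a ! 1\<close> \<open>1 \<le> a ! 2\<close> by linarith
        moreover have "j < 3 \<longleftrightarrow> j = 0 \<or> j = 1 \<or> j = 2" for j :: nat by linarith
        ultimately show ?thesis by auto
      qed
      then obtain i where i: "i < 3" "a ! i = 2" "\<And>j. j < 3 \<Longrightarrow> j \<noteq> i \<Longrightarrow> a ! j = 1" by blast
      \<comment> \<open>The transposition brings the factor of degree 2 to the last place; the other
        two positions receive lines of degree 1.\<close>
      have *: "Transposition.transpose i 2 j < 3" "Transposition.transpose i 2 j \<noteq> i" if "j < 2" for j
        using that i(1) by (auto simp: Transposition.transpose_def)
      have "exceptional (permute_list (Transposition.transpose i 2) n) (permute_list (Transposition.transpose i 2) a)"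
        using permute_list_transpose_last[of i n] permute_list_transpose_last[of i a]
          len k i all1 *[of 0] *[of 1] by (simp add: exceptional_def)
      then show ?thesis using tr[OF i(1)] k by blast
    next
      assume k: "k = 4"
      have s: "a ! 0 + a ! 1 + a ! 2 + a ! 3 = 4" using d k by (simp add: d_def lessThan_small)
      moreover have "1 \<le> a ! 0" "1 \<le> a ! 1" "1 \<le> a ! 2" "1 \<le> a ! 3" using a1 k by auto
      ultimately have "a ! 0 = 1" "a ! 1 = 1" "a ! 2 = 1" "a ! 3 = 1" by linarith+
      then have "a = [1, 1, 1, 1]" "n = [1, 1, 1, 1]"
        using len k all1[of 0] all1[of 1] all1[of 2] all1[of 3]
          list_by_length(3)[of n] list_by_length(3)[of a] by simp_all
      then show ?thesis by (intro idI) (simp add: exceptional_def)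
    qed
  next
    case 2
    then have "A \<noteq> {}" by (auto simp: degA_def)
    then obtain i0 where i0: "i0 \<in> A" by blast
    then have i0k: "i0 < k" "2 \<le> n ! i0" by (auto simp: A_def)
    have sA: "sum (nth a) (A - {i0}) + a ! i0 = 1"
      using 2 AB(1) i0 by (simp add: degA_def sum.remove[of A i0])
    then have ai0: "a ! i0 = 1" using a1 i0k by fastforce
    then have "sum (nth a) (A - {i0}) = 0" using sA by simp
    then have "\<forall>i\<in>A - {i0}. a ! i = 0" using AB(1) by simp
    moreover have "1 \<le> a ! i" if "i \<in> A" for i using that a1 by (auto simp: A_def)
    ultimately have "i = i0" if "i \<in> A" for i
      using that by (metis DiffI not_one_le_zero singletonD)
    then have A: "A = {i0}" using i0 by blast
    \<comment> \<open>With one line of degree 1 the total degree is 2, where every factor must have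
      dimension at least 3.\<close>
    have "degB \<noteq> 1"
    proof
      assume "degB = 1"
      then have "B \<noteq> {}" by (auto simp: degB_def)
      then obtain b where "b < k" "n ! b = 1" by (auto simp: B_def)
      then show False using c2[of b] dAB 2 \<open>degB = 1\<close> by simp
    qed
    moreover have "degB \<noteq> 0" using c1 dAB 2 by simp
    ultimately have dB: "degB = 2" using not5 2 by linarith
    then have d3: "d = 3" using dAB 2 by simp
    have nosing: "\<not> ((\<exists>b. B = {b}) \<or> n ! i0 = 2)"
      using kernel_mixed_3[OF F A ai0 dB _ t(1)] t(2) by blast
    have "card B \<noteq> 0" using dB AB(2) by (auto simp: degB_def)
    moreover have "card B \<noteq> 1" using nosing card_1_singletonE by metis
    moreover have "k = 1 + card B"
    proof -
      have "card {..<k} = card A + card B" using card_Un_disjoint[OF AB(1,2,4)] AB(3) by simp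
      then show ?thesis using A by simp
    qed
    ultimately have k: "k = 3" using kd d3 by linarith
    have ones: "a ! j = 1" if "j < 3" for j
    proof -
      have "a ! 0 + a ! 1 + a ! 2 = 3" using d3 k by (simp add: d_def lessThan_small)
      moreover have "1 \<le> a ! 0" "1 \<le> a ! 1" "1 \<le> a ! 2" using a1 k by auto
      moreover have "j = 0 \<or> j = 1 \<or> j = 2" using that by linarith
      ultimately show ?thesis by auto
    qed
    have nB: "n ! j = 1" if "j < 3" "j \<noteq> i0" for j
    proof -
      have "j \<in> A \<union> B" unfolding AB(3) using that k by simp
      then have "j \<in> B" using A that(2) by blast
      then show ?thesis by (simp add: B_def)
    qed
    have i3: "i0 < 3" using i0k k by simp
    \<comment> \<open>Now the factor of dimension at least 3 is moved to the last place.\<close>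
    have *: "Transposition.transpose i0 2 j < 3" "Transposition.transpose i0 2 j \<noteq> i0" if "j < 2" for j
      using that i3 by (auto simp: Transposition.transpose_def)
    have "3 \<le> n ! i0" using nosing i0k(2) by linarith
    then have "exceptional (permute_list (Transposition.transpose i0 2) n) (permute_list (Transposition.transpose i0 2) a)"
      using permute_list_transpose_last[of i0 n] permute_list_transpose_last[of i0 a]
        len k i3 ones nB *[of 0] *[of 1] by (simp add: exceptional_def)
    then show ?thesis using tr[OF i3] k by blast
  next
    case 3
    then have d: "d = 2" using dAB by simp
    then have n3: "3 \<le> n ! i" if "i < k" for i using c2 that by simp
    have "k = 1 \<or> k = 2" using kd d len(3) by linarith
    then show ?thesis
    proof
      assume k: "k = 1"
      then have "a ! 0 = 2" using d by (simp add: d_def lessThan_small)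
      then have "a = [2]" "n = [n ! 0]"
        using len k list_by_length(1)[of n] list_by_length(1)[of a] by simp_all
      then have "exceptional n a" unfolding exceptional_def using n3[of 0] k by (intro disjI1) auto
      then show ?thesis by (rule idI)
    next
      assume k: "k = 2"
      then have "a ! 0 + a ! 1 = 2" using d by (simp add: d_def lessThan_small)
      moreover have "1 \<le> a ! 0" "1 \<le> a ! 1" using a1 k by auto
      ultimately have "a ! 0 = 1" "a ! 1 = 1" by linarith+
      then have a: "a = [1, 1]" and n: "n = [n ! 0, n ! 1]"
        using len k list_by_length(2)[of n] list_by_length(2)[of a] by simp_all
      have n0: "3 \<le> n ! 0" "3 \<le> n ! 1" using n3 k by auto
      have ex: "exceptional [p, q] [1, 1]" if "3 \<le> p" "p \<le> q" for p q
        unfolding exceptional_def using that by auto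
      show ?thesis
      proof (cases "n ! 0 \<le> n ! 1")
        case True
        then show ?thesis using ex[OF n0(1) True] a n by (metis idI)
      next
        case False
        let ?\<sigma> = "Transposition.transpose 0 (1::nat)"
        have upt: "[0..<2] = [0, 1::nat]" by (simp add: numeral_2_eq_2 One_nat_def)
        have "permute_list ?\<sigma> n = [n ! 1, n ! 0]" "permute_list ?\<sigma> a = [1, 1]"
          using len k \<open>a ! 0 = 1\<close> \<open>a ! 1 = 1\<close> by (simp_all add: permute_list_def upt)
        moreover have "?\<sigma> permutes {..<k}" using k by (intro permutes_swap_id) auto
        ultimately show ?thesis using ex[OF n0(2)] False by (intro exI[of _ ?\<sigma>]) simp
      qed
    qed
  qed
qed

theorem theorem4p5:
  fixes k :: nat and n a :: "nat list"
  assumes "k \<ge> 1" and "length n = k" and "length a = k"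
    and "\<forall>i<k. n ! i \<ge> 1" and "\<forall>i<k. a ! i \<ge> 1"
  shows "T_stmt n a 3 \<longleftrightarrow>
    \<not> (\<exists>\<sigma>. \<sigma> permutes {..<k} \<and> exceptional (permute_list \<sigma> n) (permute_list \<sigma> a))"
  using not_T_exceptional[OF assms(2,3)] exceptional_of_not_T[OF assms(2,3,1,4,5)] by blast

end
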